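(* Suppose that the following three conditions are met. (1) Numbers $m,q\in\{1,2,3,\dots\}$ are fixed and $\hat q=2\lfloor(q+1)/2\rfloor$. Functions $a,b,c\in HC_b^{2m+\hat q-2}(\mathbb{R})$ are given with $\inf_{x\in\mathbb{R}}a(x)>0$. The operator $A$ on $UC_b(\mathbb{R})$ with domain $D(A)=HC_b^2(\mathbb{R})$ is defined by $Au=au''+bu'+cu$. (2) Numbers $T>0$, $M\ge1$ and $\sigma\ge0$ are given. For each $t\in(0,T]$ a bounded linear operator $S(t)$ on $UC_b(\mathbb{R})$ is defined such that $\|S(t)^k\|\le Me^{k\sigma t}$ for all $k=1,2,3,\dots$. (3) There exist a constant $\alpha\le1$ and nonnegative constants $B_0,B_1,\dots,B_{2m+q}$ such that for all $t\in(0,T]$ and all $f\in UC_b^{2m+q}(\mathbb{R})$ $$\Big\|S(t)f-\sum_{k=0}^{m}\frac{t^kA^kf}{k!}\Big\|\le t^{m+\alpha}\sum_{i=0}^{2m+q}B_i\|f^{(i)}\|.$$ Then the following three statements hold. 1. The closure $\overline{A}$ of the operator $A$ in the Banach space $UC_b(\mathbb{R})$ is the generator of a $C_0$-semigroup $(e^{t\overline{A}})_{t\ge0}$ in $UC_b(\mathbb{R})$, and $\|e^{t\overline{A}}\|\le e^{\gamma t}$ for all $t\ge0$, where $\gamma=\sup_{x\in\mathbb{R}}c(x)$. 2. Let $w=\max(\sigma,\gamma,0)$. Then there exist nonnegative constants $C_0,C_1,\dots,C_{2m+\hat q}$, independent of $t$, $T$ and $n$, such that for all $t>0$, all integers $n\ge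 n_{\alpha,t}$ with $n\ge1$ (where $n_{\alpha,t}=t/T$ if $\alpha=1$ and $n_{\alpha,t}=\max(t/T,t)$ if $\alpha<1$) and all $f\in UC_b^{2m+\hat q}(\mathbb{R})$ $$\big\|S(t/n)^nf-e^{t\overline{A}}f\big\|\le\frac{Mt^{m+\alpha}e^{wt}}{n^{m-1+\alpha}}\sum_{i=0}^{2m+\hat q}C_i\|f^{(i)}\|.$$ 3. If $\alpha>1-m$, then for all $\mathcal{T}>0$ and all $g\in UC_b(\mathbb{R})$ $$\lim_{\mathcal{T}/T\le n\to\infty}\ \sup_{t\in(0,\mathcal{T}]}\big\|S(t/n)^ng-e^{t\overline{A}}g\big\|=0,$$ where the limit is taken over integers $n\ge\mathcal{T}/T$.
   Context: $UC_b(\mathbb{R})$ is the Banach space of all bounded uniformly continuous functions $\mathbb{R}\to\mathbb{R}$ with norm $\|f\|=\sup_{x\in\mathbb{R}}|f(x)|$. $UC_b^n(\mathbb{R})$ is the space of all $u\in UC_b(\mathbb{R})$ with $u',\dots,u^{(n)}\in UC_b(\mathbb{R})$. $HC_b(\mathbb{R})$ is the space of all bounded Hölder continuous functions $u\colon\mathbb{R}\to\mathbb{R}$ (with some Hölder exponent in $(0,1]$, which may depend on the function), $HC_b^n(\mathbb{R})$ is the space of all $u\in HC_b(\mathbb{R})$ with $u',\dots,u^{(n)}\in HC_b(\mathbb{R})$, and $HC_b^0=HC_b$. In condition (3), $A^kf$ for $f\in UC_b^{2m+q}(\mathbb{R})$ means the differential expression $u\mapsto au''+bu'+cu$ applied $k$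 times to $f$. *)

theory Defs
  imports "HOL-Analysis.Analysis"
begin

section \<open>The Banach space of bounded uniformly continuous functions\<close>

definition UCb :: "(real \<Rightarrow> real) set" where
  "UCb = {f. bounded (range f) \<and> uniformly_continuous_on UNIV f}"

text \<open>The supremum is only meaningful for bounded \<open>f\<close>.\<close>

definition sup_norm :: "(real \<Rightarrow> real) \<Rightarrow> real" where
  "sup_norm f = (SUP x. \<bar>f x\<bar>)"

lemma abs_le_sup_norm: "bounded (range f) \<Longrightarrow> \<bar>f x\<bar> \<le> sup_norm f"
  unfolding sup_norm_def
  by (rule cSUP_upper) (auto simp: bounded_iff bdd_above_def)

lemma sup_norm_le: "(\<And>x. \<bar>f x\<bar> \<le> K) \<Longrightarrow> sup_norm f \<le> K"
  unfolding sup_norm_def by (rule cSUP_least) auto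

typedef ucb = UCb
  morphisms apply_ucb Ucb
  by (rule exI[of _ "\<lambda>_. 0"]) (auto simp: UCb_def uniformly_continuous_on_const)

setup_lifting type_definition_ucb

lemma ucb_eqI: "(\<And>x. apply_ucb f x = apply_ucb g x) \<Longrightarrow> f = g"
  by (metis apply_ucb_inject ext)

lemma bounded_apply_ucb: "bounded (range (apply_ucb f))"
  using apply_ucb[of f] by (simp add: UCb_def)

lemma uniformly_continuous_apply_ucb: "uniformly_continuous_on UNIV (apply_ucb f)"
  using apply_ucb[of f] by (simp add: UCb_def)

instantiation ucb :: real_normed_vector
begin

lift_definition zero_ucb :: ucb is "\<lambda>_. 0"
  by (auto simp: UCb_def uniformly_continuous_on_const)

lift_definition plus_ucb :: "ucb \<Rightarrow> ucb \<Rightarrow> ucb" is "\<lambda>f g x. f x + g x"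
  by (auto simp: UCb_def intro!: bounded_plus_comp uniformly_continuous_on_add)

lift_definition minus_ucb :: "ucb \<Rightarrow> ucb \<Rightarrow> ucb" is "\<lambda>f g x. f x - g x"
  by (auto simp: UCb_def intro!: bounded_minus_comp uniformly_continuous_on_diff)

lift_definition uminus_ucb :: "ucb \<Rightarrow> ucb" is "\<lambda>f x. - f x"
  by (auto simp: UCb_def uniformly_continuous_on_minus bounded_iff)

lift_definition scaleR_ucb :: "real \<Rightarrow> ucb \<Rightarrow> ucb" is "\<lambda>r f x. r * f x"
proof -
  fix r and f :: "real \<Rightarrow> real"
  assume "f \<in> UCb"
  then show "(\<lambda>x. r * f x) \<in> UCb"
    using bounded_scaleR_comp[of f UNIV r]
    by (auto simp: UCb_def intro!: uniformly_continuous_on_cmul_left)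
qed

lift_definition norm_ucb :: "ucb \<Rightarrow> real" is sup_norm .

definition dist_ucb :: "ucb \<Rightarrow> ucb \<Rightarrow> real" where
  "dist_ucb f g = norm (f - g)"

definition sgn_ucb :: "ucb \<Rightarrow> ucb" where
  "sgn_ucb f = inverse (norm f) *\<^sub>R f"

definition uniformity_ucb :: "(ucb \<times> ucb) filter" where
  "uniformity_ucb = (INF e\<in>{0 <..}. principal {(x, y). dist x y < e})"

definition open_ucb :: "ucb set \<Rightarrow> bool" where
  "open_ucb S = (\<forall>x\<in>S. \<forall>\<^sub>F (x', y) in uniformity. x' = x \<longrightarrow> y \<in> S)"

lemma abs_apply_ucb_le_norm: "\<bar>apply_ucb f x\<bar> \<le> norm f"
  unfolding norm_ucb.rep_eq by (rule abs_le_sup_norm[OF bounded_apply_ucb])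

lemma norm_ucb_le: "(\<And>x. \<bar>apply_ucb f x\<bar> \<le> K) \<Longrightarrow> norm f \<le> K"
  unfolding norm_ucb.rep_eq by (rule sup_norm_le)

instance
proof
  fix r s :: real and f g h :: ucb
  show "dist f g = norm (f - g)" by (rule dist_ucb_def)
  show "sgn f = inverse (norm f) *\<^sub>R f" by (rule sgn_ucb_def)
  show "uniformity = (INF e\<in>{0 <..}. principal {(x, y :: ucb). dist x y < e})"
    by (rule uniformity_ucb_def)
  show "open S = (\<forall>x\<in>S. \<forall>\<^sub>F (x', y) in uniformity. x' = x \<longrightarrow> y \<in> S)" for S :: "ucb set"
    by (rule open_ucb_def)
  show "f + g + h = f + (g + h)" by transfer (simp add: add.assoc)
  show "f + g = g + f" by transfer (simp add: add.commute)
  show "0 + f = f" by transfer simp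
  show "- f + f = 0" by transfer simp
  show "f - g = f + - g" by transfer simp
  show "r *\<^sub>R (f + g) = r *\<^sub>R f + r *\<^sub>R g" by transfer (simp add: algebra_simps)
  show "(r + s) *\<^sub>R f = r *\<^sub>R f + s *\<^sub>R f" by transfer (simp add: algebra_simps)
  show "r *\<^sub>R s *\<^sub>R f = (r * s) *\<^sub>R f" by transfer (simp add: algebra_simps)
  show "1 *\<^sub>R f = f" by transfer simp
  show "norm f = 0 \<longleftrightarrow> f = 0"
  proof
    assume "norm f = 0"
    then have "apply_ucb f x = 0" for x
      using abs_apply_ucb_le_norm[of f x] by simp
    then show "f = 0" by (auto intro!: ucb_eqI simp: zero_ucb.rep_eq)
  qed (simp add: norm_ucb.rep_eq zero_ucb.rep_eq sup_norm_def)
  show "norm (f + g) \<le> norm f + norm g"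
  proof (rule norm_ucb_le)
    fix x
    have "\<bar>apply_ucb (f + g) x\<bar> \<le> \<bar>apply_ucb f x\<bar> + \<bar>apply_ucb g x\<bar>"
      by (simp add: plus_ucb.rep_eq abs_triangle_ineq)
    also have "\<dots> \<le> norm f + norm g"
      by (intro add_mono abs_apply_ucb_le_norm)
    finally show "\<bar>apply_ucb (f + g) x\<bar> \<le> norm f + norm g" .
  qed
  have le: "norm (r *\<^sub>R f) \<le> \<bar>r\<bar> * norm f" for r :: real and f :: ucb
    by (rule norm_ucb_le)
      (auto simp: scaleR_ucb.rep_eq abs_mult intro!: mult_left_mono abs_apply_ucb_le_norm)
  show "norm (r *\<^sub>R f) = \<bar>r\<bar> * norm f"
  proof (cases "r = 0")
    case True
    moreover have "0 *\<^sub>R f = 0" by transfer simp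
    moreover have "norm (0 :: ucb) = 0"
      by (simp add: norm_ucb.rep_eq zero_ucb.rep_eq sup_norm_def)
    ultimately show ?thesis by simp
  next
    case False
    have "inverse r *\<^sub>R r *\<^sub>R f = f"
      using False by transfer (simp add: field_simps)
    then have "norm f \<le> \<bar>inverse r\<bar> * norm (r *\<^sub>R f)"
      using le[of "inverse r" "r *\<^sub>R f"] by simp
    then have "\<bar>r\<bar> * norm f \<le> norm (r *\<^sub>R f)"
      using False by (simp add: field_simps)
    with le[of r f] show ?thesis by simp
  qed
qed

end

instance ucb :: banach
proof
  fix X :: "nat \<Rightarrow> ucb"
  assume X: "Cauchy X"
  have "uniformly_Cauchy_on UNIV (\<lambda>n. apply_ucb (X n))"
    unfolding uniformly_Cauchy_on_def
  proof (intro allI impI)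
    fix e :: real
    assume "e > 0"
    with X obtain N where N: "\<And>m n. m \<ge> N \<Longrightarrow> n \<ge> N \<Longrightarrow> dist (X m) (X n) < e"
      unfolding Cauchy_def by blast
    have "dist (apply_ucb (X m) x) (apply_ucb (X n) x) \<le> dist (X m) (X n)" for m n x
      using abs_apply_ucb_le_norm[of "X m - X n" x]
      by (simp add: dist_norm minus_ucb.rep_eq)
    with N show "\<exists>M. \<forall>x\<in>UNIV. \<forall>m\<ge>M. \<forall>n\<ge>M. dist (apply_ucb (X m) x) (apply_ucb (X n) x) < e"
      by (meson order.strict_trans1)
  qed
  then obtain g where g: "uniform_limit UNIV (\<lambda>n. apply_ucb (X n)) g sequentially"
    using Cauchy_uniformly_convergent uniformly_convergent_on_def by blast
  have close: "\<exists>N. \<forall>n\<ge>N. \<forall>x. dist (apply_ucb (X n) x) (g x) < e" if "e > 0" for e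
    using g that unfolding uniform_limit_sequentially_iff by auto
  have "g \<in> UCb"
    unfolding UCb_def
  proof (intro CollectI conjI)
    obtain n where n: "\<And>x. dist (apply_ucb (X n) x) (g x) < 1"
      using close[of 1] by auto
    have "\<bar>g x\<bar> \<le> norm (X n) + 1" for x
      using n[of x] abs_apply_ucb_le_norm[of "X n" x] by (simp add: dist_real_def)
    then show "bounded (range g)"
      by (auto simp: bounded_iff)
    show "uniformly_continuous_on UNIV g"
      unfolding uniformly_continuous_on_def
    proof (intro allI impI)
      fix e :: real
      assume e: "e > 0"
      then obtain n where n: "\<And>x. dist (apply_ucb (X n) x) (g x) < e / 3"
        using close[of "e / 3"] by auto
      obtain d where d: "d > 0"
        "\<And>x y. dist y x < d \<Longrightarrow> dist (apply_ucb (X n) y) (apply_ucb (X n) x) < e / 3"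
        using uniformly_continuous_apply_ucb[of "X n"] e
        unfolding uniformly_continuous_on_def by (metis UNIV_I divide_pos_pos zero_less_numeral)
      have "dist (g y) (g x) < e" if "dist y x < d" for x y
        using d(2)[OF that] n[of x] n[of y] unfolding dist_real_def by linarith
      with d(1) show "\<exists>d>0. \<forall>x\<in>UNIV. \<forall>y\<in>UNIV. dist y x < d \<longrightarrow> dist (g y) (g x) < e"
        by blast
    qed
  qed
  then have g': "apply_ucb (Ucb g) = g" by (rule Ucb_inverse)
  have "X \<longlonglongrightarrow> Ucb g"
    unfolding lim_sequentially
  proof (intro allI impI)
    fix e :: real
    assume e: "e > 0"
    then obtain N where N: "\<And>n x. n \<ge> N \<Longrightarrow> dist (apply_ucb (X n) x) (g x) < e / 2"
      using close[of "e / 2"] by auto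
    have "dist (X n) (Ucb g) < e" if "n \<ge> N" for n
    proof -
      have "norm (X n - Ucb g) \<le> e / 2"
        using N[OF that]
        by (intro norm_ucb_le) (simp add: minus_ucb.rep_eq g' dist_real_def less_imp_le)
      with e show ?thesis by (simp add: dist_norm)
    qed
    then show "\<exists>N. \<forall>n\<ge>N. dist (X n) (Ucb g) < e" by blast
  qed
  then show "convergent X" by (rule convergentI)
qed


section \<open>Function classes\<close>

text \<open>The Hoelder exponent and constant may depend on the function.\<close>

definition HCb :: "(real \<Rightarrow> real) set" where
  "HCb = {u. bounded (range u) \<and>
     (\<exists>\<theta> L. 0 < \<theta> \<and> \<theta> \<le> 1 \<and> (\<forall>x y. \<bar>u x - u y\<bar> \<le> L * \<bar>x - y\<bar> powr \<theta>))}"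

text \<open>Functions that are \<open>n\<close> times differentiable and belong to \<open>X\<close> together with their first
  \<open>n\<close> derivatives.\<close>

definition with_derivs_in :: "(real \<Rightarrow> real) set \<Rightarrow> nat \<Rightarrow> (real \<Rightarrow> real) set" where
  "with_derivs_in X n =
     {u. (\<forall>i<n. \<forall>x. (deriv ^^ i) u differentiable (at x)) \<and> (\<forall>i\<le>n. (deriv ^^ i) u \<in> X)}"

definition UCb_n :: "nat \<Rightarrow> (real \<Rightarrow> real) set" where
  "UCb_n n = with_derivs_in UCb n"

definition HCb_n :: "nat \<Rightarrow> (real \<Rightarrow> real) set" where
  "HCb_n n = with_derivs_in HCb n"


section \<open>Unbounded operators, semigroups and generators\<close>

text \<open>A possibly unbounded operator on a normed space is represented by its graph, so the closure
  of an operator is the topological closure of the graph in the product space.\<close>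

definition diff_expr ::
    "(real \<Rightarrow> real) \<Rightarrow> (real \<Rightarrow> real) \<Rightarrow> (real \<Rightarrow> real) \<Rightarrow> (real \<Rightarrow> real) \<Rightarrow> real \<Rightarrow> real" where
  "diff_expr a b c u = (\<lambda>x. a x * deriv (deriv u) x + b x * deriv u x + c x * u x)"

definition op_A :: "(real \<Rightarrow> real) \<Rightarrow> (real \<Rightarrow> real) \<Rightarrow> (real \<Rightarrow> real) \<Rightarrow> (ucb \<times> ucb) set" where
  "op_A a b c = {(u, v). apply_ucb u \<in> HCb_n 2 \<and> apply_ucb v = diff_expr a b c (apply_ucb u)}"

text \<open>Only the values at nonnegative times matter.\<close>

definition C0_semigroup :: "(real \<Rightarrow> 'a::banach \<Rightarrow>\<^sub>L 'a) \<Rightarrow> bool" where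
  "C0_semigroup U \<longleftrightarrow>
     U 0 = id_blinfun \<and>
     (\<forall>s\<ge>0. \<forall>t\<ge>0. U (s + t) = U s o\<^sub>L U t) \<and>
     (\<forall>x. continuous_on {0..} (\<lambda>t. U t x))"

definition generator :: "(real \<Rightarrow> 'a::banach \<Rightarrow>\<^sub>L 'a) \<Rightarrow> ('a \<times> 'a) set" where
  "generator U = {(x, y). ((\<lambda>t. (U t x - x) /\<^sub>R t) \<longlongrightarrow> y) (at_right 0)}"

definition blinfun_power :: "('a::real_normed_vector \<Rightarrow>\<^sub>L 'a) \<Rightarrow> nat \<Rightarrow> 'a \<Rightarrow>\<^sub>L 'a" where
  "blinfun_power A k = ((o\<^sub>L) A ^^ k) id_blinfun"

end

(* In dimension one the resolvent equation and elliptic regularity are elementary: u'' can be solved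
   for from A u, and the equation kappa u - A u = f reduces to first order linear equations by a contraction
   argument.  A maximum principle bounds the resolvent by 1 / (kappa - gamma), so by Yosida approximation A
   on UC_b^2 generates a semigroup U; approximating the right-hand side f by Lipschitz functions
   shows that this operator is the closure of A on HC_b^2.

   With s = t/n, the error S(s)^n f - U(t) f telescopes into the terms
   S(s)^(n-1-k) (S(s) - U(s)) U(k s) f.  Each is estimated by comparing S(s) and U(s) with the Taylor
   polynomial, provided that the derivatives of U(k s) f are controlled.  This follows from
   commutation of U with A: the C^(2N) norm is equivalent to the sum of the norms of A^i u for
   i at most N, which is why q is rounded up to an even number. *)
theory Submission
  imports Defs
begin

section \<open>Calculus in the spaces of smooth bounded functions\<close>

text \<open>The order of quantifiers shapes the proof: the constants \<open>C\<close> come before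
  \<open>T\<close> and the family \<open>S\<close>. Hence the semigroup, which depends on
  \<open>a\<close>, \<open>b\<close>, \<open>c\<close> alone, is built beforehand, and the one-step
  estimate speaks of a single vector in place of S(t)f. With N = m + (q + 1) div 2 the coefficients
  have p = 2N - 2 derivatives, exactly what elliptic regularity needs to reach order 2N; since q
  \<ge> 1 gives N \<ge> m + 1, the Taylor remainder, which contains A^(m+1) f, is bounded as well.
  No smoothing property of the parabolic equation is invoked: the flow preserves the domain of A^N,
  and this domain is \<open>UCb_n (2 * N)\<close>. The Hoelder condition enters where the closure of
  the operator with domain \<open>HCb_n 2\<close> is identified; the analysis around it is done in
  \<open>UCb_n\<close>. Generation keeps the sharp rate \<gamma>, possibly negative, whereas the
  error estimate multiplies powers of S by values of U and therefore uses one common rate w \<ge> 0.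
  Convergence for arbitrary data follows from the rate for smooth data by density, because both
  evolutions are bounded uniformly on a bounded time interval.\<close>

lemma UCbI_lipschitz:
  assumes "\<And>x. \<bar>f x\<bar> \<le> K" and "\<And>x y. \<bar>f x - f y\<bar> \<le> L * \<bar>x - y\<bar>"
  shows "f \<in> UCb"
proof -
  have "L \<ge> 0"
    using assms(2)[of 1 0] by simp
  then have "L-lipschitz_on UNIV f"
    by (auto simp: lipschitz_on_def dist_real_def assms(2))
  then show ?thesis
    using assms(1) by (auto simp: UCb_def bounded_iff lipschitz_on_uniformly_continuous)
qed

lemma lipschitz_if_bounded_deriv:
  fixes f f' :: "real \<Rightarrow> real"
  assumes "\<And>x. (f has_field_derivative f' x) (at x)" and "\<And>x. \<bar>f' x\<bar> \<le> L"
  shows "\<bar>f x - f y\<bar> \<le> L * \<bar>x - y\<bar>"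
proof -
  have "norm (f x - f y) \<le> L * norm (x - y)"
    by (rule field_differentiable_bound[of UNIV f f']) (auto simp: assms)
  then show ?thesis by simp
qed

lemma UCbI_deriv:
  assumes "\<And>x. \<bar>f x\<bar> \<le> K" and "\<And>x. (f has_field_derivative f' x) (at x)" and "\<And>x. \<bar>f' x\<bar> \<le> L"
  shows "f \<in> UCb"
  using assms(1) lipschitz_if_bounded_deriv[OF assms(2,3)] by (rule UCbI_lipschitz)

lemma UCb_bounded: "f \<in> UCb \<Longrightarrow> bounded (range f)"
  by (simp add: UCb_def)

lemma UCb_abs_le: "f \<in> UCb \<Longrightarrow> \<bar>f x\<bar> \<le> sup_norm f"
  by (simp add: UCb_def abs_le_sup_norm)

lemma UCb_continuous: "f \<in> UCb \<Longrightarrow> continuous_on UNIV f"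
  by (simp add: UCb_def uniformly_continuous_imp_continuous)

lemma UCb_const [simp]: "(\<lambda>_. k) \<in> UCb"
  by (auto simp: UCb_def uniformly_continuous_on_const)

lemma UCb_add: "f \<in> UCb \<Longrightarrow> g \<in> UCb \<Longrightarrow> (\<lambda>x. f x + g x) \<in> UCb"
  by (auto simp: UCb_def intro!: bounded_plus_comp uniformly_continuous_on_add)

text \<open>The moduli of continuity of \<open>f\<close> and \<open>g\<close> control that of
  \<open>h\<close>. Products and reciprocals are treated through such difference estimates, which
  serve the Hoelder class again later.\<close>

lemma UCbI_dominated:
  assumes f: "f \<in> UCb" and g: "g \<in> UCb" and K: "\<And>x. \<bar>h x\<bar> \<le> K"
    and L: "\<And>x y. \<bar>h x - h y\<bar> \<le> L * (\<bar>f x - f y\<bar> + \<bar>g x - g y\<bar>)"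
  shows "h \<in> UCb"
proof -
  have "uniformly_continuous_on UNIV h"
    unfolding uniformly_continuous_on_def
  proof (intro allI impI)
    fix e :: real assume e: "e > 0"
    define l where "l = \<bar>L\<bar> + 1"
    have l: "L \<le> l" "l > 0" by (auto simp: l_def)
    define e' where "e' = e / 2 / l"
    have e': "e' > 0" and e'': "l * e' = e / 2"
      using e l by (auto simp: e'_def)
    obtain d1 where d1: "d1 > 0" "\<And>x y. dist y x < d1 \<Longrightarrow> dist (f y) (f x) < e'"
      using f e' unfolding UCb_def uniformly_continuous_on_def by auto
    obtain d2 where d2: "d2 > 0" "\<And>x y. dist y x < d2 \<Longrightarrow> dist (g y) (g x) < e'"
      using g e' unfolding UCb_def uniformly_continuous_on_def by auto
    have "dist (h y) (h x) < e" if "dist y x < min d1 d2" for x y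
    proof -
      have "dist (h y) (h x) \<le> L * (\<bar>f y - f x\<bar> + \<bar>g y - g x\<bar>)"
        using L by (simp add: dist_real_def)
      also have "\<dots> \<le> l * (\<bar>f y - f x\<bar> + \<bar>g y - g x\<bar>)"
        using l by (intro mult_right_mono) auto
      also have "\<dots> < l * (e' + e')"
        using d1(2)[of y x] d2(2)[of y x] that l
        by (intro mult_strict_left_mono add_strict_mono) (auto simp: dist_real_def)
      also have "\<dots> = e" unfolding distrib_left[of "l"] e'' by simp
      finally show ?thesis .
    qed
    then show "\<exists>d>0. \<forall>x\<in>UNIV. \<forall>y\<in>UNIV. dist y x < d \<longrightarrow> dist (h y) (h x) < e"
      using d1(1) d2(1) by (intro exI[of _ "min d1 d2"]) auto
  qed
  with K show ?thesis by (auto simp: UCb_def bounded_iff)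
qed

lemma abs_mult_le_sup_norm:
  assumes "f \<in> UCb" "g \<in> UCb"
  shows "\<bar>f x * g x\<bar> \<le> sup_norm f * sup_norm g"
  unfolding abs_mult using UCb_abs_le[OF assms(1)] UCb_abs_le[OF assms(2)]
  by (meson abs_ge_zero mult_mono' order_trans)

lemma abs_mult_diff_le:
  assumes "f \<in> UCb" "g \<in> UCb"
  shows "\<bar>f x * g x - f y * g y\<bar> \<le> (sup_norm f + sup_norm g) * (\<bar>f x - f y\<bar> + \<bar>g x - g y\<bar>)"
proof -
  have "f x * g x - f y * g y = (f x - f y) * g x + f y * (g x - g y)"
    by (simp add: algebra_simps)
  also have "\<bar>\<dots>\<bar> \<le> \<bar>f x - f y\<bar> * \<bar>g x\<bar> + \<bar>f y\<bar> * \<bar>g x - g y\<bar>"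
    by (simp add: abs_mult[symmetric])
  also have "\<dots> \<le> \<bar>f x - f y\<bar> * (sup_norm f + sup_norm g) + (sup_norm f + sup_norm g) * \<bar>g x - g y\<bar>"
    using UCb_abs_le[OF assms(1), of y] UCb_abs_le[OF assms(2), of x]
    by (intro add_mono mult_left_mono mult_right_mono) auto
  finally show ?thesis by (simp add: algebra_simps)
qed

text \<open>The difference on the right is doubled to match the form of
  \<open>UCbI_dominated\<close> with both functions equal to \<open>f\<close>.\<close>

lemma abs_inverse_diff_le:
  fixes f :: "real \<Rightarrow> real"
  assumes k: "k > 0" "\<And>x. k \<le> f x"
  shows "\<bar>1 / f x - 1 / f y\<bar> \<le> (1 / k * (1 / k)) * (\<bar>f x - f y\<bar> + \<bar>f x - f y\<bar>)"
proof -
  have pos: "f x > 0" for x using k(2)[of x] k(1) by linarith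
  have "1 / f x - 1 / f y = (f y - f x) * ((1 / f x) * (1 / f y))"
    using pos[of x] pos[of y] by (simp add: field_simps)
  then have "\<bar>1 / f x - 1 / f y\<bar> = \<bar>f x - f y\<bar> * ((1 / f x) * (1 / f y))"
    using pos[of x] pos[of y] by (simp add: abs_mult abs_minus_commute)
  also have "\<dots> \<le> \<bar>f x - f y\<bar> * (1 / k * (1 / k))"
    using k pos[of x] pos[of y] by (intro mult_left_mono mult_mono frac_le) (auto intro: less_imp_le)
  also have "\<dots> \<le> (1 / k * (1 / k)) * (\<bar>f x - f y\<bar> + \<bar>f x - f y\<bar>)"
    using k by (simp add: algebra_simps divide_right_mono)
  finally show ?thesis .
qed

lemma abs_inverse_le:
  fixes f :: "real \<Rightarrow> real"
  assumes k: "k > 0" "\<And>x. k \<le> f x"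
  shows "\<bar>1 / f x\<bar> \<le> 1 / k"
  using k(1) k(2)[of x] by (simp add: frac_le)

lemma UCb_mult: "f \<in> UCb \<Longrightarrow> g \<in> UCb \<Longrightarrow> (\<lambda>x. f x * g x) \<in> UCb"
  by (rule UCbI_dominated[OF _ _ abs_mult_le_sup_norm abs_mult_diff_le])

lemma UCb_cmult: "f \<in> UCb \<Longrightarrow> (\<lambda>x. k * f x) \<in> UCb"
  by (intro UCb_mult UCb_const)

lemma UCb_minus: "f \<in> UCb \<Longrightarrow> (\<lambda>x. - f x) \<in> UCb"
  using UCb_cmult[of f "-1"] by simp

lemma UCb_diff: "f \<in> UCb \<Longrightarrow> g \<in> UCb \<Longrightarrow> (\<lambda>x. f x - g x) \<in> UCb"
  using UCb_add[of f "\<lambda>x. - g x"] by (simp add: UCb_minus)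

lemma UCb_inverse: "f \<in> UCb \<Longrightarrow> k > 0 \<Longrightarrow> (\<And>x. k \<le> f x) \<Longrightarrow> (\<lambda>x. 1 / f x) \<in> UCb"
  by (rule UCbI_dominated[OF _ _ abs_inverse_le abs_inverse_diff_le])

lemma sup_norm_nonneg: "f \<in> UCb \<Longrightarrow> 0 \<le> sup_norm f"
  using UCb_abs_le[of f 0] by linarith

lemma sup_norm_add: "f \<in> UCb \<Longrightarrow> g \<in> UCb \<Longrightarrow> sup_norm (\<lambda>x. f x + g x) \<le> sup_norm f + sup_norm g"
  by (rule sup_norm_le) (meson UCb_abs_le abs_triangle_ineq add_mono order_trans)

lemma sup_norm_mult: "f \<in> UCb \<Longrightarrow> g \<in> UCb \<Longrightarrow> sup_norm (\<lambda>x. f x * g x) \<le> sup_norm f * sup_norm g"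
  by (rule sup_norm_le) (rule abs_mult_le_sup_norm)

lemma sup_norm_minus: "sup_norm (\<lambda>x. - f x) = sup_norm f"
  by (simp add: sup_norm_def)

section \<open>Hoelder functions and iterated derivatives\<close>

lemma HCb_subset_UCb: "HCb \<subseteq> UCb"
proof
  fix u assume "u \<in> HCb"
  then obtain \<theta> L where bd: "bounded (range u)" and th: "0 < \<theta>"
    and L: "\<And>x y. \<bar>u x - u y\<bar> \<le> L * \<bar>x - y\<bar> powr \<theta>"
    by (auto simp: HCb_def)
  have "uniformly_continuous_on UNIV u"
    unfolding uniformly_continuous_on_def
  proof (intro allI impI)
    fix e :: real assume e: "e > 0"
    \<comment> \<open>\<open>d\<close> solves (|L| + 1) d^\<theta> = e; the added 1 excludes a zero
      divisor.\<close>
    define d where "d = (e / (\<bar>L\<bar> + 1)) powr (1 / \<theta>)"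
    have d: "d > 0" "d powr \<theta> = e / (\<bar>L\<bar> + 1)"
      using e th by (auto simp: d_def powr_powr)
    have "dist (u y) (u x) < e" if "dist y x < d" for x y
    proof -
      have "dist (u y) (u x) \<le> L * \<bar>y - x\<bar> powr \<theta>"
        using L by (simp add: dist_real_def)
      also have "\<dots> \<le> (\<bar>L\<bar> + 1) * \<bar>y - x\<bar> powr \<theta>"
        by (intro mult_right_mono) auto
      also have "\<dots> < (\<bar>L\<bar> + 1) * d powr \<theta>"
        using that th by (intro mult_strict_left_mono powr_less_mono2) (auto simp: dist_real_def)
      also have "\<dots> = e" using d(2) by (simp add: field_simps)
      finally show ?thesis .
    qed
    with d(1) show "\<exists>d>0. \<forall>x\<in>UNIV. \<forall>y\<in>UNIV. dist y x < d \<longrightarrow> dist (u y) (u x) < e"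
      by blast
  qed
  with bd show "u \<in> UCb" by (simp add: UCb_def)
qed

lemma with_derivs_in_0: "with_derivs_in X 0 = X"
  by (simp add: with_derivs_in_def)

text \<open>Peeling off the derivative of lowest order lets inductions on \<open>n\<close> pass from
  \<open>f\<close> to \<open>deriv f\<close>, as the product and reciprocal rules require.\<close>

lemma with_derivs_in_Suc:
  "f \<in> with_derivs_in X (Suc n) \<longleftrightarrow>
     f \<in> X \<and> (\<forall>x. f differentiable (at x)) \<and> deriv f \<in> with_derivs_in X n"
proof -
  have sw: "(deriv ^^ i) (deriv f) = (deriv ^^ Suc i) f" for i
    by (simp only: funpow_Suc_right comp_def)
  have *: "(\<forall>i<Suc n. P i) \<longleftrightarrow> P 0 \<and> (\<forall>i<n. P (Suc i))" "(\<forall>i\<le>Suc n. P i) \<longleftrightarrow> P 0 \<and> (\<forall>i\<le>n. P (Suc i))"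
    for P by (rule All_less_Suc2, unfold less_Suc_eq_le[symmetric], rule All_less_Suc2)
  show ?thesis
    unfolding with_derivs_in_def mem_Collect_eq sw * by auto
qed

lemma UCb_n_0: "UCb_n 0 = UCb"
  by (simp add: UCb_n_def with_derivs_in_0)

lemma UCb_n_SucI:
  assumes "f \<in> UCb" and "\<And>x. (f has_field_derivative f' x) (at x)" and "f' \<in> UCb_n n"
  shows "f \<in> UCb_n (Suc n)"
proof -
  have "deriv f = f'"
    using assms(2) by (auto intro: DERIV_imp_deriv)
  with assms show ?thesis
    by (auto simp: UCb_n_def with_derivs_in_Suc real_differentiable_def)
qed

lemma UCb_n_SucD:
  assumes "f \<in> UCb_n (Suc n)"
  shows "f \<in> UCb" "(f has_field_derivative deriv f x) (at x)" "deriv f \<in> UCb_n n"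
  using assms by (auto simp: UCb_n_def with_derivs_in_Suc DERIV_deriv_iff_real_differentiable)

lemma UCb_n_mono: "m \<le> n \<Longrightarrow> f \<in> UCb_n n \<Longrightarrow> f \<in> UCb_n m"
  by (auto simp: UCb_n_def with_derivs_in_def)

lemma UCb_n_UCb: "f \<in> UCb_n n \<Longrightarrow> f \<in> UCb"
  using UCb_n_mono[of 0 n f] by (simp add: UCb_n_0)

lemma UCb_n_deriv_pow: "f \<in> UCb_n n \<Longrightarrow> i \<le> n \<Longrightarrow> (deriv ^^ i) f \<in> UCb"
  by (auto simp: UCb_n_def with_derivs_in_def)

lemma HCb_n_subset_UCb_n: "HCb_n n \<subseteq> UCb_n n"
  using HCb_subset_UCb by (auto simp: UCb_n_def HCb_n_def with_derivs_in_def)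

section \<open>The C^n norm\<close>

definition cnorm :: "nat \<Rightarrow> (real \<Rightarrow> real) \<Rightarrow> real" where
  "cnorm n f = (\<Sum>i = 0..n. sup_norm ((deriv ^^ i) f))"

lemma cnorm_0: "cnorm 0 f = sup_norm f"
  by (simp add: cnorm_def)

lemma cnorm_Suc: "cnorm (Suc n) f = sup_norm f + cnorm n (deriv f)"
  unfolding cnorm_def sum.atLeast0_atMost_Suc_shift
  by (simp add: funpow_Suc_right del: funpow.simps)

lemma cnorm_nonneg: "f \<in> UCb_n n \<Longrightarrow> 0 \<le> cnorm n f"
  unfolding cnorm_def by (intro sum_nonneg sup_norm_nonneg) (auto dest: UCb_n_deriv_pow)

lemma cnorm_mono: "f \<in> UCb_n n \<Longrightarrow> m \<le> n \<Longrightarrow> cnorm m f \<le> cnorm n f"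
  unfolding cnorm_def by (intro sum_mono2 sup_norm_nonneg) (auto dest: UCb_n_deriv_pow)

lemma sup_norm_deriv_pow_le: "f \<in> UCb_n n \<Longrightarrow> i \<le> n \<Longrightarrow> sup_norm ((deriv ^^ i) f) \<le> cnorm n f"
  unfolding cnorm_def by (rule member_le_sum) (auto dest: UCb_n_deriv_pow intro!: sup_norm_nonneg)

lemma sup_norm_le_cnorm: "f \<in> UCb_n n \<Longrightarrow> sup_norm f \<le> cnorm n f"
  using sup_norm_deriv_pow_le[of f n 0] by simp

lemma UCb_n_const: "(\<lambda>_. k) \<in> UCb_n n"
proof (induction n arbitrary: k)
  case (Suc n)
  show ?case by (rule UCb_n_SucI[OF _ _ Suc[of 0]]) auto
qed (simp add: UCb_n_0)

lemma UCb_n_add: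
  "f \<in> UCb_n n \<Longrightarrow> g \<in> UCb_n n \<Longrightarrow>
    (\<lambda>x. f x + g x) \<in> UCb_n n \<and> cnorm n (\<lambda>x. f x + g x) \<le> cnorm n f + cnorm n g"
proof (induction n arbitrary: f g)
  case 0
  then show ?case by (auto simp: UCb_n_0 cnorm_0 UCb_add sup_norm_add)
next
  case (Suc n)
  note f = UCb_n_SucD[OF Suc.prems(1)] and g = UCb_n_SucD[OF Suc.prems(2)]
  have d: "((\<lambda>x. f x + g x) has_field_derivative deriv f x + deriv g x) (at x)" for x
    by (intro DERIV_add f(2) g(2))
  have de: "deriv (\<lambda>x. f x + g x) = (\<lambda>x. deriv f x + deriv g x)"
    using d by (auto intro: DERIV_imp_deriv)
  note IH = Suc.IH[OF f(3) g(3)]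
  show ?case
    using UCb_n_SucI[OF UCb_add[OF f(1) g(1)] d conjunct1[OF IH]] conjunct2[OF IH] sup_norm_add[OF f(1) g(1)]
    by (auto simp: cnorm_Suc de)
qed

text \<open>Each derivative splits a product into two, which accounts for the factor 2^n.\<close>

lemma UCb_n_mult:
  "f \<in> UCb_n n \<Longrightarrow> g \<in> UCb_n n \<Longrightarrow>
    (\<lambda>x. f x * g x) \<in> UCb_n n \<and> cnorm n (\<lambda>x. f x * g x) \<le> 2 ^ n * cnorm n f * cnorm n g"
proof (induction n arbitrary: f g)
  case 0
  then show ?case by (auto simp: UCb_n_0 cnorm_0 UCb_mult sup_norm_mult)
next
  case (Suc n)
  note f = UCb_n_SucD[OF Suc.prems(1)] and g = UCb_n_SucD[OF Suc.prems(2)]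
  have fn: "f \<in> UCb_n n" and gn: "g \<in> UCb_n n"
    using Suc.prems UCb_n_mono[of n "Suc n"] by auto
  have d: "((\<lambda>x. f x * g x) has_field_derivative deriv f x * g x + f x * deriv g x) (at x)" for x
    using DERIV_mult[OF f(2) g(2)] by (simp add: mult.commute add.commute)
  have de: "deriv (\<lambda>x. f x * g x) = (\<lambda>x. deriv f x * g x + f x * deriv g x)"
    using d by (auto intro: DERIV_imp_deriv)
  note I1 = Suc.IH[OF f(3) gn] and I2 = Suc.IH[OF fn g(3)]
  note I3 = UCb_n_add[OF conjunct1[OF I1] conjunct1[OF I2]]
  define F0 F1 G0 G1 p where "F0 = sup_norm f" "F1 = cnorm n (deriv f)"
    "G0 = sup_norm g" "G1 = cnorm n (deriv g)" "p = (2::real) ^ n"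
  note D = this
  have nn: "0 \<le> F0" "0 \<le> F1" "0 \<le> G0" "0 \<le> G1"
    unfolding D using f g by (auto intro: sup_norm_nonneg cnorm_nonneg)
  have p: "p \<ge> 1" by (simp add: D)
  have "cnorm (Suc n) (\<lambda>x. f x * g x) \<le> F0 * G0 + (p * F1 * cnorm n g + p * cnorm n f * G1)"
    unfolding cnorm_Suc de using sup_norm_mult[OF f(1) g(1)] I1 I2 I3 unfolding D by linarith
  also have "\<dots> \<le> p * (F0 * G0) + (p * F1 * (G0 + G1) + p * (F0 + F1) * G1)"
  proof (intro add_mono mult_left_mono mult_right_mono)
    show "F0 * G0 \<le> p * (F0 * G0)"
      using mult_right_mono[OF p, of "F0 * G0"] nn by simp
    show "cnorm n g \<le> G0 + G1" "cnorm n f \<le> F0 + F1"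
      using cnorm_mono[OF Suc.prems(1), of n] cnorm_mono[OF Suc.prems(2), of n] by (auto simp: D cnorm_Suc)
  qed (use nn p in auto)
  also have "\<dots> \<le> 2 * p * (F0 + F1) * (G0 + G1)"
    using nn p mult_nonneg_nonneg[of p "F0 * G0"] mult_nonneg_nonneg[of p "F0 * G1"] mult_nonneg_nonneg[of p "F1 * G0"]
    by (simp add: algebra_simps)
  finally have "cnorm (Suc n) (\<lambda>x. f x * g x) \<le> 2 ^ Suc n * cnorm (Suc n) f * cnorm (Suc n) g"
    by (simp add: D cnorm_Suc mult.assoc)
  with UCb_n_SucI[OF UCb_mult[OF f(1) g(1)] d conjunct1[OF I3]] show ?case by blast
qed

lemma UCb_n_minus: "f \<in> UCb_n n \<Longrightarrow> (\<lambda>x. - f x) \<in> UCb_n n \<and> cnorm n (\<lambda>x. - f x) = cnorm n f"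
proof (induction n arbitrary: f)
  case 0
  then show ?case by (auto simp: UCb_n_0 cnorm_0 UCb_minus sup_norm_minus)
next
  case (Suc n)
  note f = UCb_n_SucD[OF Suc.prems(1)]
  have d: "((\<lambda>x. - f x) has_field_derivative - deriv f x) (at x)" for x
    by (intro DERIV_minus f(2))
  have de: "deriv (\<lambda>x. - f x) = (\<lambda>x. - deriv f x)"
    using d by (auto intro: DERIV_imp_deriv)
  note IH = Suc.IH[OF f(3)]
  show ?case
    using UCb_n_SucI[OF UCb_minus[OF f(1)] d conjunct1[OF IH]] conjunct2[OF IH]
    by (auto simp: cnorm_Suc de sup_norm_minus)
qed

lemma UCb_n_diff:
  assumes "f \<in> UCb_n n" "g \<in> UCb_n n"
  shows "(\<lambda>x. f x - g x) \<in> UCb_n n \<and> cnorm n (\<lambda>x. f x - g x) \<le> cnorm n f + cnorm n g"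
  using UCb_n_add[OF assms(1), of "\<lambda>x. - g x"] UCb_n_minus[OF assms(2)] by simp

text \<open>The derivative -f' (1/f)^2 is a product to which the induction hypothesis applies.
  Membership alone is stated because the reciprocal is later taken of the fixed coefficient
  \<open>a\<close>, whose norm enters as a constant.\<close>

lemma UCb_n_inverse:
  "f \<in> UCb_n n \<Longrightarrow> k > 0 \<Longrightarrow> (\<And>x. k \<le> f x) \<Longrightarrow> (\<lambda>x. 1 / f x) \<in> UCb_n n"
proof (induction n)
  case 0
  then show ?case by (auto simp: UCb_n_0 intro: UCb_inverse)
next
  case (Suc n)
  note f = UCb_n_SucD[OF Suc.prems(1)]
  have I: "(\<lambda>x. 1 / f x) \<in> UCb_n n"
    using Suc UCb_n_mono[of n "Suc n"] by auto
  have nz: "f x \<noteq> 0" for x using Suc.prems(2) Suc.prems(3)[of x] by auto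
  have d: "((\<lambda>x. 1 / f x) has_field_derivative - deriv f x * ((1 / f x) * (1 / f x))) (at x)" for x
    using DERIV_inverse_fun[OF f(2) nz, of x] by (simp add: divide_inverse power2_eq_square mult.assoc)
  show ?case
  proof (rule UCb_n_SucI[OF UCb_inverse[OF f(1) Suc.prems(2,3)] d])
    show "(\<lambda>x. - deriv f x * (1 / f x * (1 / f x))) \<in> UCb_n n"
      using UCb_n_mult[of "\<lambda>x. - deriv f x" n "\<lambda>x. 1 / f x * (1 / f x)"] UCb_n_minus[OF f(3)] UCb_n_mult[OF I I] by blast
  qed
qed

section \<open>Second order differential expressions\<close>

text \<open>Within distance \<open>h\<close> of x the mean value theorem yields a point where u'
  equals a difference quotient, at most 2U/h; from there u' moves by at most hV. As \<open>h\<close>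
  is free, u' is bounded with an arbitrarily small share of u''.\<close>

lemma interpolation_first_deriv:
  fixes u u' u'' :: "real \<Rightarrow> real"
  assumes u: "\<And>x. \<bar>u x\<bar> \<le> U" and u'': "\<And>x. \<bar>u'' x\<bar> \<le> V" and h: "h > 0"
    and d: "\<And>x. (u has_field_derivative u' x) (at x)" "\<And>x. (u' has_field_derivative u'' x) (at x)"
  shows "\<bar>u' x\<bar> \<le> 2 * U / h + h * V"
proof -
  obtain z where z: "x < z" "z < x + h" "u (x + h) - u x = (x + h - x) * u' z"
    using MVT2[of x "x + h" u u'] d(1) h by auto
  have "V \<ge> 0" using u''[of 0] by linarith
  have "\<bar>u' x - u' z\<bar> \<le> V * \<bar>x - z\<bar>"
    by (rule lipschitz_if_bounded_deriv[OF d(2) u''])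
  also have "\<dots> \<le> V * h"
    using z \<open>V \<ge> 0\<close> by (intro mult_left_mono) auto
  finally have 1: "\<bar>u' x - u' z\<bar> \<le> V * h" .
  have "h * \<bar>u' z\<bar> = \<bar>u (x + h) - u x\<bar>"
    using z(3) h by (simp add: abs_mult)
  also have "\<dots> \<le> 2 * U" using u[of x] u[of "x + h"] by linarith
  finally have "\<bar>u' z\<bar> \<le> 2 * U / h" using h by (simp add: field_simps)
  with 1 show ?thesis by (simp add: mult.commute)
qed

lemma UCb_n_2D:
  assumes "u \<in> UCb_n (n + 2)"
  shows "u \<in> UCb_n n" "deriv u \<in> UCb_n n" "deriv (deriv u) \<in> UCb_n n"
    "(u has_field_derivative deriv u x) (at x)" "(deriv u has_field_derivative deriv (deriv u) x) (at x)"
proof -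
  have u: "u \<in> UCb_n (Suc (Suc n))" using assms by simp
  note 1 = UCb_n_SucD[OF u] note 2 = UCb_n_SucD[OF 1(3)]
  show "u \<in> UCb_n n" using u UCb_n_mono[of n "Suc (Suc n)"] by simp
  show "deriv u \<in> UCb_n n" using 1(3) UCb_n_mono[of n "Suc n"] by simp
  show "deriv (deriv u) \<in> UCb_n n" by (rule 2(3))
  show "(u has_field_derivative deriv u x) (at x)" by (rule 1(2))
  show "(deriv u has_field_derivative deriv (deriv u) x) (at x)" by (rule 2(2))
qed

lemma UCb_2D:
  assumes "u \<in> UCb_n 2"
  shows "u \<in> UCb" "deriv u \<in> UCb" "deriv (deriv u) \<in> UCb"
    "(u has_field_derivative deriv u x) (at x)" "(deriv u has_field_derivative deriv (deriv u) x) (at x)"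
proof -
  have "u \<in> UCb_n (0 + 2)" using assms by (simp add: numeral_2_eq_2)
  from UCb_n_2D[OF this] show "u \<in> UCb" "deriv u \<in> UCb" "deriv (deriv u) \<in> UCb"
    "(u has_field_derivative deriv u x) (at x)" "(deriv u has_field_derivative deriv (deriv u) x) (at x)"
    by (auto simp: UCb_n_0)
qed

lemma UCb_2I:
  assumes "\<And>x. (u has_field_derivative u' x) (at x)" "\<And>x. (u' has_field_derivative u'' x) (at x)"
    and "u \<in> UCb_n n" "u' \<in> UCb_n n" "u'' \<in> UCb_n n"
  shows "u \<in> UCb_n (n + 2)" "deriv u = u'" "deriv (deriv u) = u''"
proof -
  have "u' \<in> UCb_n (Suc n)"
    using UCb_n_SucI[OF UCb_n_UCb[OF assms(4)] assms(2,5)] .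
  from UCb_n_SucI[OF UCb_n_UCb[OF assms(3)] assms(1) this] show "u \<in> UCb_n (n + 2)" by simp
  show d: "deriv u = u'" using assms(1) by (auto intro: DERIV_imp_deriv)
  show "deriv (deriv u) = u''" unfolding d using assms(2) by (auto intro: DERIV_imp_deriv)
qed

lemma deriv_lincomb:
  assumes "\<And>x. (f has_field_derivative f' x) (at x)" "\<And>x. (g has_field_derivative g' x) (at x)"
  shows "deriv (\<lambda>x. r * f x + s * g x) = (\<lambda>x. r * f' x + s * g' x :: real)"
  by (rule ext, rule DERIV_imp_deriv) (auto intro!: derivative_eq_intros assms)

lemma diff_expr_lincomb:
  assumes "u \<in> UCb_n 2" "v \<in> UCb_n 2"
  shows "diff_expr a b c (\<lambda>x. r * u x + s * v x) = (\<lambda>x. r * diff_expr a b c u x + s * diff_expr a b c v x)"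
  unfolding diff_expr_def deriv_lincomb[OF UCb_2D(4)[OF assms(1)] UCb_2D(4)[OF assms(2)]]
    deriv_lincomb[OF UCb_2D(5)[OF assms(1)] UCb_2D(5)[OF assms(2)]]
  by (auto simp: algebra_simps)

lemma UCb_n_lincomb: "u \<in> UCb_n n \<Longrightarrow> v \<in> UCb_n n \<Longrightarrow> (\<lambda>x. r * u x + s * v x) \<in> UCb_n n"
  using UCb_n_mult[OF UCb_n_const[of r n]] UCb_n_mult[OF UCb_n_const[of s n]] UCb_n_add by blast

text \<open>\<open>p\<close> counts the derivatives of the coefficients and limits the orders below:
  regularity is available up to order p + 2. Constant coefficients with p = 0 give the model
  operator u''.\<close>

locale elliptic =
  fixes a b c :: "real \<Rightarrow> real" and a0 :: real and p :: nat
  assumes a: "a \<in> UCb_n p" and b: "b \<in> UCb_n p" and c: "c \<in> UCb_n p"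
    and a0: "a0 > 0" "\<And>x. a0 \<le> a x"
begin

lemma a_nz: "a x \<noteq> 0" "a x > 0"
  using a0(2)[of x] a0(1) by auto

lemma second_deriv_eq:
  "deriv (deriv u) x = (1 / a x) * (diff_expr a b c u x - (b x * deriv u x + c x * u x))"
  using a_nz(1)[of x] by (simp add: diff_expr_def field_simps)

lemma diff_expr_UCb_n:
  assumes "n \<le> p"
  shows "\<exists>K\<ge>0. \<forall>u \<in> UCb_n (n + 2). diff_expr a b c u \<in> UCb_n n \<and> cnorm n (diff_expr a b c u) \<le> K * cnorm (n + 2) u"
proof (intro exI conjI ballI)
  define K where "K = 2 ^ n * (cnorm n a + cnorm n b + cnorm n c)"
  have abc: "a \<in> UCb_n n" "b \<in> UCb_n n" "c \<in> UCb_n n"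
    using assms a b c UCb_n_mono by blast+
  have nn: "cnorm n a \<ge> 0" "cnorm n b \<ge> 0" "cnorm n c \<ge> 0"
    using abc cnorm_nonneg by auto
  then show "K \<ge> 0" by (simp add: K_def)
  fix u assume u: "u \<in> UCb_n (n + 2)"
  note U = UCb_n_2D[OF u]
  note 1 = UCb_n_mult[OF abc(1) U(3)] note 2 = UCb_n_mult[OF abc(2) U(2)] note 3 = UCb_n_mult[OF abc(3) U(1)]
  note 4 = UCb_n_add[OF conjunct1[OF 1] conjunct1[OF 2]]
  note 5 = UCb_n_add[OF conjunct1[OF 4] conjunct1[OF 3]]
  show "diff_expr a b c u \<in> UCb_n n" unfolding diff_expr_def using 5 by blast
  have "u \<in> UCb_n (Suc (Suc n))" using u by simp
  note s = UCb_n_SucD[OF this]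
  have le: "cnorm n u \<le> cnorm (n + 2) u" "cnorm n (deriv u) \<le> cnorm (n + 2) u"
      "cnorm n (deriv (deriv u)) \<le> cnorm (n + 2) u"
    using cnorm_mono[OF u, of n] cnorm_mono[OF s(3), of n] sup_norm_nonneg[OF s(1)] sup_norm_nonneg[OF UCb_n_UCb[OF s(3)]]
    by (auto simp: cnorm_Suc)
  have "cnorm n (diff_expr a b c u) \<le> 2 ^ n * cnorm n a * cnorm n (deriv (deriv u))
      + 2 ^ n * cnorm n b * cnorm n (deriv u) + 2 ^ n * cnorm n c * cnorm n u"
    unfolding diff_expr_def using 1 2 3 4 5 by linarith
  also have "\<dots> \<le> 2 ^ n * cnorm n a * cnorm (n + 2) u
      + 2 ^ n * cnorm n b * cnorm (n + 2) u + 2 ^ n * cnorm n c * cnorm (n + 2) u"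
    by (intro add_mono mult_left_mono le) (simp_all add: nn)
  also have "\<dots> = K * cnorm (n + 2) u" by (simp add: K_def algebra_simps)
  finally show "cnorm n (diff_expr a b c u) \<le> K * cnorm (n + 2) u" .
qed

text \<open>\<open>j\<close> is the order left after \<open>k\<close> applications. The innermost
  application lands in order j + 2k - 2, and that many derivatives fall on the coefficients, whence
  the bound p + 2.\<close>

lemma diff_expr_pow_UCb_n:
  "j + 2 * k \<le> p + 2 \<Longrightarrow> \<exists>K\<ge>0. \<forall>u \<in> UCb_n (j + 2 * k).
     (diff_expr a b c ^^ k) u \<in> UCb_n j \<and> cnorm j ((diff_expr a b c ^^ k) u) \<le> K * cnorm (j + 2 * k) u"
proof (induction k arbitrary: j)
  case 0
  show ?case by (rule exI[of _ 1]) auto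
next
  case (Suc k)
  obtain K where K: "K \<ge> 0" "\<And>u. u \<in> UCb_n ((j + 2) + 2 * k) \<Longrightarrow>
     (diff_expr a b c ^^ k) u \<in> UCb_n (j + 2) \<and> cnorm (j + 2) ((diff_expr a b c ^^ k) u) \<le> K * cnorm ((j + 2) + 2 * k) u"
    using Suc.IH[of "j + 2"] Suc.prems by auto
  obtain K' where K': "K' \<ge> 0" "\<And>u. u \<in> UCb_n (j + 2) \<Longrightarrow>
     diff_expr a b c u \<in> UCb_n j \<and> cnorm j (diff_expr a b c u) \<le> K' * cnorm (j + 2) u"
    using diff_expr_UCb_n[of j] Suc.prems by auto
  have eq: "j + 2 * Suc k = (j + 2) + 2 * k" by simp
  show ?case
  proof (intro exI[of _ "K' * K"] conjI ballI)
    show "0 \<le> K' * K" using K K' by simp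
    fix u assume u: "u \<in> UCb_n (j + 2 * Suc k)"
    note 1 = K(2)[OF u[unfolded eq]]
    show "(diff_expr a b c ^^ Suc k) u \<in> UCb_n j" using K'(2) 1 by auto
    have "cnorm j ((diff_expr a b c ^^ Suc k) u) \<le> K' * cnorm (j + 2) ((diff_expr a b c ^^ k) u)"
      using K'(2) 1 by auto
    also have "\<dots> \<le> K' * (K * cnorm (j + 2 * Suc k) u)"
      unfolding eq by (intro mult_left_mono conjunct2[OF 1] K'(1))
    finally show "cnorm j ((diff_expr a b c ^^ Suc k) u) \<le> K' * K * cnorm (j + 2 * Suc k) u"
      by (simp add: mult.assoc)
  qed
qed

text \<open>Solving for u'' leaves a term in u', whose interpolation bound contains h times u''; for
  small \<open>h\<close> this is absorbed into the left-hand side.\<close>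

lemma elliptic_estimate_base:
  "\<exists>K\<ge>0. \<forall>u \<in> UCb_n 2. cnorm 2 u \<le> K * (sup_norm (diff_expr a b c u) + sup_norm u)"
proof -
  define B C where "B = sup_norm b" and "C = sup_norm c"
  have bc: "b \<in> UCb" "c \<in> UCb" using b c UCb_n_UCb by auto
  have BC: "B \<ge> 0" "C \<ge> 0" using bc by (auto simp: B_def C_def sup_norm_nonneg)
  \<comment> \<open>Chosen so that B h / a0 \<le> 1/2; the added 1 covers B = 0.\<close>
  define h where "h = a0 / (2 * (B + 1))"
  have h: "h > 0" using a0 BC by (simp add: h_def)
  define \<beta> where "\<beta> = 2 / a0 * (2 * B / h + C)"
  define K where "K = 1 + 2 / h + (1 + h) * (2 / a0 + \<beta>)"
  have \<beta>: "\<beta> \<ge> 0" using a0 BC h by (simp add: \<beta>_def)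
  show ?thesis
  proof (intro exI[of _ K] conjI ballI)
    show "K \<ge> 0" unfolding K_def using h \<beta> a0 by auto
    fix u assume u: "u \<in> UCb_n 2"
    note U = UCb_2D[OF u]
    define F u0 u1 u2 where "F = sup_norm (diff_expr a b c u)" and "u0 = sup_norm u"
      and "u1 = sup_norm (deriv u)" and "u2 = sup_norm (deriv (deriv u))"
    have Lu: "diff_expr a b c u \<in> UCb"
      unfolding diff_expr_def by (intro UCb_add UCb_mult bc U UCb_n_UCb[OF a])
    have nn: "F \<ge> 0" "u0 \<ge> 0" "u1 \<ge> 0" "u2 \<ge> 0"
      unfolding F_def u0_def u1_def u2_def by (intro sup_norm_nonneg Lu U)+
    have i: "u1 \<le> 2 * u0 / h + h * u2"
      unfolding u1_def u0_def u2_def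
      by (intro sup_norm_le interpolation_first_deriv[OF _ _ h U(4,5)] UCb_abs_le U)
    have "\<bar>deriv (deriv u) x\<bar> \<le> (1 / a0) * (F + (B * u1 + C * u0))" for x
      unfolding second_deriv_eq[of u x] abs_mult
    proof (intro mult_mono)
      show "\<bar>1 / a x\<bar> \<le> 1 / a0" using a0 a_nz[of x] by (simp add: frac_le)
      have "\<bar>diff_expr a b c u x\<bar> \<le> F" "\<bar>b x * deriv u x\<bar> \<le> B * u1" "\<bar>c x * u x\<bar> \<le> C * u0"
        unfolding F_def B_def C_def u1_def u0_def by (intro UCb_abs_le abs_mult_le_sup_norm Lu bc U)+
      then show "\<bar>diff_expr a b c u x - (b x * deriv u x + c x * u x)\<bar> \<le> F + (B * u1 + C * u0)" by linarith
    qed (use a0 in auto)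
    then have "u2 \<le> (1 / a0) * (F + (B * u1 + C * u0))"
      unfolding u2_def by (rule sup_norm_le)
    also have "\<dots> \<le> (1 / a0) * (F + (B * (2 * u0 / h + h * u2) + C * u0))"
      using a0 i BC by (intro mult_left_mono add_mono) auto
    also have "\<dots> = (1 / a0) * F + (1 / a0) * (2 * B / h + C) * u0 + (B * h / a0) * u2"
      by (simp add: algebra_simps add_divide_distrib)
    also have "(B * h / a0) * u2 \<le> 1 / 2 * u2"
    proof (rule mult_right_mono[OF _ nn(4)])
      have "B * h / a0 = B / (2 * (B + 1))"
        using a0(1) by (simp add: h_def)
      also have "\<dots> \<le> 1 / 2"
        using BC by (simp add: divide_simps)
      finally show "B * h / a0 \<le> 1 / 2" .
    qed
    finally have "u2 \<le> (1 / a0) * F + (1 / a0) * (2 * B / h + C) * u0 + 1 / 2 * u2" by simp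
    then have "u2 \<le> 2 * ((1 / a0) * F + (1 / a0) * (2 * B / h + C) * u0)" by simp
    also have "\<dots> = 2 / a0 * F + \<beta> * u0"
      by (simp add: \<beta>_def algebra_simps)
    finally have u2: "u2 \<le> 2 / a0 * F + \<beta> * u0" .
    have "cnorm 2 u = u0 + u1 + u2"
      by (simp add: numeral_2_eq_2 cnorm_Suc cnorm_0 u0_def u1_def u2_def)
    also have "\<dots> \<le> u0 + 2 * u0 / h + (1 + h) * u2" using i by (simp add: algebra_simps)
    also have "\<dots> \<le> u0 + 2 * u0 / h + (1 + h) * (2 / a0 * F + \<beta> * u0)"
      using u2 h by (intro add_left_mono mult_left_mono) auto
    \<comment> \<open>The added nonnegative terms have the roles of \<open>F\<close> and
      \<open>u0\<close> exchanged, so that the sum factors as K (F + u0).\<close>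
    also have "\<dots> \<le> u0 + 2 * u0 / h + (1 + h) * (2 / a0 * F + \<beta> * u0)
        + (F + 2 * F / h + (1 + h) * (2 / a0 * u0 + \<beta> * F))"
      using nn h \<beta> a0 by (simp add: add_nonneg_nonneg)
    also have "\<dots> = K * (F + u0)" by (simp add: K_def algebra_simps add_divide_distrib)
    finally show "cnorm 2 u \<le> K * (sup_norm (diff_expr a b c u) + sup_norm u)"
      by (simp add: F_def u0_def)
  qed
qed

text \<open>Bootstrapping: once u has n + 2 derivatives, every term in the formula for u'' has n +
  1, hence so does u''. Smoothness beyond order 2 is a conclusion, which is what makes the estimate
  applicable to orbits of the semigroup.\<close>

lemma elliptic_estimate:
  "n \<le> p \<Longrightarrow> \<exists>K\<ge>0. \<forall>u \<in> UCb_n 2. diff_expr a b c u \<in> UCb_n n \<longrightarrow>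
     u \<in> UCb_n (n + 2) \<and> cnorm (n + 2) u \<le> K * (cnorm n (diff_expr a b c u) + sup_norm u)"
proof (induction n)
  case 0
  show ?case using elliptic_estimate_base by (auto simp add: cnorm_0 numeral_2_eq_2)
next
  case (Suc n)
  define N where "N = Suc n"
  have abc: "a \<in> UCb_n N" "b \<in> UCb_n N" "c \<in> UCb_n N"
    using Suc.prems a b c UCb_n_mono unfolding N_def by blast+
  define a' where "a' = (\<lambda>x. 1 / a x)"
  have a': "a' \<in> UCb_n N" unfolding a'_def by (rule UCb_n_inverse[OF abc(1) a0])
  obtain K where K: "K \<ge> 0" "\<And>u. u \<in> UCb_n 2 \<Longrightarrow> diff_expr a b c u \<in> UCb_n n \<Longrightarrow>
     u \<in> UCb_n (n + 2) \<and> cnorm (n + 2) u \<le> K * (cnorm n (diff_expr a b c u) + sup_norm u)"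
    using Suc by auto
  define D where "D = 2 ^ N * (cnorm N b + cnorm N c)"
  define E where "E = 2 ^ N * cnorm N a'"
  have nn: "cnorm N b \<ge> 0" "cnorm N c \<ge> 0" "D \<ge> 0" "E \<ge> 0"
    unfolding D_def E_def using abc a' by (auto intro!: cnorm_nonneg mult_nonneg_nonneg add_nonneg_nonneg)
  show ?case
  proof (intro exI[of _ "2 * K + E * (1 + D * K)"] conjI ballI impI)
    show "2 * K + E * (1 + D * K) \<ge> 0" using nn K(1) by simp
    fix u assume u: "u \<in> UCb_n 2" and F: "diff_expr a b c u \<in> UCb_n (Suc n)"
    define F where "F = diff_expr a b c u"
    have FN: "F \<in> UCb_n N" using F by (simp add: F_def N_def)
    have Fn: "diff_expr a b c u \<in> UCb_n n" using F UCb_n_mono[of n "Suc n"] by simp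
    note 1 = K(2)[OF u Fn]
    then have un: "u \<in> UCb_n (Suc N)" by (simp add: N_def)
    have u0: "u \<in> UCb_n N" using un UCb_n_mono[of N "Suc N"] by simp
    have u1: "deriv u \<in> UCb_n N" using UCb_n_SucD[OF un] by simp
    note b1 = UCb_n_mult[OF abc(2) u1] note c1 = UCb_n_mult[OF abc(3) u0]
    note bc = UCb_n_add[OF conjunct1[OF b1] conjunct1[OF c1]]
    note Fbc = UCb_n_diff[OF FN conjunct1[OF bc]]
    note aF = UCb_n_mult[OF a' conjunct1[OF Fbc]]
    have dd: "deriv (deriv u) = (\<lambda>x. a' x * (F x - (b x * deriv u x + c x * u x)))"
      by (rule ext) (simp add: a'_def F_def second_deriv_eq)
    have ddN: "deriv (deriv u) \<in> UCb_n N" unfolding dd using aF by blast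
    show "u \<in> UCb_n (Suc n + 2)"
      using UCb_2I(1)[OF UCb_2D(4)[OF u] UCb_2D(5)[OF u] u0 u1 ddN] by (simp add: N_def)
    \<comment> \<open>\<open>X\<close> is bounded by the induction hypothesis and dominates both u
      and u' at the order N = n + 1.\<close>
    define X where "X = cnorm (n + 2) u"
    have X: "cnorm N (deriv u) \<le> X" "cnorm N u \<le> X" "sup_norm u + cnorm N (deriv u) = X"
    proof -
      show *: "sup_norm u + cnorm N (deriv u) = X"
        by (simp add: X_def cnorm_Suc N_def)
      show "cnorm N (deriv u) \<le> X" using * sup_norm_nonneg[OF UCb_n_UCb[OF u]] by linarith
      show "cnorm N u \<le> X" using cnorm_mono[OF un, of N] by (simp add: X_def N_def)
    qed
    have "cnorm N (\<lambda>x. F x - (b x * deriv u x + c x * u x)) \<le>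
        cnorm N F + (2 ^ N * cnorm N b * cnorm N (deriv u) + 2 ^ N * cnorm N c * cnorm N u)"
      using b1 c1 bc Fbc by linarith
    also have "\<dots> \<le> cnorm N F + (2 ^ N * cnorm N b * X + 2 ^ N * cnorm N c * X)"
      using nn X by (intro add_mono mult_left_mono) auto
    also have "\<dots> = cnorm N F + D * X" by (simp add: D_def algebra_simps)
    finally have *: "cnorm N (\<lambda>x. F x - (b x * deriv u x + c x * u x)) \<le> cnorm N F + D * X" .
    have "cnorm N (deriv (deriv u)) \<le> E * cnorm N (\<lambda>x. F x - (b x * deriv u x + c x * u x))"
      unfolding dd E_def using aF by blast
    also have "\<dots> \<le> E * (cnorm N F + D * X)" by (intro mult_left_mono * nn)
    finally have "cnorm (Suc n + 2) u \<le> 2 * X + E * (cnorm N F + D * X)"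
      using X(1) sup_norm_nonneg[OF UCb_n_UCb[OF u]] X(3) sup_norm_le_cnorm[OF u1] sup_norm_nonneg[OF UCb_n_UCb[OF u1]] by (simp add: cnorm_Suc N_def)
    also have "\<dots> \<le> 2 * (K * (cnorm N F + sup_norm u)) + E * ((cnorm N F + sup_norm u) + D * (K * (cnorm N F + sup_norm u)))"
    proof -
      have "X \<le> K * (cnorm n F + sup_norm u)" using 1 by (simp add: X_def F_def)
      also have "\<dots> \<le> K * (cnorm N F + sup_norm u)"
        using cnorm_mono[OF FN, of n] by (intro mult_left_mono K(1)) (simp add: N_def)
      finally have X': "X \<le> K * (cnorm N F + sup_norm u)" .
      show ?thesis
        using X' nn sup_norm_nonneg[OF UCb_n_UCb[OF u]] by (intro add_mono mult_left_mono) auto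
    qed
    also have "\<dots> = (2 * K + E * (1 + D * K)) * (cnorm N F + sup_norm u)" by (simp add: algebra_simps)
    finally show "cnorm (Suc n + 2) u \<le> (2 * K + E * (1 + D * K)) * (cnorm (Suc n) (diff_expr a b c u) + sup_norm u)"
      by (simp add: F_def N_def)
  qed
qed

text \<open>The estimate of order 2k is applied to u and the induction hypothesis to Au, whose
  iterates are those of u shifted by one.\<close>

lemma cnorm_le_diff_expr_pow:
  "2 * k \<le> p + 2 \<Longrightarrow> \<exists>K\<ge>0. \<forall>u \<in> UCb_n (2 * k).
     cnorm (2 * k) u \<le> K * (\<Sum>i\<le>k. sup_norm ((diff_expr a b c ^^ i) u))"
proof (induction k)
  case 0
  show ?case by (rule exI[of _ 1]) (simp add: cnorm_0)
next
  case (Suc k)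
  obtain K where K: "K \<ge> 0" "\<And>u. u \<in> UCb_n (2 * k) \<Longrightarrow>
     cnorm (2 * k) u \<le> K * (\<Sum>i\<le>k. sup_norm ((diff_expr a b c ^^ i) u))"
    using Suc by auto
  obtain E where E: "E \<ge> 0" "\<And>u. u \<in> UCb_n 2 \<Longrightarrow> diff_expr a b c u \<in> UCb_n (2 * k) \<Longrightarrow>
     u \<in> UCb_n (2 * k + 2) \<and> cnorm (2 * k + 2) u \<le> E * (cnorm (2 * k) (diff_expr a b c u) + sup_norm u)"
    using elliptic_estimate[of "2 * k"] Suc.prems by auto
  show ?case
  proof (intro exI[of _ "E * (K + 1)"] conjI ballI)
    show "E * (K + 1) \<ge> 0" using E K by simp
    fix u assume "u \<in> UCb_n (2 * Suc k)"
    then have u: "u \<in> UCb_n (2 * k + 2)" by simp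
    have u2: "u \<in> UCb_n 2" using UCb_n_mono[OF _ u, of 2] by simp
    have Au: "diff_expr a b c u \<in> UCb_n (2 * k)" using diff_expr_UCb_n[of "2 * k"] u Suc.prems by auto
    define S where "S = (\<Sum>i\<le>k. sup_norm ((diff_expr a b c ^^ i) (diff_expr a b c u)))"
    have "S \<ge> 0" unfolding S_def
    proof (intro sum_nonneg sup_norm_nonneg)
      fix i assume "i \<in> {..k}"
      then have "diff_expr a b c u \<in> UCb_n (0 + 2 * i)" using Au UCb_n_mono[of "2 * i" "2 * k"] by simp
      then show "(diff_expr a b c ^^ i) (diff_expr a b c u) \<in> UCb"
        using diff_expr_pow_UCb_n[of 0 i] \<open>i \<in> {..k}\<close> Suc.prems by (auto simp: UCb_n_0)
    qed
    have S: "(\<Sum>i\<le>Suc k. sup_norm ((diff_expr a b c ^^ i) u)) = sup_norm u + S"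
      unfolding S_def sum.atMost_Suc_shift by (simp add: funpow_Suc_right del: funpow.simps)
    have "cnorm (2 * k + 2) u \<le> E * (K * S + sup_norm u)"
      using E(2)[OF u2 Au] mult_left_mono[OF add_right_mono[OF K(2)[OF Au], of "sup_norm u"] E(1)]
      unfolding S_def by linarith
    also have "\<dots> \<le> E * ((K + 1) * (sup_norm u + S))"
      using E(1) K(1) \<open>S \<ge> 0\<close> sup_norm_nonneg[OF UCb_n_UCb[OF u]]
      by (intro mult_left_mono) (auto simp: algebra_simps)
    finally show "cnorm (2 * Suc k) u \<le> E * (K + 1) * (\<Sum>i\<le>Suc k. sup_norm ((diff_expr a b c ^^ i) u))"
      unfolding S by (simp add: mult.assoc)
  qed
qed

end

section \<open>Averages and density of smooth functions\<close>

text \<open>Antiderivatives take the place of integrals: averages are difference quotients of one,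
  and the variation of constants formula is written with another.\<close>

lemma continuous_antiderivative:
  fixes f :: "real \<Rightarrow> real"
  assumes "continuous_on UNIV f"
  obtains F where "\<And>x. (F has_field_derivative f x) (at x)"
proof -
  have "\<exists>F. \<forall>x. -\<infinity> < ereal x \<longrightarrow> ereal x < \<infinity> \<longrightarrow> (F has_vector_derivative f x) (at x)"
    by (rule einterval_antiderivative) (use assms in \<open>auto simp: continuous_on_eq_continuous_at\<close>)
  then show ?thesis
    using that by (auto simp: has_real_derivative_iff_has_vector_derivative)
qed

lemma UCb_n_shift: "f \<in> UCb_n n \<Longrightarrow> (\<lambda>x. f (x + h)) \<in> UCb_n n"
proof (induction n arbitrary: f)
  case 0
  then have f: "f \<in> UCb" by (simp add: UCb_n_0)
  have "uniformly_continuous_on UNIV (\<lambda>x. f (x + h))"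
    unfolding uniformly_continuous_on_def
  proof (intro allI impI)
    fix e :: real assume "e > 0"
    then obtain d where d: "d > 0" "\<And>x y. dist y x < d \<Longrightarrow> dist (f y) (f x) < e"
      using f unfolding UCb_def uniformly_continuous_on_def by auto
    then show "\<exists>d>0. \<forall>x\<in>UNIV. \<forall>y\<in>UNIV. dist y x < d \<longrightarrow> dist (f (y + h)) (f (x + h)) < e"
      by (intro exI[of _ d]) (auto simp: dist_real_def)
  qed
  moreover have "bounded (range (\<lambda>x. f (x + h)))"
    using UCb_abs_le[OF f] by (auto simp: bounded_iff)
  ultimately show ?case by (simp add: UCb_n_0 UCb_def)
next
  case (Suc n)
  note f = UCb_n_SucD[OF Suc.prems]
  have "(\<lambda>x. f (x + h)) \<in> UCb"
    using Suc.IH[of f] UCb_n_mono[OF _ Suc.prems, of n] UCb_n_UCb by auto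
  moreover have "((\<lambda>x. f (x + h)) has_field_derivative deriv f (x + h)) (at x)" for x
    using f(2)[of "x + h"] by (simp add: DERIV_shift)
  ultimately show ?case using Suc.IH[OF f(3)] by (rule UCb_n_SucI)
qed

text \<open>The approximant is the average of \<open>f\<close> over \<open>[x, x + h]\<close>.\<close>

lemma UCb_n_approx_Suc:
  assumes f: "f \<in> UCb_n k" and e: "e > 0"
  shows "\<exists>g \<in> UCb_n (Suc k). \<forall>x. \<bar>g x - f x\<bar> \<le> e"
proof -
  have fU: "f \<in> UCb" by (rule UCb_n_UCb[OF f])
  obtain F where F: "\<And>x. (F has_field_derivative f x) (at x)"
    using continuous_antiderivative[OF UCb_continuous[OF fU]] by blast
  obtain d where d: "d > 0" "\<And>x y. dist y x < d \<Longrightarrow> dist (f y) (f x) < e"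
    using fU e unfolding UCb_def uniformly_continuous_on_def by auto
  define h where "h = d / 2"
  have h: "h > 0" "h < d" using d by (auto simp: h_def)
  define g where "g = (\<lambda>x. (F (x + h) - F x) / h)"
  \<comment> \<open>By the mean value theorem the average is a value of \<open>f\<close> within
    distance \<open>h\<close>; this yields both boundedness and closeness to
    \<open>f\<close>.\<close>
  have gz: "\<exists>z. x < z \<and> z < x + h \<and> g x = f z" for x
  proof -
    obtain z where "x < z" "z < x + h" "F (x + h) - F x = (x + h - x) * f z"
      using MVT2[of x "x + h" F f] F h by auto
    then show ?thesis using h by (intro exI[of _ z]) (auto simp: g_def)
  qed
  have gf: "\<bar>g x - f x\<bar> \<le> e" for x
  proof -
    obtain z where z: "x < z" "z < x + h" "g x = f z" using gz by blast
    then have "dist (f z) (f x) < e" using h by (intro d(2)) (simp add: dist_real_def)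
    with z(3) show ?thesis by (simp add: dist_real_def)
  qed
  have dg: "(g has_field_derivative (1 / h) * f (x + h) + (- 1 / h) * f x) (at x)" for x
    unfolding g_def using F[of "x + h"] F[of x] h
    by (auto intro!: derivative_eq_intros simp: DERIV_shift diff_divide_distrib)
  have g': "(\<lambda>x. (1 / h) * f (x + h) + (- 1 / h) * f x) \<in> UCb_n k"
    by (rule UCb_n_lincomb[OF UCb_n_shift[OF f] f])
  have "g \<in> UCb"
  proof (rule UCbI_deriv[OF _ dg])
    show "\<bar>g x\<bar> \<le> sup_norm f" for x using gz[of x] UCb_abs_le[OF fU] by metis
    show "\<bar>(1 / h) * f (x + h) + (- 1 / h) * f x\<bar> \<le> sup_norm (\<lambda>x. (1 / h) * f (x + h) + (- 1 / h) * f x)" for x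
      by (rule UCb_abs_le[OF UCb_n_UCb[OF g']])
  qed
  from UCb_n_SucI[OF this dg g'] gf show ?thesis by blast
qed

lemma UCb_n_dense:
  assumes f: "f \<in> UCb"
  shows "e > 0 \<Longrightarrow> \<exists>g \<in> UCb_n k. \<forall>x. \<bar>g x - f x\<bar> \<le> e"
proof (induction k arbitrary: e)
  case 0
  then show ?case using f by (intro bexI[of _ f]) (auto simp: UCb_n_0)
next
  case (Suc k)
  obtain g where g: "g \<in> UCb_n k" "\<And>x. \<bar>g x - f x\<bar> \<le> e / 2"
    using Suc.IH[of "e / 2"] Suc.prems by auto
  obtain g' where g': "g' \<in> UCb_n (Suc k)" "\<And>x. \<bar>g' x - g x\<bar> \<le> e / 2"
    using UCb_n_approx_Suc[OF g(1), of "e / 2"] Suc.prems by auto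
  have "\<bar>g' x - f x\<bar> \<le> e" for x using g(2)[of x] g'(2)[of x] by linarith
  with g'(1) show ?case by blast
qed

section \<open>The resolvent equation\<close>

text \<open>The solutions are exp(-\<mu>x) (F x - l), and boundedness at minus infinity determines
  l. The nondecreasing \<open>H\<close> and the nonincreasing \<open>P\<close> enclose F, and each
  value of \<open>P\<close> is at most each value of \<open>H\<close>; a number between all of them
  serves as \<open>l\<close> and gives |F - l| \<le> G exp(\<mu>x).\<close>

lemma first_order_bounded_solution:
  assumes mu: "\<mu> > 0" and f: "f \<in> UCb"
  obtains v where "\<And>x. (v has_field_derivative f x - \<mu> * v x) (at x)" "\<And>x. \<bar>v x\<bar> \<le> sup_norm f / \<mu>"
proof -
  define G where "G = sup_norm f / \<mu>"
  have "continuous_on UNIV (\<lambda>x. exp (\<mu> * x) * f x)"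
    by (intro continuous_intros UCb_continuous[OF f])
  then obtain F where F: "\<And>x. (F has_field_derivative exp (\<mu> * x) * f x) (at x)"
    using continuous_antiderivative by blast
  define H where "H = (\<lambda>x. F x + G * exp (\<mu> * x))"
  define P where "P = (\<lambda>x. F x - G * exp (\<mu> * x))"
  have fG: "- (\<mu> * G) \<le> f x" "f x \<le> \<mu> * G" for x
    using UCb_abs_le[OF f, of x] mu by (auto simp: G_def)
  have dH: "(H has_field_derivative exp (\<mu> * x) * (f x + \<mu> * G)) (at x)" for x
    unfolding H_def by (auto intro!: derivative_eq_intros F simp: algebra_simps)
  have dP: "(P has_field_derivative exp (\<mu> * x) * (f x - \<mu> * G)) (at x)" for x
    unfolding P_def by (auto intro!: derivative_eq_intros F simp: algebra_simps)
  have H: "H x \<le> H y" if "x \<le> y" for x y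
  proof (rule DERIV_nonneg_imp_nondecreasing[OF that])
    fix z show "\<exists>w. (H has_real_derivative w) (at z) \<and> 0 \<le> w"
      using dH[of z] fG(1)[of z] by (intro exI[of _ "exp (\<mu> * z) * (f z + \<mu> * G)"]) auto
  qed
  have P: "P y \<le> P x" if "x \<le> y" for x y
  proof (rule DERIV_nonpos_imp_nonincreasing[OF that])
    fix z show "\<exists>w. (P has_real_derivative w) (at z) \<and> w \<le> 0"
      using dP[of z] fG(2)[of z]
      by (intro exI[of _ "exp (\<mu> * z) * (f z - \<mu> * G)"]) (auto simp: mult_le_0_iff)
  qed
  have G: "G \<ge> 0" using sup_norm_nonneg[OF f] mu by (simp add: G_def)
  have PH: "P x \<le> H y" for x y
  proof -
    have "P z \<le> H z" for z using G by (simp add: P_def H_def)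
    then show ?thesis using H[of x y] P[of y x] by (meson linear order_trans)
  qed
  define l where "l = (INF x. H x)"
  have "bdd_below (range H)" using PH[of 0] by (auto simp: bdd_below_def)
  then have lH: "l \<le> H x" for x unfolding l_def by (rule cINF_lower) simp
  have Pl: "P x \<le> l" for x unfolding l_def by (rule cINF_greatest) (use PH in auto)
  define v where "v = (\<lambda>x. exp (- (\<mu> * x)) * (F x - l))"
  show ?thesis
  proof
    fix x
    have "\<bar>F x - l\<bar> \<le> G * exp (\<mu> * x)" using lH[of x] Pl[of x] by (auto simp: H_def P_def)
    then have "\<bar>v x\<bar> \<le> exp (- (\<mu> * x)) * (G * exp (\<mu> * x))"
      by (simp add: v_def abs_mult)
    also have "\<dots> = G" by (simp add: exp_minus)
    finally show "\<bar>v x\<bar> \<le> sup_norm f / \<mu>" by (simp add: G_def)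
    show "(v has_field_derivative f x - \<mu> * v x) (at x)"
      unfolding v_def by (rule derivative_eq_intros F refl)+ (simp add: algebra_simps exp_minus)
  qed
qed

text \<open>The operator \<open>\<mu>\<^sup>2 - D\<^sup>2\<close> factors as \<open>(\<mu> - D)(\<mu> + D)\<close>; reflection reduces the first factor to the
  second.\<close>

lemma second_order_bounded_solution:
  assumes mu: "\<mu> > 0" and g: "g \<in> UCb"
  obtains u where "u \<in> UCb_n 2" "\<And>x. deriv (deriv u) x = \<mu>\<^sup>2 * u x - g x"
    "\<And>x. \<bar>u x\<bar> \<le> sup_norm g / \<mu>\<^sup>2" "\<And>x. \<bar>deriv u x\<bar> \<le> 2 * sup_norm g / \<mu>"
proof -
  define G where "G = sup_norm g"
  define gr where "gr = (\<lambda>x. g (- x))"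
  have "gr \<in> UCb"
  proof -
    have "uniformly_continuous_on UNIV gr"
      unfolding uniformly_continuous_on_def
    proof (intro allI impI)
      fix e :: real assume "e > 0"
      then obtain d where d: "d > 0" "\<And>x y. dist y x < d \<Longrightarrow> dist (g y) (g x) < e"
        using g unfolding UCb_def uniformly_continuous_on_def by auto
      then show "\<exists>d>0. \<forall>x\<in>UNIV. \<forall>y\<in>UNIV. dist y x < d \<longrightarrow> dist (gr y) (gr x) < e"
        by (intro exI[of _ d]) (auto simp: dist_real_def gr_def)
    qed
    then show ?thesis using UCb_abs_le[OF g] by (auto simp: UCb_def bounded_iff gr_def)
  qed
  then obtain wr where wr: "\<And>x. (wr has_field_derivative gr x - \<mu> * wr x) (at x)" "\<And>x. \<bar>wr x\<bar> \<le> sup_norm gr / \<mu>"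
    using first_order_bounded_solution[OF mu] by metis
  have grG: "sup_norm gr \<le> G" unfolding G_def by (rule sup_norm_le) (simp add: gr_def UCb_abs_le[OF g])
  \<comment> \<open>Reflecting back turns \<open>wr\<close> into a bounded solution of \<mu>w - w' =
    g; the second factor is then inverted by u' + \<mu>u = w.\<close>
  define w where "w = (\<lambda>x. wr (- x))"
  have dw: "(w has_field_derivative \<mu> * w x - g x) (at x)" for x
  proof -
    have "((\<lambda>x. wr (- x)) has_field_derivative (gr (- x) - \<mu> * wr (- x)) * (- 1)) (at x)"
      by (rule DERIV_chain2[OF wr(1)]) (auto intro!: derivative_eq_intros)
    then show ?thesis by (simp add: w_def gr_def)
  qed
  have w: "\<bar>w x\<bar> \<le> G / \<mu>" for x
    using wr(2)[of "- x"] divide_right_mono[OF grG, of \<mu>] mu unfolding w_def by linarith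
  have gG: "\<bar>g x\<bar> \<le> G" for x unfolding G_def by (rule UCb_abs_le[OF g])
  have muw: "\<bar>\<mu> * w x\<bar> \<le> G" for x
    using w[of x] mu by (simp add: abs_mult field_simps)
  have wU: "w \<in> UCb"
  proof (rule UCbI_deriv[OF w dw])
    show "\<bar>\<mu> * w x - g x\<bar> \<le> G + G" for x using muw[of x] gG[of x] by linarith
  qed
  obtain u where u: "\<And>x. (u has_field_derivative w x - \<mu> * u x) (at x)" "\<And>x. \<bar>u x\<bar> \<le> sup_norm w / \<mu>"
    using first_order_bounded_solution[OF mu wU] by metis
  have "sup_norm w \<le> G / \<mu>" by (rule sup_norm_le) (rule w)
  then have uG: "\<bar>u x\<bar> \<le> G / \<mu> / \<mu>" for x
    using u(2)[of x] divide_right_mono[of "sup_norm w" "G / \<mu>" \<mu>] mu by linarith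
  have muu: "\<bar>\<mu> * u x\<bar> \<le> G / \<mu>" for x
    using uG[of x] mu by (simp add: abs_mult field_simps)
  have u1: "\<bar>w x - \<mu> * u x\<bar> \<le> 2 * G / \<mu>" for x
  proof -
    have "2 * G / \<mu> = G / \<mu> + G / \<mu>" by simp
    then show ?thesis using muu[of x] w[of x] by linarith
  qed
  have uU: "u \<in> UCb" by (rule UCbI_deriv[OF uG u(1) u1])
  have u1U: "(\<lambda>x. w x - \<mu> * u x) \<in> UCb" by (intro UCb_diff wU UCb_cmult uU)
  have d2: "((\<lambda>x. w x - \<mu> * u x) has_field_derivative \<mu>\<^sup>2 * u x - g x) (at x)" for x
    by (rule derivative_eq_intros dw u(1) refl)+ (simp add: algebra_simps power2_eq_square)
  have u2U: "(\<lambda>x. \<mu>\<^sup>2 * u x - g x) \<in> UCb" by (intro UCb_diff g UCb_cmult uU)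
  note R = UCb_2I[OF u(1) d2, of 0, unfolded UCb_n_0, OF uU u1U u2U]
  show ?thesis
  proof
    show "u \<in> UCb_n 2" using R(1) by (simp add: numeral_2_eq_2)
    show "deriv (deriv u) x = \<mu>\<^sup>2 * u x - g x" for x using R(3) by metis
    show "\<bar>deriv u x\<bar> \<le> 2 * sup_norm g / \<mu>" for x using u1[of x] R(2) by (metis G_def)
    show "\<bar>u x\<bar> \<le> sup_norm g / \<mu>\<^sup>2" for x using uG[of x] by (simp add: G_def power2_eq_square)
  qed
qed

section \<open>The maximum principle on the line\<close>

lemma attains_max_minus_square:
  fixes u :: "real \<Rightarrow> real"
  assumes u: "continuous_on UNIV u" "\<And>x. \<bar>u x\<bar> \<le> U" and d: "\<delta> > 0"
  obtains y where "\<And>z. u z - \<delta> * z\<^sup>2 \<le> u y - \<delta> * y\<^sup>2"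
proof -
  have U: "U \<ge> 0" using u(2)[of 0] by linarith
  \<comment> \<open>Outside [-R, R] the penalty \<delta>z^2 is at least 2U, the most by which
    \<open>u\<close> can vary.\<close>
  define R where "R = sqrt (2 * U / \<delta>)"
  have R: "R \<ge> 0" "R\<^sup>2 = 2 * U / \<delta>" using U d by (auto simp: R_def)
  have "continuous_on {-R..R} (\<lambda>z. u z - \<delta> * z\<^sup>2)"
    by (intro continuous_intros continuous_on_subset[OF u(1)]) auto
  from continuous_attains_sup[OF _ _ this] R obtain y
    where y: "y \<in> {-R..R}" "\<And>z. z \<in> {-R..R} \<Longrightarrow> u z - \<delta> * z\<^sup>2 \<le> u y - \<delta> * y\<^sup>2" by auto
  show ?thesis
  proof
    fix z
    show "u z - \<delta> * z\<^sup>2 \<le> u y - \<delta> * y\<^sup>2"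
    proof (cases "z \<in> {-R..R}")
      case False
      then have "R\<^sup>2 \<le> z\<^sup>2" using R by (intro abs_le_square_iff[THEN iffD1]) auto
      then have "2 * U \<le> \<delta> * z\<^sup>2" using R d by (simp add: field_simps)
      then show ?thesis using y(2)[of 0] R(1) u(2)[of z] u(2)[of 0] by simp
    qed (rule y(2))
  qed
qed

text \<open>If l were positive, f' would be positive just to the right of the critical point and f
  would exceed its maximum there.\<close>

lemma second_deriv_nonpos_at_max:
  fixes f f' :: "real \<Rightarrow> real"
  assumes d: "\<And>x. (f has_field_derivative f' x) (at x)" "(f' has_field_derivative l) (at y)"
    and mx: "\<And>z. f z \<le> f y"
  shows "f' y = 0" "l \<le> 0"
proof -
  show 0: "f' y = 0"
    by (rule DERIV_local_max[OF d(1), of 1]) (auto simp: mx)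
  show "l \<le> 0"
  proof (rule ccontr)
    assume "\<not> l \<le> 0"
    then obtain e where e: "e > 0" "\<And>h. h > 0 \<Longrightarrow> h < e \<Longrightarrow> f' y < f' (y + h)"
      using DERIV_pos_inc_right[OF d(2)] by auto
    obtain z where z: "y < z" "z < y + e / 2" "f (y + e / 2) - f y = (y + e / 2 - y) * f' z"
      using MVT2[of y "y + e / 2" f f'] d(1) e(1) by auto
    have "f' z > 0" using e(2)[of "z - y"] z e(1) 0 by auto
    then have "(y + e / 2 - y) * f' z > 0" using e(1) by simp
    then have "f (y + e / 2) > f y" using z(3) by linarith
    then show False using mx[of "y + e / 2"] by linarith
  qed
qed

context elliptic
begin

text \<open>The supremum of u may not be attained, so the inequality is tested at a maximum point y
  of u - \<delta>z^2. There u' = 2\<delta>y and u'' \<le> 2\<delta>, and comparison with the value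
  at 0 gives \<delta>|y| \<le> sqrt(2 U0 \<delta>). All error terms vanish as \<delta> tends to
  0.\<close>

lemma one_sided_maximum_principle:
  assumes u: "u \<in> UCb_n 2" and c_le: "\<And>x. c x \<le> \<gamma>" and lam: "\<gamma> < \<kappa>" and F: "F \<ge> 0"
    and le: "\<And>x. \<kappa> * u x - diff_expr a b c u x \<le> F"
  shows "(\<kappa> - \<gamma>) * u z \<le> F"
proof (cases "u z \<le> 0")
  case True
  then show ?thesis using F lam mult_nonneg_nonpos[of "\<kappa> - \<gamma>" "u z"] by linarith
next
  case False
  note U = UCb_2D[OF u]
  define U0 A B where "U0 = sup_norm u" and "A = sup_norm a" and "B = sup_norm b"
  have aU: "a \<in> UCb" and bU: "b \<in> UCb" using a b UCb_n_UCb by auto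
  have U0: "\<bar>u x\<bar> \<le> U0" for x unfolding U0_def by (rule UCb_abs_le[OF U(1)])
  have main: "(\<kappa> - \<gamma>) * (u z - \<delta> * z\<^sup>2) \<le> F + 2 * \<delta> * A + 2 * B * sqrt (2 * U0 * \<delta>)" if d: "\<delta> > 0" for \<delta>
  proof -
    obtain y where y: "\<And>z. u z - \<delta> * z\<^sup>2 \<le> u y - \<delta> * y\<^sup>2"
      using attains_max_minus_square[OF UCb_continuous[OF U(1)] U0 d] by metis
    have d1: "((\<lambda>x. u x - \<delta> * x\<^sup>2) has_field_derivative deriv u x - 2 * \<delta> * x) (at x)" for x
      by (auto intro!: derivative_eq_intros U(4))
    have d2: "((\<lambda>x. deriv u x - 2 * \<delta> * x) has_field_derivative deriv (deriv u) y - 2 * \<delta>) (at y)"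
      by (auto intro!: derivative_eq_intros U(5))
    note cr = second_deriv_nonpos_at_max[of "\<lambda>x. u x - \<delta> * x\<^sup>2" "\<lambda>x. deriv u x - 2 * \<delta> * x", OF d1 d2 y]
    show ?thesis
    proof (cases "u z - \<delta> * z\<^sup>2 \<le> 0")
      case True
      have "(\<kappa> - \<gamma>) * (u z - \<delta> * z\<^sup>2) \<le> 0" using True lam by (simp add: mult_nonneg_nonpos)
      moreover have "0 \<le> F + 2 * \<delta> * A + 2 * B * sqrt (2 * U0 * \<delta>)"
        using F d sup_norm_nonneg[OF aU] sup_norm_nonneg[OF bU] U0[of 0]
        by (auto simp: A_def B_def intro!: add_nonneg_nonneg mult_nonneg_nonneg)
      ultimately show ?thesis by linarith
    next
      case False
      have uy: "u z - \<delta> * z\<^sup>2 \<le> u y"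
      proof -
        have "0 \<le> \<delta> * y\<^sup>2" using d by simp
        then show ?thesis using y[of z] by linarith
      qed
      have "(\<kappa> - \<gamma>) * (u z - \<delta> * z\<^sup>2) \<le> (\<kappa> - \<gamma>) * u y"
        using uy lam by (intro mult_left_mono) auto
      \<comment> \<open>The inequality c \<le> \<gamma> is multiplied by u(y), which is positive
        because the penalised value at z is.\<close>
      also have "\<dots> \<le> (\<kappa> - c y) * u y"
        using uy False c_le[of y] by (intro mult_right_mono) auto
      also have "\<dots> \<le> F + a y * deriv (deriv u) y + b y * deriv u y"
        using le[of y] by (simp add: diff_expr_def algebra_simps)
      also have "a y * deriv (deriv u) y \<le> a y * (2 * \<delta>)"
        using cr(2) a_nz(2)[of y] by (intro mult_left_mono) auto
      also have "a y * (2 * \<delta>) \<le> A * (2 * \<delta>)"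
        using UCb_abs_le[OF aU, of y] d by (intro mult_right_mono) (auto simp: A_def)
      also have "b y * deriv u y \<le> B * (2 * sqrt (2 * U0 * \<delta>))"
      proof -
        have "\<delta> * y\<^sup>2 \<le> 2 * U0"
          using y[of 0] U0[of y] U0[of 0] by simp
        then have "(\<delta> * \<bar>y\<bar>)\<^sup>2 \<le> 2 * U0 * \<delta>"
          using mult_left_mono[of "\<delta> * y\<^sup>2" "2 * U0" \<delta>] d by (simp add: power_mult_distrib power2_eq_square mult_ac)
        then have s: "\<delta> * \<bar>y\<bar> \<le> sqrt (2 * U0 * \<delta>)" by (rule real_le_rsqrt)
        have "b y * deriv u y \<le> \<bar>b y\<bar> * \<bar>deriv u y\<bar>" by (metis abs_ge_self abs_mult)
        also have "\<bar>deriv u y\<bar> = 2 * (\<delta> * \<bar>y\<bar>)" using cr(1) d by (simp add: abs_mult)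
        also have "\<bar>b y\<bar> * (2 * (\<delta> * \<bar>y\<bar>)) \<le> B * (2 * sqrt (2 * U0 * \<delta>))"
          using s UCb_abs_le[OF bU, of y] d by (intro mult_mono) (auto simp: B_def)
        finally show ?thesis .
      qed
      finally show ?thesis by (simp add: algebra_simps)
    qed
  qed
  have "((\<lambda>\<delta>. F + 2 * \<delta> * A + 2 * B * sqrt (2 * U0 * \<delta>)) \<longlongrightarrow> F + 2 * 0 * A + 2 * B * sqrt (2 * U0 * 0)) (at_right 0)"
    by (intro tendsto_intros)
  moreover have "((\<lambda>\<delta>. (\<kappa> - \<gamma>) * (u z - \<delta> * z\<^sup>2)) \<longlongrightarrow> (\<kappa> - \<gamma>) * (u z - 0 * z\<^sup>2)) (at_right 0)"
    by (intro tendsto_intros)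
  moreover have "\<forall>\<^sub>F \<delta> in at_right 0. (\<kappa> - \<gamma>) * (u z - \<delta> * z\<^sup>2) \<le> F + 2 * \<delta> * A + 2 * B * sqrt (2 * U0 * \<delta>)"
    using eventually_at_right_less[of 0] by eventually_elim (rule main)
  ultimately have "(\<kappa> - \<gamma>) * (u z - 0 * z\<^sup>2) \<le> F + 2 * 0 * A + 2 * B * sqrt (2 * U0 * 0)"
    by (rule tendsto_le[OF trivial_limit_at_right_real])
  then show ?thesis by simp
qed

lemma resolvent_bound:
  assumes u: "u \<in> UCb_n 2" and c_le: "\<And>x. c x \<le> \<gamma>" and lam: "\<gamma> < \<kappa>" and F: "F \<ge> 0"
    and le: "\<And>x. \<bar>\<kappa> * u x - diff_expr a b c u x\<bar> \<le> F"
  shows "(\<kappa> - \<gamma>) * \<bar>u z\<bar> \<le> F"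
proof -
  have "(\<kappa> - \<gamma>) * u z \<le> F"
    by (rule one_sided_maximum_principle[OF u c_le lam F]) (use le in \<open>auto simp: abs_le_iff\<close>)
  moreover have eq: "diff_expr a b c (\<lambda>x. - u x) x = - diff_expr a b c u x" for x
    using fun_cong[OF diff_expr_lincomb[OF u u, of a b c "-1" 0], of x] by simp
  have "(\<kappa> - \<gamma>) * (- u z) \<le> F"
  proof (rule one_sided_maximum_principle[OF _ c_le lam F, where u = "\<lambda>x. - u x"])
    show "(\<lambda>x. - u x) \<in> UCb_n 2" using UCb_n_minus[OF u] by simp
    show "\<kappa> * - u x - diff_expr a b c (\<lambda>x. - u x) x \<le> F" for x
      using le[of x] unfolding eq by (simp add: abs_le_iff)
  qed
  ultimately show ?thesis by (auto simp: abs_if)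
qed

end

text \<open>The maximum principle for u'' gives uniqueness, so the bounds of the constructed
  solution pass to every solution in \<open>UCb_n 2\<close>. The contraction estimate needs them for
  differences of chosen solutions.\<close>

lemma second_order_solution_bound:
  assumes mu: "\<mu> > 0" and g: "g \<in> UCb" and u: "u \<in> UCb_n 2"
    and eq: "\<And>x. deriv (deriv u) x = \<mu>\<^sup>2 * u x - g x"
  shows "\<bar>u x\<bar> \<le> sup_norm g / \<mu>\<^sup>2" "\<bar>deriv u x\<bar> \<le> 2 * sup_norm g / \<mu>"
proof -
  obtain v where v: "v \<in> UCb_n 2" "\<And>x. deriv (deriv v) x = \<mu>\<^sup>2 * v x - g x"
    "\<And>x. \<bar>v x\<bar> \<le> sup_norm g / \<mu>\<^sup>2" "\<And>x. \<bar>deriv v x\<bar> \<le> 2 * sup_norm g / \<mu>"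
    using second_order_bounded_solution[OF mu g] by metis
  interpret laplace: elliptic "\<lambda>_. 1" "\<lambda>_. 0" "\<lambda>_. 0" 1 0
    by unfold_locales (auto simp: UCb_n_0)
  define w where "w = (\<lambda>x. 1 * u x + (-1) * v x)"
  have w: "w \<in> UCb_n 2" unfolding w_def by (rule UCb_n_lincomb[OF u v(1)])
  have "diff_expr (\<lambda>_. 1) (\<lambda>_. 0) (\<lambda>_. 0) w x = \<mu>\<^sup>2 * w x" for x
    unfolding w_def diff_expr_lincomb[OF u v(1)] by (simp add: diff_expr_def eq v(2) algebra_simps)
  then have "(\<mu>\<^sup>2 - 0) * \<bar>w x\<bar> \<le> 0" for x
    by (intro laplace.resolvent_bound[OF w]) (use mu in auto)
  then have "w x = 0" for x using mu by (simp add: mult_le_0_iff)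
  then have "u = v" by (auto simp: w_def)
  with v show "\<bar>u x\<bar> \<le> sup_norm g / \<mu>\<^sup>2" "\<bar>deriv u x\<bar> \<le> 2 * sup_norm g / \<mu>" by auto
qed

text \<open>Writing \<open>u\<close> as the bounded solution of \<open>\<mu>\<^sup>2 u - u'' = g\<close> with \<open>\<kappa> = a\<^sub>0 \<mu>\<^sup>2\<close> turns the
  resolvent equation into a fixed point equation for \<open>g\<close>, which is contractive for large \<open>\<mu>\<close> because
  \<open>\<bar>\<mu>\<^sup>2 - \<kappa> / a\<bar> \<le> \<mu>\<^sup>2 (1 - a\<^sub>0 / sup a)\<close>.\<close>

lemma (in elliptic) resolvent_exists:
  "\<exists>\<kappa>\<^sub>0. \<forall>\<kappa>\<ge>\<kappa>\<^sub>0. \<forall>f \<in> UCb. \<exists>u \<in> UCb_n 2. \<forall>x. \<kappa> * u x - diff_expr a b c u x = f x"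
proof -
  define A B C where "A = sup_norm a" and "B = sup_norm b" and "C = sup_norm c"
  have U: "a \<in> UCb" "b \<in> UCb" "c \<in> UCb" using a b c UCb_n_UCb by auto
  have aA: "a x \<le> A" for x using UCb_abs_le[OF U(1), of x] by (simp add: A_def)
  have A: "A > 0" using aA[of 0] a_nz(2)[of 0] by linarith
  have BC: "B \<ge> 0" "C \<ge> 0" using U by (auto simp: B_def C_def sup_norm_nonneg)
  have a'U: "(\<lambda>x. 1 / a x) \<in> UCb" by (rule UCb_inverse[OF U(1) a0])
  \<comment> \<open>The ellipticity ratio: the second order part contracts by 1 - \<epsilon>, and
    \<open>\<mu>0\<close> is so large that the lower order terms cost at most \<epsilon>/2.\<close>
  define \<epsilon> where "\<epsilon> = a0 / A"
  have eps: "\<epsilon> > 0" "\<epsilon> \<le> 1" using A a0(1) order_trans[OF a0(2) aA] by (simp_all add: \<epsilon>_def)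
  define \<mu>0 where "\<mu>0 = max 1 (2 * (C + 2 * B) / (a0 * \<epsilon>))"
  show ?thesis
  proof (intro exI[of _ "a0 * \<mu>0\<^sup>2"] allI impI ballI)
    fix \<kappa> f assume kap: "a0 * \<mu>0\<^sup>2 \<le> \<kappa>" and f: "f \<in> UCb"
    define \<mu> where "\<mu> = sqrt (\<kappa> / a0)"
    have "\<mu>0\<^sup>2 \<le> \<kappa> / a0" using kap a0(1) by (simp add: field_simps)
    then have mu0: "\<mu>0 \<le> \<mu>" unfolding \<mu>_def by (rule real_le_rsqrt)
    then have mu1: "\<mu> \<ge> 1" by (simp add: \<mu>0_def)
    then have mu: "\<mu> > 0" by linarith
    have kmu: "\<kappa> = a0 * \<mu>\<^sup>2"
      using order_trans[OF zero_le_power2 \<open>\<mu>0\<^sup>2 \<le> \<kappa> / a0\<close>] a0(1) unfolding \<mu>_def by (subst real_sqrt_pow2) auto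
    have "2 * (C + 2 * B) / (a0 * \<epsilon>) \<le> \<mu>" using mu0 by (simp add: \<mu>0_def)
    then have small: "(C + 2 * B) / a0 \<le> \<epsilon> / 2 * \<mu>"
      using a0(1) eps by (simp add: field_simps)
    define sol where "sol = (\<lambda>g. SOME u. u \<in> UCb_n 2 \<and> (\<forall>x. deriv (deriv u) x = \<mu>\<^sup>2 * u x - apply_ucb g x))"
    have gU: "apply_ucb g \<in> UCb" for g by (rule apply_ucb)
    have "\<exists>u. u \<in> UCb_n 2 \<and> (\<forall>x. deriv (deriv u) x = \<mu>\<^sup>2 * u x - apply_ucb g x)" for g
      using second_order_bounded_solution[OF mu gU] by metis
    then have "sol g \<in> UCb_n 2 \<and> (\<forall>x. deriv (deriv (sol g)) x = \<mu>\<^sup>2 * sol g x - apply_ucb g x)" for g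
      unfolding sol_def by (rule someI_ex)
    then have sol: "sol g \<in> UCb_n 2" "deriv (deriv (sol g)) x = \<mu>\<^sup>2 * sol g x - apply_ucb g x" for g x
      by auto
    \<comment> \<open>Substituting u'' = \<mu>^2 u - g into \<kappa>u - Au = f and solving for g
      gives g = \<phi> g.\<close>
    define \<phi> where "\<phi> = (\<lambda>g x. (1 / a x) * (f x + (a x * \<mu>\<^sup>2 - \<kappa> + c x) * sol g x + b x * deriv (sol g) x))"
    have phiU: "\<phi> g \<in> UCb" for g
      unfolding \<phi>_def by (intro UCb_mult UCb_add UCb_diff UCb_const a'U f U UCb_2D(1,2)[OF sol(1)])
    define \<Phi> where "\<Phi> = (\<lambda>g. Ucb (\<phi> g))"
    have Phi: "apply_ucb (\<Phi> g) = \<phi> g" for g unfolding \<Phi>_def by (rule Ucb_inverse[OF phiU])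
    have "dist (\<Phi> g) (\<Phi> h) \<le> (1 - \<epsilon> / 2) * dist g h" for g h
      unfolding dist_norm
    proof (rule norm_ucb_le)
      fix x
      define w where "w = (\<lambda>x. 1 * sol g x + (-1) * sol h x)"
      define N where "N = norm (g - h)"
      have N: "N \<ge> 0" by (simp add: N_def)
      have wU: "w \<in> UCb_n 2" unfolding w_def by (rule UCb_n_lincomb[OF sol(1) sol(1)])
      have dw: "deriv w = (\<lambda>x. 1 * deriv (sol g) x + (-1) * deriv (sol h) x)"
        unfolding w_def by (rule deriv_lincomb) (rule UCb_2D(4)[OF sol(1)])+
      have ddw: "deriv (deriv w) = (\<lambda>x. 1 * deriv (deriv (sol g)) x + (-1) * deriv (deriv (sol h)) x)"
        unfolding dw by (rule deriv_lincomb) (rule UCb_2D(5)[OF sol(1)])+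
      have "deriv (deriv w) y = \<mu>\<^sup>2 * w y - apply_ucb (g - h) y" for y
        unfolding ddw sol(2) by (simp add: w_def minus_ucb.rep_eq algebra_simps)
      note bd = second_order_solution_bound[OF mu gU wU this, folded norm_ucb.rep_eq, folded N_def]
      have w0: "\<bar>w x\<bar> \<le> N / \<mu>\<^sup>2" and w1: "\<bar>deriv w x\<bar> \<le> 2 * N / \<mu>" by (rule bd)+
      have "apply_ucb (\<Phi> g - \<Phi> h) x = (1 / a x) * ((a x * \<mu>\<^sup>2 - \<kappa>) * w x + c x * w x + b x * deriv w x)"
        unfolding minus_ucb.rep_eq Phi \<phi>_def dw by (simp add: w_def algebra_simps)
      also have "\<dots> = (1 - a0 / a x) * (\<mu>\<^sup>2 * w x) + (1 / a x) * (c x * w x + b x * deriv w x)"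
        using a_nz(1)[of x] by (simp add: kmu field_simps)
      finally have eq: "apply_ucb (\<Phi> g - \<Phi> h) x = (1 - a0 / a x) * (\<mu>\<^sup>2 * w x) + (1 / a x) * (c x * w x + b x * deriv w x)" .
      have "\<bar>apply_ucb (\<Phi> g - \<Phi> h) x\<bar> \<le>
          \<bar>1 - a0 / a x\<bar> * (\<mu>\<^sup>2 * \<bar>w x\<bar>) + \<bar>1 / a x\<bar> * \<bar>c x * w x + b x * deriv w x\<bar>"
        unfolding eq by (rule order_trans[OF abs_triangle_ineq]) (simp add: abs_mult)
      also have "\<dots> \<le>
          \<bar>1 - a0 / a x\<bar> * (\<mu>\<^sup>2 * \<bar>w x\<bar>) + \<bar>1 / a x\<bar> * (\<bar>c x\<bar> * \<bar>w x\<bar> + \<bar>b x\<bar> * \<bar>deriv w x\<bar>)"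
        unfolding abs_mult[symmetric, of "c x"] abs_mult[symmetric, of "b x"]
        by (intro add_left_mono mult_left_mono abs_triangle_ineq abs_ge_zero)
      also have "\<dots> \<le> (1 - \<epsilon>) * (\<mu>\<^sup>2 * (N / \<mu>\<^sup>2)) + 1 / a0 * (C * (N / \<mu>\<^sup>2) + B * (2 * N / \<mu>))"
      proof (intro add_mono mult_mono mult_nonneg_nonneg w0 w1 add_nonneg_nonneg)
        show "\<bar>1 - a0 / a x\<bar> \<le> 1 - \<epsilon>"
          using a0 a0(2)[of x] aA[of x] a_nz(2)[of x] by (simp add: \<epsilon>_def frac_le)
        show "\<bar>1 / a x\<bar> \<le> 1 / a0" using a0 a_nz[of x] by (simp add: frac_le)
        show "\<bar>c x\<bar> \<le> C" "\<bar>b x\<bar> \<le> B" unfolding C_def B_def by (intro UCb_abs_le U)+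
      qed (use BC N eps a0 mu in auto)
      also have "\<mu>\<^sup>2 * (N / \<mu>\<^sup>2) = N" using mu by simp
      also have "1 / a0 * (C * (N / \<mu>\<^sup>2) + B * (2 * N / \<mu>)) \<le> \<epsilon> / 2 * N"
      proof -
        have "N / \<mu>\<^sup>2 \<le> N / \<mu>"
          using mu mu1 N self_le_power[of \<mu> 2] by (intro divide_left_mono) auto
        then have "1 / a0 * (C * (N / \<mu>\<^sup>2) + B * (2 * N / \<mu>)) \<le> 1 / a0 * (C * (N / \<mu>) + B * (2 * N / \<mu>))"
          using BC a0 by (intro mult_left_mono add_mono) auto
        also have "\<dots> = (C + 2 * B) / a0 * (N / \<mu>)" by (simp add: algebra_simps add_divide_distrib)
        also have "\<dots> \<le> (\<epsilon> / 2 * \<mu>) * (N / \<mu>)" using small N mu by (intro mult_right_mono) auto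
        also have "\<dots> = \<epsilon> / 2 * N" using mu by simp
        finally show ?thesis .
      qed
      finally show "\<bar>apply_ucb (\<Phi> g - \<Phi> h) x\<bar> \<le> (1 - \<epsilon> / 2) * norm (g - h)"
        by (simp add: N_def algebra_simps)
    qed
    then have "\<exists>!g. \<Phi> g = g" using eps by (intro banach_fix_type[of "1 - \<epsilon> / 2"]) auto
    then obtain g where "\<Phi> g = g" by blast
    then have g: "apply_ucb g = \<phi> g" using Phi by metis
    show "\<exists>u \<in> UCb_n 2. \<forall>x. \<kappa> * u x - diff_expr a b c u x = f x"
    proof (intro bexI[of _ "sol g"] allI sol(1))
      fix x
      have "a x * apply_ucb g x = f x + (a x * \<mu>\<^sup>2 - \<kappa> + c x) * sol g x + b x * deriv (sol g) x"
        unfolding fun_cong[OF g, of x] \<phi>_def using a_nz(1)[of x] by simp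
      then show "\<kappa> * sol g x - diff_expr a b c (sol g) x = f x"
        unfolding diff_expr_def sol(2) by (simp add: algebra_simps)
    qed
  qed
qed

section \<open>Generation of semigroups\<close>

text \<open>A copy of the type of bounded operators that is a Banach algebra under composition, which makes
  the library's exponential available.\<close>

typedef (overloaded) 'a bop = "UNIV :: ('a::{banach, perfect_space} \<Rightarrow>\<^sub>L 'a) set"
  morphisms op_of Bop ..

setup_lifting type_definition_bop

instantiation bop :: ("{banach, perfect_space}") real_normed_algebra_1
begin

lift_definition zero_bop :: "'a bop" is 0 .
lift_definition one_bop :: "'a bop" is id_blinfun .
lift_definition plus_bop :: "'a bop \<Rightarrow> 'a bop \<Rightarrow> 'a bop" is "(+)" .
lift_definition minus_bop :: "'a bop \<Rightarrow> 'a bop \<Rightarrow> 'a bop" is "(-)" .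
lift_definition uminus_bop :: "'a bop \<Rightarrow> 'a bop" is uminus .
lift_definition times_bop :: "'a bop \<Rightarrow> 'a bop \<Rightarrow> 'a bop" is "(o\<^sub>L)" .
lift_definition scaleR_bop :: "real \<Rightarrow> 'a bop \<Rightarrow> 'a bop" is scaleR .
lift_definition norm_bop :: "'a bop \<Rightarrow> real" is norm .

definition dist_bop :: "'a bop \<Rightarrow> 'a bop \<Rightarrow> real" where
  "dist_bop f g = norm (f - g)"

definition sgn_bop :: "'a bop \<Rightarrow> 'a bop" where
  "sgn_bop f = inverse (norm f) *\<^sub>R f"

definition uniformity_bop :: "('a bop \<times> 'a bop) filter" where
  "uniformity_bop = (INF e\<in>{0 <..}. principal {(x, y). dist x y < e})"

definition open_bop :: "'a bop set \<Rightarrow> bool" where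
  "open_bop S = (\<forall>x\<in>S. \<forall>\<^sub>F (x', y) in uniformity. x' = x \<longrightarrow> y \<in> S)"

instance
proof
  fix r s :: real and f g h :: "'a bop"
  show "dist f g = norm (f - g)" by (rule dist_bop_def)
  show "sgn f = inverse (norm f) *\<^sub>R f" by (rule sgn_bop_def)
  show "uniformity = (INF e\<in>{0 <..}. principal {(x, y :: 'a bop). dist x y < e})"
    by (rule uniformity_bop_def)
  show "open S = (\<forall>x\<in>S. \<forall>\<^sub>F (x', y) in uniformity. x' = x \<longrightarrow> y \<in> S)" for S :: "'a bop set"
    by (rule open_bop_def)
  show "f + g + h = f + (g + h)" by transfer simp
  show "f + g = g + f" by transfer simp
  show "0 + f = f" by transfer simp
  show "- f + f = 0" by transfer simp
  show "f - g = f + - g" by transfer simp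
  show "r *\<^sub>R (f + g) = r *\<^sub>R f + r *\<^sub>R g" by transfer (simp add: scaleR_add_right)
  show "(r + s) *\<^sub>R f = r *\<^sub>R f + s *\<^sub>R f" by transfer (simp add: scaleR_add_left)
  show "r *\<^sub>R s *\<^sub>R f = (r * s) *\<^sub>R f" by transfer simp
  show "1 *\<^sub>R f = f" by transfer simp
  show "f * g * h = f * (g * h)" by transfer (auto intro: blinfun_eqI)
  show "1 * f = f" "f * 1 = f" by (transfer, auto intro: blinfun_eqI)+
  show "(f + g) * h = f * h + g * h" "f * (g + h) = f * g + f * h"
    by (transfer, auto intro!: blinfun_eqI simp: blinfun.bilinear_simps)+
  show "r *\<^sub>R f * g = r *\<^sub>R (f * g)" "f * r *\<^sub>R g = r *\<^sub>R (f * g)"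
    by (transfer, auto intro!: blinfun_eqI simp: blinfun.bilinear_simps)+
  show "(0 :: 'a bop) \<noteq> 1"
    by transfer (metis norm_blinfun_id norm_zero zero_neq_one)
  show "norm f = 0 \<longleftrightarrow> f = 0" by transfer simp
  show "norm (f + g) \<le> norm f + norm g" by transfer (rule norm_triangle_ineq)
  show "norm (r *\<^sub>R f) = \<bar>r\<bar> * norm f" by transfer simp
  show "norm (f * g) \<le> norm f * norm g" by transfer (rule norm_blinfun_compose)
  show "norm (1 :: 'a bop) = 1" by transfer simp
qed

end

instance bop :: ("{banach, perfect_space}") banach
proof
  fix X :: "nat \<Rightarrow> 'a bop"
  have d: "dist (Bop f) (Bop g) = dist f g" for f g :: "'a \<Rightarrow>\<^sub>L 'a"
    unfolding dist_norm by transfer simp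
  have X: "X = (\<lambda>n. Bop (op_of (X n)))" by (simp add: op_of_inverse)
  assume "Cauchy X"
  then have "Cauchy (\<lambda>n. op_of (X n))"
    by (subst (asm) X) (auto simp: Cauchy_def d)
  then obtain L where "(\<lambda>n. op_of (X n)) \<longlonglongrightarrow> L" using Cauchy_convergent convergent_def by blast
  then have "X \<longlonglongrightarrow> Bop L"
    by (subst X) (simp add: lim_sequentially d)
  then show "convergent X" by (rule convergentI)
qed

lemma op_of_simps:
  "op_of (f * g) x = op_of f (op_of g x)" "op_of 1 x = x" "op_of (f - g) x = op_of f x - op_of g x"
  "op_of (r *\<^sub>R f) x = r *\<^sub>R op_of f x" "op_of (Bop F) = F"
  by (simp_all add: times_bop.rep_eq one_bop.rep_eq minus_bop.rep_eq scaleR_bop.rep_eq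
      Bop_inverse blinfun.bilinear_simps)

lemma norm_op_of: "norm (op_of f) = norm f"
  by (simp add: norm_bop.rep_eq)

lemma bounded_linear_op_of: "bounded_linear (\<lambda>f. op_of f x)"
proof (rule bounded_linear_intro[of _ "norm x"])
  show "norm (op_of f x) \<le> norm f * norm x" for f
    using norm_blinfun[of "op_of f" x] by (simp add: norm_op_of)
qed (simp_all add: plus_bop.rep_eq scaleR_bop.rep_eq blinfun.bilinear_simps)

lemma has_vector_derivative_norm_bound:
  fixes \<phi> :: "real \<Rightarrow> 'a::real_normed_vector"
  assumes t: "0 \<le> t" and d: "\<And>r. (\<phi> has_vector_derivative \<phi>' r) (at r)"
    and K: "\<And>r. 0 \<le> r \<Longrightarrow> r \<le> t \<Longrightarrow> norm (\<phi>' r) \<le> K"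
  shows "norm (\<phi> t - \<phi> 0) \<le> t * K"
proof (cases "t = 0")
  case False
  have "norm (\<phi> t - \<phi> 0) \<le> t * K - 0 * K"
  proof (rule differentiable_bound_general[where f' = \<phi>' and \<phi>' = "\<lambda>_. K"])
    show "continuous_on {0..t} \<phi>"
      by (meson continuous_at_imp_continuous_on d has_vector_derivative_continuous)
  qed (use t False K d in \<open>auto intro!: continuous_intros derivative_eq_intros\<close>)
  then show ?thesis by simp
qed simp

subsection \<open>Exponentials of dissipative bounded operators\<close>

text \<open>exp(ts(J - 1)) = exp(-ts) exp(tsJ), and for a contraction J the second factor is at most
  exp(ts).\<close>

lemma norm_exp_yosida_le:
  fixes J :: "'a::{banach, perfect_space} bop"
  assumes "norm J \<le> 1" "s \<ge> 0" "t \<ge> 0"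
  shows "norm (exp (t *\<^sub>R (s *\<^sub>R (J - 1)))) \<le> 1"
proof -
  have "t *\<^sub>R (s *\<^sub>R (J - 1)) = of_real (- (t * s)) + (t * s) *\<^sub>R J"
    by (simp add: of_real_def scaleR_diff_right)
  moreover have "exp (of_real (- (t * s)) + (t * s) *\<^sub>R J) = exp (of_real (- (t * s))) * exp ((t * s) *\<^sub>R J)"
    by (rule exp_add_commuting) (simp add: of_real_def)
  ultimately have "exp (t *\<^sub>R (s *\<^sub>R (J - 1))) = of_real (exp (- (t * s))) * exp ((t * s) *\<^sub>R J)"
    by (simp only: exp_of_real)
  then have "norm (exp (t *\<^sub>R (s *\<^sub>R (J - 1)))) \<le> exp (- (t * s)) * norm (exp ((t * s) *\<^sub>R J))"
    using norm_mult_ineq[of "of_real (exp (- (t * s))) :: 'a bop" "exp ((t * s) *\<^sub>R J)"] by simp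
  also have "\<dots> \<le> exp (- (t * s)) * exp (norm ((t * s) *\<^sub>R J))"
    by (intro mult_left_mono norm_exp) auto
  also have "\<dots> \<le> exp (- (t * s)) * exp (t * s)"
    using assms by (auto simp: mult_left_le)
  also have "\<dots> = 1" by (simp add: exp_minus)
  finally show ?thesis .
qed

text \<open>The path \<Phi> runs from exp(tC) to exp(tB) with derivative \<Phi> (B - C). Written as
  exp(rB) exp((t - r)C) it consists of contractions; commutation makes this form agree with the one
  that is easy to differentiate.\<close>

lemma exp_diff_bound:
  fixes B C :: "'a::{banach, perfect_space} bop"
  assumes comm: "B * C = C * B" and t: "t \<ge> 0"
    and B: "\<And>r. r \<ge> 0 \<Longrightarrow> norm (exp (r *\<^sub>R B)) \<le> 1" and C: "\<And>r. r \<ge> 0 \<Longrightarrow> norm (exp (r *\<^sub>R C)) \<le> 1"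
  shows "norm (op_of (exp (t *\<^sub>R B)) x - op_of (exp (t *\<^sub>R C)) x) \<le> t * norm (op_of B x - op_of C x)"
proof -
  define \<Phi> where "\<Phi> = (\<lambda>r. exp (t *\<^sub>R C) * exp (r *\<^sub>R (B - C)))"
  have eq: "\<Phi> r = exp (r *\<^sub>R B) * exp ((t - r) *\<^sub>R C)" for r
    unfolding \<Phi>_def by (subst (1 2) exp_add_commuting[symmetric]) (auto simp: algebra_simps comm)
  have d: "(\<Phi> has_vector_derivative \<Phi> r * (B - C)) (at r)" for r
    unfolding \<Phi>_def mult.assoc
    by (rule bounded_linear.has_vector_derivative[OF bounded_linear_mult_right exp_scaleR_has_vector_derivative_right])
  have "norm (op_of (\<Phi> t) x - op_of (\<Phi> 0) x) \<le> t * norm (op_of B x - op_of C x)"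
  proof (rule has_vector_derivative_norm_bound[OF t bounded_linear.has_vector_derivative[OF bounded_linear_op_of d]])
    fix r assume r: "0 \<le> r" "r \<le> t"
    have "norm (\<Phi> r) \<le> norm (exp (r *\<^sub>R B)) * norm (exp ((t - r) *\<^sub>R C))"
      unfolding eq by (rule norm_mult_ineq)
    also have "\<dots> \<le> 1 * 1" using r by (intro mult_mono B C) auto
    finally have "norm (op_of (\<Phi> r)) \<le> 1" by (simp add: norm_op_of)
    then have "norm (op_of (\<Phi> r) (op_of B x - op_of C x)) \<le> 1 * norm (op_of B x - op_of C x)"
      by (intro order_trans[OF norm_blinfun] mult_right_mono) auto
    then show "norm (op_of (\<Phi> r * (B - C)) x) \<le> norm (op_of B x - op_of C x)"
      by (simp add: op_of_simps)
  qed
  then show ?thesis by (simp add: eq)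
qed

subsection \<open>The Hille--Yosida theorem\<close>

text \<open>\<open>resolvent\<close> expresses in one equivalence that \<open>R \<kappa>\<close>
  inverts \<kappa> - A, and it makes the graph linear and closed. With the bound 1 / (\<kappa> -
  \<omega>) on the resolvent itself, A - \<omega> generates contractions and higher powers need no
  separate treatment.\<close>

locale hille_yosida =
  fixes A :: "('a::{banach, perfect_space} \<times> 'a) set" and R :: "real \<Rightarrow> 'a \<Rightarrow>\<^sub>L 'a" and \<omega> \<kappa>\<^sub>0 :: real
  assumes kappa0: "\<omega> < \<kappa>\<^sub>0"
    and norm_R: "\<And>\<kappa>. \<kappa> \<ge> \<kappa>\<^sub>0 \<Longrightarrow> norm (R \<kappa>) \<le> 1 / (\<kappa> - \<omega>)"
    and resolvent: "\<And>\<kappa> x y. \<kappa> \<ge> \<kappa>\<^sub>0 \<Longrightarrow> (x, y) \<in> A \<longleftrightarrow> R \<kappa> (\<kappa> *\<^sub>R x - y) = x"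
    and dense: "\<And>x e. e > 0 \<Longrightarrow> \<exists>(y, z) \<in> A. norm (x - y) < e"
begin

lemma R_in_A: "\<kappa> \<ge> \<kappa>\<^sub>0 \<Longrightarrow> (R \<kappa> y, \<kappa> *\<^sub>R R \<kappa> y - y) \<in> A"
  by (subst resolvent) auto

text \<open>This compares the resolvent identity with its copy in which \<kappa> and \<nu> are
  exchanged. Commutation is what allows the exponentials of two Yosida approximations to be
  compared.\<close>

lemma R_commute:
  assumes "\<kappa> \<ge> \<kappa>\<^sub>0" "\<nu> \<ge> \<kappa>\<^sub>0"
  shows "R \<kappa> (R \<nu> y) = R \<nu> (R \<kappa> y)"
proof (cases "\<kappa> = \<nu>")
  case False
  have id: "R \<nu> y = (\<kappa> - \<nu>) *\<^sub>R R \<kappa> (R \<nu> y) + R \<kappa> y" if "\<kappa> \<ge> \<kappa>\<^sub>0" "\<nu> \<ge> \<kappa>\<^sub>0" for \<kappa> \<nu>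
    using R_in_A[OF that(2), of y] unfolding resolvent[OF that(1)]
    by (simp add: blinfun.bilinear_simps algebra_simps)
  have "(\<kappa> - \<nu>) *\<^sub>R R \<kappa> (R \<nu> y) = R \<nu> y - R \<kappa> y"
    using id[OF assms] by (simp only: eq_diff_eq)
  also have "\<dots> = - (R \<kappa> y - R \<nu> y)" by simp
  also have "R \<kappa> y - R \<nu> y = (\<nu> - \<kappa>) *\<^sub>R R \<nu> (R \<kappa> y)"
    using id[OF assms(2,1)] by (simp only: diff_eq_eq)
  also have "- \<dots> = (\<kappa> - \<nu>) *\<^sub>R R \<nu> (R \<kappa> y)"
    by (simp only: scaleR_minus_left[symmetric] minus_diff_eq)
  finally have "(\<kappa> - \<nu>) *\<^sub>R R \<kappa> (R \<nu> y) = (\<kappa> - \<nu>) *\<^sub>R R \<nu> (R \<kappa> y)" .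
  with False show ?thesis by simp
qed simp

section \<open>Yosida approximation\<close>

definition s where "s n = max 1 (\<kappa>\<^sub>0 - \<omega>) + real n"
text \<open>\<open>B n\<close> = s (s R(\<omega> + s) - 1) is the Yosida approximation of A -
  \<omega>, with the parameter \<open>s n\<close> tending to infinity. The shift by \<omega> makes
  \<open>J n\<close> and the exponentials \<open>V n\<close> contractions; the offset in
  \<open>s n\<close> keeps \<omega> + s in the range where the resolvent is controlled.\<close>

definition J where "J n = Bop (s n *\<^sub>R R (\<omega> + s n))"
definition B where "B n = s n *\<^sub>R (J n - 1)"
definition V where "V n t = op_of (exp (t *\<^sub>R B n))"

lemma s: "s n \<ge> 1" "s n > 0" "\<omega> + s n \<ge> \<kappa>\<^sub>0"
  by (auto simp: s_def)

lemma norm_J: "norm (J n) \<le> 1"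
proof -
  have "norm (J n) = s n * norm (R (\<omega> + s n))"
    using s(2)[of n] by (simp add: J_def norm_bop.rep_eq op_of_simps)
  also have "\<dots> \<le> s n * (1 / (\<omega> + s n - \<omega>))"
    using s(2)[of n] by (intro mult_left_mono norm_R s(3)) auto
  finally show ?thesis using s(2)[of n] by simp
qed

lemma norm_J_apply: "norm (op_of (J n) x) \<le> norm x"
  using norm_blinfun[of "op_of (J n)" x] mult_right_mono[OF norm_J[of n], of "norm x"] by (simp add: norm_op_of)

lemma J_commute: "J n * J m = J m * J n"
  unfolding J_def
  by (rule op_of_inject[THEN iffD1], rule blinfun_eqI)
    (simp add: op_of_simps blinfun.bilinear_simps R_commute[OF s(3) s(3)])

lemma B_commute: "B n * B m = B m * B n"
  by (simp add: B_def algebra_simps J_commute)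

lemma norm_exp_B: "t \<ge> 0 \<Longrightarrow> norm (exp (t *\<^sub>R B n)) \<le> 1"
  unfolding B_def by (rule norm_exp_yosida_le[OF norm_J]) (use s(2)[of n] in auto)

lemma norm_V: "t \<ge> 0 \<Longrightarrow> norm (V n t x) \<le> norm x"
  using norm_blinfun[of "V n t" x] mult_right_mono[OF norm_exp_B[of t n], of "norm x"]
  by (simp add: V_def norm_op_of)

text \<open>On the domain the approximation is \<open>J n\<close> after A - \<omega>. Its
  convergence thus reduces to that of \<open>J n\<close> to the identity, and it is bounded
  uniformly in \<open>n\<close>.\<close>

lemma B_eq:
  assumes "(x, y) \<in> A"
  shows "op_of (B n) x = op_of (J n) (y - \<omega> *\<^sub>R x)"
proof -
  have "x = R (\<omega> + s n) ((\<omega> + s n) *\<^sub>R x - y)"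
    using assms unfolding resolvent[OF s(3)[of n]] by simp
  then have "s n *\<^sub>R x = s n *\<^sub>R R (\<omega> + s n) (s n *\<^sub>R x - (y - \<omega> *\<^sub>R x))"
    by (simp add: algebra_simps)
  then show ?thesis
    by (simp add: B_def J_def op_of_simps blinfun.bilinear_simps scaleR_diff_right)
qed

lemma norm_B_apply: "(x, y) \<in> A \<Longrightarrow> norm (op_of (B n) x) \<le> norm (y - \<omega> *\<^sub>R x)"
  by (simp add: B_eq norm_J_apply)

lemma s_lim: "(\<lambda>n. K / s n) \<longlonglongrightarrow> 0"
proof (rule real_tendsto_divide_at_top[OF tendsto_const])
  show "filterlim s at_top sequentially"
    unfolding s_def by (intro filterlim_tendsto_add_at_top[OF tendsto_const] filterlim_real_sequentially)
qed

text \<open>On the domain J y - y = B y / s tends to 0 because B y stays bounded; contractivity and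
  density extend this to every vector.\<close>

lemma J_tendsto: "(\<lambda>n. op_of (J n) x) \<longlonglongrightarrow> x"
proof (rule LIMSEQ_I)
  fix e :: real assume e: "e > 0"
  obtain y z where yz: "(y, z) \<in> A" "norm (x - y) < e / 3" using dense[of "e / 3" x] e by auto
  define K where "K = norm (z - \<omega> *\<^sub>R y)"
  obtain N where "\<forall>n\<ge>N. norm (K / s n - 0) < e / 3"
    using LIMSEQ_D[OF s_lim[of K], of "e / 3"] e by auto
  then have N: "K / s n < e / 3" if "n \<ge> N" for n
    using that by (simp only: real_norm_def diff_0_right le_less_trans[OF abs_ge_self])
  have "norm (op_of (J n) x - x) < e" if "n \<ge> N" for n
  proof -
    have "op_of (J n) y - y = (1 / s n) *\<^sub>R op_of (B n) y"
      using s(2)[of n] by (simp add: B_def op_of_simps)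
    then have "norm (op_of (J n) y - y) = norm (op_of (B n) y) / s n"
      using s(2)[of n] by simp
    also have "\<dots> \<le> K / s n" using norm_B_apply[OF yz(1)] s(2)[of n] by (simp add: K_def divide_right_mono)
    finally have 1: "norm (op_of (J n) y - y) < e / 3" using N[OF that] by linarith
    have "op_of (J n) x - x = op_of (J n) (x - y) + (op_of (J n) y - y) - (x - y)"
      by (simp add: blinfun.bilinear_simps)
    also have "norm \<dots> \<le> norm (op_of (J n) (x - y)) + norm (op_of (J n) y - y) + norm (x - y)"
      by (rule order_trans[OF norm_triangle_ineq4 add_right_mono[OF norm_triangle_ineq]])
    finally show ?thesis using norm_J_apply[of n "x - y"] 1 yz(2) by linarith
  qed
  then show "\<exists>N. \<forall>n\<ge>N. norm (op_of (J n) x - x) < e" by blast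
qed

lemma B_tendsto: "(x, y) \<in> A \<Longrightarrow> (\<lambda>n. op_of (B n) x) \<longlonglongrightarrow> y - \<omega> *\<^sub>R x"
  unfolding B_eq by (rule J_tendsto)

lemma V_diff: "t \<ge> 0 \<Longrightarrow> norm (V n t x - V m t x) \<le> t * norm (op_of (B n) x - op_of (B m) x)"
  unfolding V_def by (rule exp_diff_bound[OF B_commute]) (auto intro: norm_exp_B)

text \<open>On the domain the Cauchy property is inherited from \<open>B n\<close> through
  \<open>V_diff\<close>; contractivity and density give it everywhere.\<close>

lemma V_convergent:
  assumes t: "t \<ge> 0"
  shows "convergent (\<lambda>n. V n t x)"
proof (rule Cauchy_convergent, rule CauchyI)
  fix e :: real assume e: "e > 0"
  obtain y z where yz: "(y, z) \<in> A" "norm (x - y) < e / 3" using dense[of "e / 3" x] e by auto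
  have "Cauchy (\<lambda>n. op_of (B n) y)" using B_tendsto[OF yz(1)] by (rule LIMSEQ_imp_Cauchy)
  then obtain N where N: "\<And>n m. n \<ge> N \<Longrightarrow> m \<ge> N \<Longrightarrow> norm (op_of (B n) y - op_of (B m) y) < e / (3 * (t + 1))"
    using e t CauchyD[of _ "e / (3 * (t + 1))"] by (metis add_nonneg_pos divide_pos_pos mult_pos_pos zero_less_numeral zero_less_one)
  have "norm (V m t x - V n t x) < e" if "m \<ge> N" "n \<ge> N" for m n
  proof -
    have "norm (V m t y - V n t y) \<le> t * norm (op_of (B m) y - op_of (B n) y)" by (rule V_diff[OF t])
    also have "\<dots> \<le> t * (e / (3 * (t + 1)))" using N[OF that] t by (intro mult_left_mono) auto
    also have "\<dots> \<le> e / 3" using e t by (simp add: field_simps)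
    finally have 1: "norm (V m t y - V n t y) \<le> e / 3" .
    have "V m t x - V n t x = V m t (x - y) + (V m t y - V n t y) - V n t (x - y)"
      by (simp add: blinfun.bilinear_simps)
    also have "norm \<dots> \<le> norm (V m t (x - y)) + norm (V m t y - V n t y) + norm (V n t (x - y))"
      by (rule order_trans[OF norm_triangle_ineq4 add_right_mono[OF norm_triangle_ineq]])
    finally show ?thesis
      using norm_V[OF t, of m "x - y"] norm_V[OF t, of n "x - y"] 1 yz(2) by linarith
  qed
  then show "\<exists>M. \<forall>m\<ge>M. \<forall>n\<ge>M. norm (V m t x - V n t x) < e" by blast
qed

section \<open>The limit semigroup\<close>

definition W where "W t = Blinfun (\<lambda>x. lim (\<lambda>n. V n t x))"

text \<open>\<open>lim\<close> and \<open>Blinfun\<close> give \<open>W t\<close> its meaning only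
  once convergence, linearity and boundedness are known, which is established for t \<ge> 0.\<close>

lemma V_tendsto_W:
  assumes t: "t \<ge> 0"
  shows "(\<lambda>n. V n t x) \<longlonglongrightarrow> W t x"
proof -
  have l: "(\<lambda>n. V n t x) \<longlonglongrightarrow> lim (\<lambda>n. V n t x)" for x
    using V_convergent[OF t] by (simp add: convergent_LIMSEQ_iff)
  have "bounded_linear (\<lambda>x. lim (\<lambda>n. V n t x))"
  proof (rule bounded_linear_intro[of _ 1])
    fix x y :: 'a and r :: real
    show "lim (\<lambda>n. V n t (x + y)) = lim (\<lambda>n. V n t x) + lim (\<lambda>n. V n t y)"
      by (rule limI) (simp add: blinfun.bilinear_simps tendsto_add l)
    show "lim (\<lambda>n. V n t (r *\<^sub>R x)) = r *\<^sub>R lim (\<lambda>n. V n t x)"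
      by (rule limI) (simp add: blinfun.bilinear_simps tendsto_scaleR l)
    show "norm (lim (\<lambda>n. V n t x)) \<le> norm x * 1"
      using LIMSEQ_le_const2[OF tendsto_norm[OF l[of x]], of "norm x"] norm_V[OF t] by auto
  qed
  then show ?thesis using l by (simp add: W_def bounded_linear_Blinfun_apply)
qed

lemma norm_W: "t \<ge> 0 \<Longrightarrow> norm (W t x) \<le> norm x"
  by (rule LIMSEQ_le_const2[OF tendsto_norm[OF V_tendsto_W]]) (auto intro: norm_V)

lemma W_0: "W 0 = id_blinfun"
proof (rule blinfun_eqI)
  fix x
  have "(\<lambda>n. x) \<longlonglongrightarrow> W 0 x" using V_tendsto_W[of 0 x] by (simp add: V_def op_of_simps)
  then show "W 0 x = id_blinfun x" by (simp add: LIMSEQ_const_iff)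
qed

text \<open>Strong limits may be multiplied because the \<open>V n r\<close> are uniformly bounded:
  V r (V t x - W t x) tends to 0.\<close>

lemma W_add:
  assumes "r \<ge> 0" "t \<ge> 0"
  shows "W (r + t) = W r o\<^sub>L W t"
proof (rule blinfun_eqI)
  fix x
  have "(\<lambda>n. V n r (V n t x - W t x)) \<longlonglongrightarrow> 0"
  proof (rule tendsto_norm_zero_cancel, rule tendsto_sandwich[OF _ _ tendsto_const])
    show "(\<lambda>n. norm (V n t x - W t x)) \<longlonglongrightarrow> 0"
      by (rule tendsto_norm_zero[OF LIM_zero[OF V_tendsto_W[OF assms(2)]]])
  qed (auto intro: always_eventually norm_V[OF assms(1)])
  then have "(\<lambda>n. V n r (V n t x - W t x) + V n r (W t x)) \<longlonglongrightarrow> 0 + W r (W t x)"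
    by (intro tendsto_add V_tendsto_W assms)
  moreover have "V n r (V n t x - W t x) + V n r (W t x) = V n (r + t) x" for n
  proof -
    have "exp ((r + t) *\<^sub>R B n) = exp (r *\<^sub>R B n) * exp (t *\<^sub>R B n)"
      by (subst exp_add_commuting[symmetric]) (auto simp: algebra_simps)
    then show ?thesis by (simp add: V_def op_of_simps blinfun.bilinear_simps)
  qed
  ultimately have "(\<lambda>n. V n (r + t) x) \<longlonglongrightarrow> W r (W t x)" by simp
  then show "W (r + t) x = (W r o\<^sub>L W t) x"
    using LIMSEQ_unique V_tendsto_W[of "r + t" x] assms by fastforce
qed

lemma V_has_vector_derivative: "((\<lambda>t. V n t x) has_vector_derivative V n t (op_of (B n) x)) (at t)"
  unfolding V_def op_of_simps(1)[symmetric]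
  by (rule bounded_linear.has_vector_derivative[OF bounded_linear_op_of exp_scaleR_has_vector_derivative_right])

lemma V_0: "V n 0 x = x"
  by (simp add: V_def op_of_simps)

lemma norm_V_diff_le:
  assumes "(x, y) \<in> A" "t \<ge> 0"
  shows "norm (V n t x - x) \<le> t * norm (y - \<omega> *\<^sub>R x)"
  using has_vector_derivative_norm_bound[OF assms(2) V_has_vector_derivative, of n x "norm (y - \<omega> *\<^sub>R x)"]
    order_trans[OF norm_V norm_B_apply[OF assms(1)]] by (simp add: V_0)

lemma norm_V_diff_le_approx:
  assumes "(z, z') \<in> A" "t \<ge> 0"
  shows "norm (V n t x - x) \<le> 2 * norm (x - z) + t * norm (z' - \<omega> *\<^sub>R z)"
proof -
  have "V n t x - x = V n t (x - z) + (V n t z - z) - (x - z)"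
    by (simp add: blinfun.bilinear_simps)
  also have "norm \<dots> \<le> norm (V n t (x - z)) + norm (V n t z - z) + norm (x - z)"
    by (rule order_trans[OF norm_triangle_ineq4 add_right_mono[OF norm_triangle_ineq]])
  finally show ?thesis
    using norm_V[OF assms(2), of n "x - z"] norm_V_diff_le[OF assms, of n] by linarith
qed

lemma norm_W_diff_le_approx:
  assumes "(z, z') \<in> A" "t \<ge> 0"
  shows "norm (W t x - x) \<le> 2 * norm (x - z) + t * norm (z' - \<omega> *\<^sub>R z)"
  using LIMSEQ_le_const2[OF tendsto_norm[OF tendsto_diff[OF V_tendsto_W[OF assms(2)] tendsto_const]]]
    norm_V_diff_le_approx[OF assms] by blast

text \<open>The mean value inequality is applied to V r x - r B x before passing to the limit in
  \<open>n\<close>. As y' may lie outside the domain, a domain element \<open>z\<close> near it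
  measures how fast V r y' departs from y'.\<close>

lemma W_expansion:
  assumes xy: "(x, y) \<in> A" and z: "(z, z') \<in> A" and t: "t \<ge> 0"
  defines "y' \<equiv> y - \<omega> *\<^sub>R x"
  shows "norm (W t x - x - t *\<^sub>R y') \<le> t * (2 * norm (y' - z) + t * norm (z' - \<omega> *\<^sub>R z))"
proof (rule LIMSEQ_le)
  define D where "D = (\<lambda>n. norm (op_of (B n) x - y'))"
  have D: "D \<longlonglongrightarrow> 0" unfolding D_def y'_def by (rule tendsto_norm_zero[OF LIM_zero[OF B_tendsto[OF xy]]])
  show "(\<lambda>n. norm (V n t x - x - t *\<^sub>R op_of (B n) x)) \<longlonglongrightarrow> norm (W t x - x - t *\<^sub>R y')"
    unfolding y'_def by (intro tendsto_intros V_tendsto_W t B_tendsto xy)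
  show "(\<lambda>n. t * (2 * D n + (2 * norm (y' - z) + t * norm (z' - \<omega> *\<^sub>R z))))
      \<longlonglongrightarrow> t * (2 * norm (y' - z) + t * norm (z' - \<omega> *\<^sub>R z))"
    by (rule tendsto_eq_intros D refl | simp)+
  have "norm (V n t x - x - t *\<^sub>R op_of (B n) x) \<le> t * (2 * D n + (2 * norm (y' - z) + t * norm (z' - \<omega> *\<^sub>R z)))" for n
  proof -
    define \<phi> where "\<phi> = (\<lambda>r. V n r x - r *\<^sub>R op_of (B n) x)"
    have d: "(\<phi> has_vector_derivative V n r (op_of (B n) x) - op_of (B n) x) (at r)" for r
      unfolding \<phi>_def by (auto intro!: derivative_eq_intros V_has_vector_derivative)
    have "norm (\<phi> t - \<phi> 0) \<le> t * (2 * D n + (2 * norm (y' - z) + t * norm (z' - \<omega> *\<^sub>R z)))"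
    proof (rule has_vector_derivative_norm_bound[OF t d])
      fix r assume r: "0 \<le> r" "r \<le> t"
      have "V n r (op_of (B n) x) - op_of (B n) x = V n r (op_of (B n) x - y') + (V n r y' - y') - (op_of (B n) x - y')"
        by (simp add: blinfun.bilinear_simps)
      also have "norm \<dots> \<le> norm (V n r (op_of (B n) x - y')) + norm (V n r y' - y') + norm (op_of (B n) x - y')"
        by (rule order_trans[OF norm_triangle_ineq4 add_right_mono[OF norm_triangle_ineq]])
      finally have "norm (V n r (op_of (B n) x) - op_of (B n) x) \<le> 2 * D n + norm (V n r y' - y')"
        using norm_V[OF r(1), of n "op_of (B n) x - y'"] by (simp add: D_def)
      also have "norm (V n r y' - y') \<le> 2 * norm (y' - z) + r * norm (z' - \<omega> *\<^sub>R z)"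
        by (rule norm_V_diff_le_approx[OF z r(1)])
      also have "r * norm (z' - \<omega> *\<^sub>R z) \<le> t * norm (z' - \<omega> *\<^sub>R z)"
        using r by (intro mult_right_mono) auto
      finally show "norm (V n r (op_of (B n) x) - op_of (B n) x) \<le> 2 * D n + (2 * norm (y' - z) + t * norm (z' - \<omega> *\<^sub>R z))"
        by simp
    qed
    then show ?thesis by (simp add: \<phi>_def V_0 algebra_simps)
  qed
  then show "\<exists>N. \<forall>n\<ge>N. norm (V n t x - x - t *\<^sub>R op_of (B n) x) \<le> t * (2 * D n + (2 * norm (y' - z) + t * norm (z' - \<omega> *\<^sub>R z)))"
    by blast
qed

lemma W_right_derivative:
  assumes xy: "(x, y) \<in> A"
  shows "((\<lambda>t. (W t x - x) /\<^sub>R t) \<longlongrightarrow> y - \<omega> *\<^sub>R x) (at_right 0)"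
proof (rule tendstoI)
  define y' where "y' = y - \<omega> *\<^sub>R x"
  fix e :: real assume e: "e > 0"
  obtain z z' where z: "(z, z') \<in> A" "norm (y' - z) < e / 4" using dense[of "e / 4" y'] e by auto
  define K where "K = norm (z' - \<omega> *\<^sub>R z)"
  have "\<forall>\<^sub>F t in at_right 0. t \<in> {0<..<e / (2 * (K + 1))}"
    using e by (intro eventually_at_right_real) (simp add: K_def add_nonneg_pos)
  then show "\<forall>\<^sub>F t in at_right 0. dist ((W t x - x) /\<^sub>R t) (y - \<omega> *\<^sub>R x) < e"
  proof eventually_elim
    case (elim t)
    then have t: "t > 0" "t < e / (2 * (K + 1))" by auto
    have "K \<ge> 0" by (simp add: K_def)
    then have "t * (K + 1) < e / 2" using t(2) by (simp add: field_simps)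
    then have tK: "t * K < e / 2" using t(1) by (simp add: distrib_left)
    have eq: "(W t x - x) /\<^sub>R t - y' = (W t x - x - t *\<^sub>R y') /\<^sub>R t"
      using t by (simp add: scaleR_diff_right)
    have "norm ((W t x - x) /\<^sub>R t - y') = norm (W t x - x - t *\<^sub>R y') / t"
      unfolding eq norm_scaleR using t by (simp add: divide_inverse)
    also have "\<dots> \<le> 2 * norm (y' - z) + t * K"
      using W_expansion[OF xy z(1), of t] t by (simp add: y'_def K_def field_simps)
    also have "\<dots> < e" using z(2) tK by linarith
    finally show ?case by (simp add: dist_norm y'_def)
  qed
qed

text \<open>The factor undoes the shift of A by \<omega>.\<close>

definition U where "U t = exp (\<omega> * t) *\<^sub>R W t"

lemma norm_U: "t \<ge> 0 \<Longrightarrow> norm (U t) \<le> exp (\<omega> * t)"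
  using norm_blinfun_bound[of 1 "W t"] norm_W by (simp add: U_def)

lemma W_Lipschitz_at:
  assumes t: "t \<ge> 0" "r \<ge> 0"
  shows "norm (W t x - W r x) \<le> norm (W \<bar>t - r\<bar> x - x)"
proof -
  have *: "norm (W t x - W r x) \<le> norm (W (t - r) x - x)" if "r \<le> t" "0 \<le> r" for t r
  proof -
    have "W t x = W r (W (t - r) x)" using W_add[of r "t - r"] that by simp
    then have "W t x - W r x = W r (W (t - r) x - x)" by (simp add: blinfun.bilinear_simps)
    then show ?thesis using norm_W[OF that(2)] by simp
  qed
  show ?thesis
  proof (cases "r \<le> t")
    case False
    then show ?thesis using *[of t r] t by (simp add: norm_minus_commute abs_if)
  qed (use *[of r t] t in auto)
qed

lemma W_continuous: "continuous_on {0..} (\<lambda>t. W t x)"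
  unfolding continuous_on_iff
proof (intro ballI allI impI)
  fix r e :: real assume r: "r \<in> {0..}" and e: "e > 0"
  obtain z z' where z: "(z, z') \<in> A" "norm (x - z) < e / 4" using dense[of "e / 4" x] e by auto
  define K where "K = norm (z' - \<omega> *\<^sub>R z)"
  have K: "K \<ge> 0" by (simp add: K_def)
  have "dist (W t x) (W r x) < e" if t: "t \<in> {0..}" "dist t r < e / (2 * (K + 1))" for t
  proof -
    have "\<bar>t - r\<bar> * (K + 1) < e / 2" using t(2) K by (simp add: dist_real_def field_simps)
    moreover have "\<bar>t - r\<bar> * K \<le> \<bar>t - r\<bar> * (K + 1)" by (intro mult_left_mono) auto
    ultimately have tK: "\<bar>t - r\<bar> * K < e / 2" by linarith
    have "norm (W t x - W r x) \<le> norm (W \<bar>t - r\<bar> x - x)" using t r by (intro W_Lipschitz_at) auto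
    also have "\<dots> \<le> 2 * norm (x - z) + \<bar>t - r\<bar> * K"
      unfolding K_def by (rule norm_W_diff_le_approx[OF z(1)]) simp
    also have "\<dots> < e" using tK z(2) by linarith
    finally show ?thesis by (simp add: dist_norm)
  qed
  then show "\<exists>d>0. \<forall>t\<in>{0..}. dist t r < d \<longrightarrow> dist (W t x) (W r x) < e"
    using e K by (intro exI[of _ "e / (2 * (K + 1))"]) (auto intro!: divide_pos_pos mult_pos_pos)
qed

lemma C0_semigroup_U: "C0_semigroup U"
  unfolding C0_semigroup_def
proof (intro conjI allI impI)
  show "U 0 = id_blinfun" by (simp add: U_def W_0)
  show "U (r + t) = U r o\<^sub>L U t" if "r \<ge> 0" "t \<ge> 0" for r t
    by (rule blinfun_eqI)
      (simp add: U_def W_add that blinfun.bilinear_simps distrib_left exp_add)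
  show "continuous_on {0..} (\<lambda>t. U t x)" for x
    unfolding U_def scaleR_blinfun.rep_eq by (intro continuous_intros W_continuous)
qed

section \<open>Identification of the generator\<close>

lemma exp_difference_quotient: "((\<lambda>t. (exp (\<omega> * t) - 1) / t) \<longlongrightarrow> \<omega>) (at_right 0)"
proof -
  have "((\<lambda>t. exp (\<omega> * t)) has_field_derivative \<omega>) (at 0)"
    by (auto intro!: derivative_eq_intros)
  then show ?thesis
    by (simp add: DERIV_def) (meson at_le filterlim_mono order_refl subset_UNIV)
qed

lemma A_subset_generator_U: "A \<subseteq> generator U"
proof (rule subsetI, clarify)
  fix x y assume xy: "(x, y) \<in> A"
  have c: "((\<lambda>t. exp (\<omega> * t)) \<longlongrightarrow> exp (\<omega> * 0)) (at_right 0)" by (intro tendsto_intros)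
  have "((\<lambda>t. exp (\<omega> * t) *\<^sub>R ((W t x - x) /\<^sub>R t) + ((exp (\<omega> * t) - 1) / t) *\<^sub>R x) \<longlongrightarrow>
      exp (\<omega> * 0) *\<^sub>R (y - \<omega> *\<^sub>R x) + \<omega> *\<^sub>R x) (at_right 0)"
    by (intro tendsto_add tendsto_scaleR c exp_difference_quotient W_right_derivative[OF xy] tendsto_const)
  moreover have "exp (\<omega> * t) *\<^sub>R ((W t x - x) /\<^sub>R t) + ((exp (\<omega> * t) - 1) / t) *\<^sub>R x = (U t x - x) /\<^sub>R t" for t
    by (simp add: U_def blinfun.bilinear_simps algebra_simps divide_inverse)
  ultimately show "(x, y) \<in> generator U" by (simp add: generator_def)
qed

text \<open>For (x, y) in the generator, some \<open>z\<close> in the domain of A solves the same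
  resolvent equation. If v = x - z were nonzero, it would be an eigenvector of the generator for the
  eigenvalue \<open>\<kappa>\<^sub>0\<close> > \<omega>, against the growth bound
  exp(\<omega>t).\<close>

lemma generator_U: "generator U = A"
proof
  show "generator U \<subseteq> A"
  proof (rule subsetI, clarify)
    fix x y assume xy: "(x, y) \<in> generator U"
    define z where "z = R \<kappa>\<^sub>0 (\<kappa>\<^sub>0 *\<^sub>R x - y)"
    have zA: "(z, \<kappa>\<^sub>0 *\<^sub>R z - (\<kappa>\<^sub>0 *\<^sub>R x - y)) \<in> A"
      unfolding z_def by (rule R_in_A) simp
    define v where "v = x - z"
    define q where "q = (\<lambda>t. (U t v - v) /\<^sub>R t)"
    have "((\<lambda>t. (U t x - x) /\<^sub>R t - (U t z - z) /\<^sub>R t) \<longlongrightarrow> y - (\<kappa>\<^sub>0 *\<^sub>R z - (\<kappa>\<^sub>0 *\<^sub>R x - y))) (at_right 0)"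
      using xy zA A_subset_generator_U by (intro tendsto_diff) (auto simp: generator_def)
    moreover have "(U t x - x) /\<^sub>R t - (U t z - z) /\<^sub>R t = q t" for t
      by (simp add: q_def v_def blinfun.bilinear_simps algebra_simps)
    moreover have "y - (\<kappa>\<^sub>0 *\<^sub>R z - (\<kappa>\<^sub>0 *\<^sub>R x - y)) = \<kappa>\<^sub>0 *\<^sub>R v"
      by (simp add: v_def algebra_simps)
    ultimately have q: "(q \<longlongrightarrow> \<kappa>\<^sub>0 *\<^sub>R v) (at_right 0)" by simp
    \<comment> \<open>The subtracted norm is 0; it is kept in the form in which it arises as a
      limit.\<close>
    have "\<kappa>\<^sub>0 * norm v - norm (\<kappa>\<^sub>0 *\<^sub>R v - \<kappa>\<^sub>0 *\<^sub>R v) \<le> \<omega> * norm v"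
    proof (rule tendsto_le[OF trivial_limit_at_right_real])
      show "((\<lambda>t. (exp (\<omega> * t) - 1) / t * norm v) \<longlongrightarrow> \<omega> * norm v) (at_right 0)"
        by (intro tendsto_intros exp_difference_quotient)
      show "((\<lambda>t. \<kappa>\<^sub>0 * norm v - norm (q t - \<kappa>\<^sub>0 *\<^sub>R v)) \<longlongrightarrow> \<kappa>\<^sub>0 * norm v - norm (\<kappa>\<^sub>0 *\<^sub>R v - \<kappa>\<^sub>0 *\<^sub>R v)) (at_right 0)"
        by (intro tendsto_intros q)
      show "\<forall>\<^sub>F t in at_right 0. \<kappa>\<^sub>0 * norm v - norm (q t - \<kappa>\<^sub>0 *\<^sub>R v) \<le> (exp (\<omega> * t) - 1) / t * norm v"
        using eventually_at_right_less[of 0]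
      proof eventually_elim
        case (elim t)
        have "(1 + t * \<kappa>\<^sub>0) *\<^sub>R v = U t v - t *\<^sub>R (q t - \<kappa>\<^sub>0 *\<^sub>R v)"
          using elim by (simp add: q_def algebra_simps)
        then have "(1 + t * \<kappa>\<^sub>0) * norm v \<le> norm (U t v - t *\<^sub>R (q t - \<kappa>\<^sub>0 *\<^sub>R v))"
          by (metis abs_ge_self mult_right_mono norm_ge_zero norm_scaleR)
        also have "\<dots> \<le> norm (U t v) + norm (t *\<^sub>R (q t - \<kappa>\<^sub>0 *\<^sub>R v))" by (rule norm_triangle_ineq4)
        also have "norm (U t v) \<le> exp (\<omega> * t) * norm v"
          using elim by (intro order_trans[OF norm_blinfun] mult_right_mono norm_U) auto
        also have "norm (t *\<^sub>R (q t - \<kappa>\<^sub>0 *\<^sub>R v)) = t * norm (q t - \<kappa>\<^sub>0 *\<^sub>R v)"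
          using elim by simp
        finally have "t * (\<kappa>\<^sub>0 * norm v - norm (q t - \<kappa>\<^sub>0 *\<^sub>R v)) \<le> (exp (\<omega> * t) - 1) * norm v"
          using elim by (simp add: algebra_simps)
        then show ?case using elim by (simp add: field_simps)
      qed
    qed
    then have "(\<kappa>\<^sub>0 - \<omega>) * norm v \<le> 0" by (simp add: algebra_simps)
    then have "v = 0" using kappa0 by (simp add: mult_le_0_iff)
    then have "x = z" by (simp add: v_def)
    with zA show "(x, y) \<in> A" by simp
  qed
qed (rule A_subset_generator_U)

end

subsection \<open>Orbits and Taylor expansion\<close>

text \<open>With w \<ge> 0 the factor exp(w t) is at least 1 and monotone in \<open>t\<close>, which
  the error estimates exploit.\<close>

locale semigroup_growth =
  fixes U :: "real \<Rightarrow> 'a::banach \<Rightarrow>\<^sub>L 'a" and w :: real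
  assumes C0: "C0_semigroup U" and w: "w \<ge> 0" and norm_U: "\<And>t. t \<ge> 0 \<Longrightarrow> norm (U t) \<le> exp (w * t)"
begin

lemma U_0: "U 0 = id_blinfun"
  using C0 by (simp add: C0_semigroup_def)

lemma U_add: "r \<ge> 0 \<Longrightarrow> t \<ge> 0 \<Longrightarrow> U (r + t) x = U r (U t x)"
  using C0 by (simp add: C0_semigroup_def)

lemma U_continuous: "continuous_on {0..} (\<lambda>t. U t x)"
  using C0 by (simp add: C0_semigroup_def)

lemma norm_U_apply: "t \<ge> 0 \<Longrightarrow> norm (U t x) \<le> exp (w * t) * norm x"
  by (rule order_trans[OF norm_blinfun mult_right_mono[OF norm_U]]) auto

lemma generator_invariant:
  assumes xy: "(x, y) \<in> generator U" and r: "r \<ge> 0"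
  shows "(U r x, U r y) \<in> generator U"
proof -
  have "((\<lambda>t. U r ((U t x - x) /\<^sub>R t)) \<longlongrightarrow> U r y) (at_right 0)"
    using xy by (intro tendsto_intros) (simp add: generator_def)
  then have "((\<lambda>t. (U t (U r x) - U r x) /\<^sub>R t) \<longlongrightarrow> U r y) (at_right 0)"
  proof (rule Lim_transform_eventually)
    show "\<forall>\<^sub>F t in at_right 0. U r ((U t x - x) /\<^sub>R t) = (U t (U r x) - U r x) /\<^sub>R t"
      using eventually_at_right_less[of 0]
    proof eventually_elim
      case (elim t)
      then show ?case
        using U_add[OF r, of t x] U_add[OF _ r, of t x] by (simp add: blinfun.bilinear_simps add.commute)
    qed
  qed
  then show ?thesis by (simp add: generator_def)
qed

text \<open>The right derivative results from applying \<open>U t\<close> to the difference quotient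
  at 0. For the left one, U t x = U (t - h) (U h x), where the outer operator varies with
  \<open>h\<close>; the uniform bound and strong continuity handle this.\<close>

lemma orbit_has_vector_derivative:
  assumes xy: "(x, y) \<in> generator U" and t: "t > 0"
  shows "((\<lambda>r. U r x) has_vector_derivative U t y) (at t)"
proof -
  define q where "q = (\<lambda>h. (U h x - x) /\<^sub>R h)"
  have q: "(q \<longlongrightarrow> y) (at_right 0)" using xy by (simp add: generator_def q_def)
  have qh: "U h x - x = h *\<^sub>R q h" if "h > 0" for h using that by (simp add: q_def)
  define E where "E = (\<lambda>r. norm ((U r x - U t x) - (r - t) *\<^sub>R U t y) / norm (r - t))"
  have "(E \<longlongrightarrow> 0) (at_right t)"
    unfolding filterlim_at_right_to_0[of _ _ t]
  proof (rule Lim_transform_eventually)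
    have "((\<lambda>h. norm (U t (q h - y))) \<longlongrightarrow> norm (U t (y - y))) (at_right 0)"
      by (intro tendsto_intros q)
    then show "((\<lambda>h. norm (U t (q h - y))) \<longlongrightarrow> 0) (at_right 0)" by simp
    show "\<forall>\<^sub>F h in at_right 0. norm (U t (q h - y)) = E (h + t)"
      using eventually_at_right_less[of 0]
    proof eventually_elim
      case (elim h)
      have "U (h + t) x - U t x = U t (U h x - x)"
        using U_add[of t h x] t elim by (simp add: blinfun.bilinear_simps add.commute)
      then have "(U (h + t) x - U t x) - h *\<^sub>R U t y = h *\<^sub>R U t (q h - y)"
        using elim by (simp add: qh blinfun.bilinear_simps scaleR_diff_right)
      then show ?case using elim by (simp add: E_def)
    qed
  qed
  moreover have "(E \<longlongrightarrow> 0) (at_left t)"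
    unfolding filterlim_at_left_to_right[of _ _ t] filterlim_at_right_to_0[of _ _ "- t"]
  proof (rule tendsto_sandwich[OF _ _ tendsto_const])
    have *: "((\<lambda>h. U (t - h) y) \<longlongrightarrow> U (t - 0) y) (at_right 0)"
    proof -
      have "isCont (\<lambda>r. U r y) t"
        using continuous_on_interior[OF U_continuous[of y], of t] t by simp
      then have "((\<lambda>r. U r y) \<longlongrightarrow> U t y) (at t)" by (simp add: isCont_def)
      moreover have "filterlim (\<lambda>h. t - h) (at t) (at_right 0)"
        unfolding filterlim_at
        by (intro conjI) (auto intro!: tendsto_eq_intros simp: eventually_at_filter)
      ultimately show ?thesis using filterlim_compose by fastforce
    qed
    have "((\<lambda>h. exp (w * t) * norm (q h - y) + norm (U (t - h) y - U t y)) \<longlongrightarrow>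
        exp (w * t) * norm (y - y) + norm (U (t - 0) y - U t y)) (at_right 0)"
      by (rule tendsto_add[OF tendsto_mult[OF tendsto_const tendsto_norm[OF tendsto_diff[OF q tendsto_const]]]
            tendsto_norm[OF tendsto_diff[OF * tendsto_const]]])
    then show "((\<lambda>h. exp (w * t) * norm (q h - y) + norm (U (t - h) y - U t y)) \<longlongrightarrow> 0) (at_right 0)" by simp
    have "\<forall>\<^sub>F h in at_right 0. h \<in> {0<..<t}" using t by (rule eventually_at_right_real)
    then show "\<forall>\<^sub>F h in at_right 0. E (- (h + - t)) \<le> exp (w * t) * norm (q h - y) + norm (U (t - h) y - U t y)"
    proof eventually_elim
      case (elim h)
      then have h: "h > 0" "h < t" by auto
      have "U t x = U (t - h) (U h x)" using U_add[of "t - h" h x] h by simp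
      then have "U (t - h) x - U t x = - (h *\<^sub>R U (t - h) (q h))"
        using qh[OF h(1)] by (metis blinfun.diff_right blinfun.scaleR_right minus_diff_eq)
      then have "(U (t - h) x - U t x) - (t - h - t) *\<^sub>R U t y
          = h *\<^sub>R - (U (t - h) (q h - y) + (U (t - h) y - U t y))"
        by (simp add: blinfun.bilinear_simps algebra_simps)
      then have "E (t - h) = norm (U (t - h) (q h - y) + (U (t - h) y - U t y))"
        using h unfolding E_def by (simp del: minus_add_distrib)
      also have "\<dots> \<le> norm (U (t - h) (q h - y)) + norm (U (t - h) y - U t y)" by (rule norm_triangle_ineq)
      also have "norm (U (t - h) (q h - y)) \<le> exp (w * (t - h)) * norm (q h - y)"
        using h by (intro norm_U_apply) simp
      also have "\<dots> \<le> exp (w * t) * norm (q h - y)"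
        using h w by (intro mult_right_mono) (auto intro: mult_left_mono)
      finally show ?case by simp
    qed
  qed (auto simp: E_def)
  ultimately have "(E \<longlongrightarrow> 0) (at t)" by (intro filterlim_split_at)
  then show ?thesis
    unfolding has_vector_derivative_def has_derivative_iff_norm E_def
    by (auto intro!: bounded_linear_intros)
qed

text \<open>The derivative of the remainder for \<open>x 0\<close> is the remainder of one order
  less for \<open>x 1\<close>, so the mean value inequality with majorant \<phi> closes the
  induction.\<close>

lemma taylor_bound:
  assumes "\<And>k. k < m \<Longrightarrow> (x k, x (Suc k)) \<in> generator U" and "t \<ge> 0"
  shows "norm (U t (x 0) - (\<Sum>k<m. (t ^ k / fact k) *\<^sub>R x k)) \<le> t ^ m / fact m * exp (w * t) * norm (x m)"
  using assms
proof (induction m arbitrary: x t)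
  case 0
  then show ?case using norm_U_apply by simp
next
  case (Suc m)
  define F where "F = (\<lambda>r. U r (x 0) - (\<Sum>k<Suc m. (r ^ k / fact k) *\<^sub>R x k))"
  define F' where "F' = (\<lambda>r. U r (x 1) - (\<Sum>k<m. (r ^ k / fact k) *\<^sub>R x (Suc k)))"
  define N where "N = norm (x (Suc m))"
  define \<phi> where "\<phi> = (\<lambda>r. r ^ Suc m / fact (Suc m) * exp (w * r) * N)"
  have gen0: "(x 0, x 1) \<in> generator U" using Suc.prems(1)[of 0] by simp
  have F': "norm (F' r) \<le> r ^ m / fact m * exp (w * r) * N" if "r \<ge> 0" for r
    using Suc.IH[of "\<lambda>k. x (Suc k)" r] Suc.prems that by (simp add: F'_def N_def)
  show ?case
  proof (cases "t = 0")
    case True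
    then show ?thesis by (simp add: U_0 sum.lessThan_Suc_shift del: sum.lessThan_Suc)
  next
    case False
    with Suc.prems have t: "t > 0" by simp
    have dF: "(F has_vector_derivative F' r) (at r)" if r: "r > 0" for r
    proof -
      have "((\<lambda>r. (r ^ Suc k / fact (Suc k)) *\<^sub>R x (Suc k)) has_vector_derivative (r ^ k / fact k) *\<^sub>R x (Suc k)) (at r)" for k
      proof -
        have "((\<lambda>r. r ^ Suc k / fact (Suc k)) has_field_derivative r ^ k / fact k) (at r)"
          by (rule derivative_eq_intros refl | simp)+
        from has_vector_derivative_scaleR[OF this has_vector_derivative_const] show ?thesis by simp
      qed
      then have "((\<lambda>r. U r (x 0) - (x 0 + (\<Sum>k<m. (r ^ Suc k / fact (Suc k)) *\<^sub>R x (Suc k)))) has_vector_derivative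
          U r (x 1) - (0 + (\<Sum>k<m. (r ^ k / fact k) *\<^sub>R x (Suc k)))) (at r)"
        by (intro has_vector_derivative_diff has_vector_derivative_add has_vector_derivative_sum
            has_vector_derivative_const orbit_has_vector_derivative[OF gen0 r])
      then show ?thesis by (simp add: F_def F'_def sum.lessThan_Suc_shift del: sum.lessThan_Suc)
    qed
    \<comment> \<open>The term w \<phi> comes from the exponential factor; being nonnegative, it
      only enlarges the majorant.\<close>
    have dphi: "(\<phi> has_vector_derivative r ^ m / fact m * exp (w * r) * N + w * \<phi> r) (at r)" for r
      unfolding has_real_derivative_iff_has_vector_derivative[symmetric] \<phi>_def
      by (rule derivative_eq_intros refl | simp)+ (simp add: algebra_simps)
    have "norm (F t - F 0) \<le> \<phi> t - \<phi> 0"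
    proof (rule differentiable_bound_general[OF t _ _ dF dphi])
      show "continuous_on {0..t} F"
        unfolding F_def by (intro continuous_intros continuous_on_subset[OF U_continuous]) auto
      show "continuous_on {0..t} \<phi>"
        unfolding \<phi>_def by (intro continuous_intros) simp
      fix r :: real assume r: "0 < r"
      have "0 \<le> w * \<phi> r" using r w by (simp add: \<phi>_def N_def)
      then show "norm (F' r) \<le> r ^ m / fact m * exp (w * r) * N + w * \<phi> r"
        using F'[of r] r by linarith
    qed auto
    then show ?thesis
      by (simp add: F_def \<phi>_def N_def U_0 sum.lessThan_Suc_shift del: sum.lessThan_Suc)
  qed
qed

end

section \<open>The closure of the differential operator\<close>

text \<open>For |x - y| \<le> 1 a smaller exponent gives a larger power; for greater distances 2K
  bounds the difference. This brings two Hoelder functions to a common exponent.\<close>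

lemma HCb_weaken_exponent:
  fixes u :: "real \<Rightarrow> real"
  assumes K: "\<And>x. \<bar>u x\<bar> \<le> K" and L: "\<And>x y. \<bar>u x - u y\<bar> \<le> L * \<bar>x - y\<bar> powr \<theta>" and th: "0 < \<eta>" "\<eta> \<le> \<theta>"
  shows "\<bar>u x - u y\<bar> \<le> (\<bar>L\<bar> + 2 * K) * \<bar>x - y\<bar> powr \<eta>"
proof -
  have K0: "K \<ge> 0" using K[of 0] by linarith
  show ?thesis
  proof (cases "\<bar>x - y\<bar> \<le> 1")
    case True
    have "\<bar>u x - u y\<bar> \<le> \<bar>L\<bar> * \<bar>x - y\<bar> powr \<theta>"
      by (rule order_trans[OF L]) (auto intro: mult_right_mono)
    also have "\<dots> \<le> \<bar>L\<bar> * \<bar>x - y\<bar> powr \<eta>"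
      using True th by (intro mult_left_mono powr_mono') auto
    also have "\<dots> \<le> (\<bar>L\<bar> + 2 * K) * \<bar>x - y\<bar> powr \<eta>" using K0 by (intro mult_right_mono) auto
    finally show ?thesis .
  next
    case False
    have "\<bar>u x - u y\<bar> \<le> 2 * K" using K[of x] K[of y] by linarith
    also have "\<dots> \<le> (\<bar>L\<bar> + 2 * K) * 1" by simp
    also have "\<dots> \<le> (\<bar>L\<bar> + 2 * K) * \<bar>x - y\<bar> powr \<eta>"
      using False th K0 by (intro mult_left_mono ge_one_powr_ge_zero) auto
    finally show ?thesis .
  qed
qed

lemma HCbI_dominated:
  assumes f: "f \<in> HCb" and g: "g \<in> HCb" and K: "\<And>x. \<bar>h x\<bar> \<le> K"
    and L: "\<And>x y. \<bar>h x - h y\<bar> \<le> L * (\<bar>f x - f y\<bar> + \<bar>g x - g y\<bar>)" and L0: "L \<ge> 0"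
  shows "h \<in> HCb"
proof -
  obtain \<theta>1 L1 where 1: "0 < \<theta>1" "\<theta>1 \<le> 1" "\<And>x y. \<bar>f x - f y\<bar> \<le> L1 * \<bar>x - y\<bar> powr \<theta>1"
    using f by (auto simp: HCb_def)
  obtain \<theta>2 L2 where 2: "0 < \<theta>2" "\<theta>2 \<le> 1" "\<And>x y. \<bar>g x - g y\<bar> \<le> L2 * \<bar>x - y\<bar> powr \<theta>2"
    using g by (auto simp: HCb_def)
  define \<theta> where "\<theta> = min \<theta>1 \<theta>2"
  have th: "0 < \<theta>" "\<theta> \<le> 1" "\<theta> \<le> \<theta>1" "\<theta> \<le> \<theta>2" using 1 2 by (auto simp: \<theta>_def)
  have fg: "f \<in> UCb" "g \<in> UCb" using f g HCb_subset_UCb by auto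
  define M1 M2 where "M1 = \<bar>L1\<bar> + 2 * sup_norm f" and "M2 = \<bar>L2\<bar> + 2 * sup_norm g"
  have "\<bar>h x - h y\<bar> \<le> (L * (M1 + M2)) * \<bar>x - y\<bar> powr \<theta>" for x y
  proof -
    have "\<bar>h x - h y\<bar> \<le> L * (M1 * \<bar>x - y\<bar> powr \<theta> + M2 * \<bar>x - y\<bar> powr \<theta>)"
      unfolding M1_def M2_def
      by (intro order_trans[OF L] mult_left_mono add_mono L0 HCb_weaken_exponent[OF UCb_abs_le[OF fg(1)] 1(3) th(1,3)]
          HCb_weaken_exponent[OF UCb_abs_le[OF fg(2)] 2(3) th(1,4)])
    then show ?thesis by (simp add: algebra_simps)
  qed
  moreover have "bounded (range h)" using K by (auto simp: bounded_iff)
  ultimately show ?thesis using th(1,2) by (auto simp: HCb_def)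
qed

lemma HCb_add: "f \<in> HCb \<Longrightarrow> g \<in> HCb \<Longrightarrow> (\<lambda>x. f x + g x) \<in> HCb"
  by (rule HCbI_dominated[where L = 1 and f = f and g = g, OF _ _ UCb_abs_le[OF UCb_add]]) (auto dest: HCb_subset_UCb[THEN subsetD])

lemma HCb_mult:
  assumes "f \<in> HCb" "g \<in> HCb"
  shows "(\<lambda>x. f x * g x) \<in> HCb"
proof -
  have fg: "f \<in> UCb" "g \<in> UCb" using assms HCb_subset_UCb by auto
  show ?thesis
    by (rule HCbI_dominated[OF assms abs_mult_le_sup_norm[OF fg] abs_mult_diff_le[OF fg]])
      (simp add: fg sup_norm_nonneg)
qed

lemma HCb_const: "(\<lambda>_. k) \<in> HCb"
  by (auto simp: HCb_def intro!: exI[of _ 1])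

lemma UCb_n_1_subset_HCb: "f \<in> UCb_n (Suc n) \<Longrightarrow> f \<in> HCb"
proof -
  assume "f \<in> UCb_n (Suc n)"
  note f = UCb_n_SucD[OF this]
  have "\<bar>f x - f y\<bar> \<le> sup_norm (deriv f) * \<bar>x - y\<bar> powr 1" for x y
    using lipschitz_if_bounded_deriv[OF f(2) UCb_abs_le[OF UCb_n_UCb[OF f(3)]], of x y] by simp
  then show "f \<in> HCb" using UCb_bounded[OF f(1)] unfolding HCb_def
    by (intro CollectI conjI exI[of _ 1] exI[of _ "sup_norm (deriv f)"]) auto
qed

lemma HCb_inverse: "f \<in> HCb \<Longrightarrow> k > 0 \<Longrightarrow> (\<And>x. k \<le> f x) \<Longrightarrow> (\<lambda>x. 1 / f x) \<in> HCb"
  by (rule HCbI_dominated[OF _ _ abs_inverse_le abs_inverse_diff_le]) auto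

text \<open>The type of operators \<open>bop\<close> requires a space without isolated points, which
  ensures that the identity has norm 1.\<close>

instance ucb :: perfect_space
proof
  fix f :: ucb
  have one: "apply_ucb (Ucb (\<lambda>_. 1)) = (\<lambda>_. 1)" by (rule Ucb_inverse) simp
  have n1: "norm (Ucb (\<lambda>_. 1)) = 1" by (simp add: norm_ucb.rep_eq one sup_norm_def)
  show "\<not> open {f}"
  proof
    assume "open {f}"
    then obtain e where e: "e > 0" "\<And>y. dist y f < e \<Longrightarrow> y = f" by (auto simp: open_dist)
    have "f + (e / 2) *\<^sub>R Ucb (\<lambda>_. 1) = f"
      by (rule e(2)) (use e(1) n1 in \<open>simp add: dist_norm\<close>)
    then have "norm ((e / 2) *\<^sub>R Ucb (\<lambda>_. 1)) = 0" by simp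
    with e(1) n1 show False by simp
  qed
qed

section \<open>The differential operator on \<open>UCb_n 2\<close> and its resolvent\<close>

context elliptic
begin

definition graph :: "(ucb \<times> ucb) set" where
  "graph = {(u, v). apply_ucb u \<in> UCb_n 2 \<and> apply_ucb v = diff_expr a b c (apply_ucb u)}"

lemma hille_yosida_graph:
  assumes c_le: "\<And>x. c x \<le> \<gamma>"
  shows "\<exists>R \<kappa>\<^sub>0. hille_yosida graph R \<gamma> \<kappa>\<^sub>0"
proof -
  obtain \<kappa>1 where ex: "\<And>\<kappa> f. \<kappa> \<ge> \<kappa>1 \<Longrightarrow> f \<in> UCb \<Longrightarrow> \<exists>u \<in> UCb_n 2. \<forall>x. \<kappa> * u x - diff_expr a b c u x = f x"
    using resolvent_exists by blast
  define \<kappa>\<^sub>0 where "\<kappa>\<^sub>0 = max \<kappa>1 (\<gamma> + 1)"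
  \<comment> \<open>As a relation the resolvent equation is linear, and the maximum principle makes
    its solutions unique; \<open>R\<close> is then defined by choice and is linear by
    uniqueness.\<close>
  define solves where "solves = (\<lambda>\<kappa> f u. apply_ucb u \<in> UCb_n 2 \<and>
    (\<forall>x. \<kappa> * apply_ucb u x - diff_expr a b c (apply_ucb u) x = apply_ucb f x))"
  have bound: "norm u \<le> norm f / (\<kappa> - \<gamma>)" if "\<kappa> \<ge> \<kappa>\<^sub>0" "solves \<kappa> f u" for \<kappa> f u
  proof (rule norm_ucb_le)
    fix x
    have k: "\<gamma> < \<kappa>" using that by (simp add: \<kappa>\<^sub>0_def)
    have "(\<kappa> - \<gamma>) * \<bar>apply_ucb u x\<bar> \<le> norm f"
      by (rule resolvent_bound[OF _ c_le k]) (use that abs_apply_ucb_le_norm[of f] in \<open>auto simp: solves_def\<close>)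
    then show "\<bar>apply_ucb u x\<bar> \<le> norm f / (\<kappa> - \<gamma>)" using k by (simp add: field_simps)
  qed
  have lincomb: "solves \<kappa> (r *\<^sub>R f + s *\<^sub>R g) (r *\<^sub>R u + s *\<^sub>R v)" if "solves \<kappa> f u" "solves \<kappa> g v" for \<kappa> r s f g u v
  proof -
    have uv: "apply_ucb u \<in> UCb_n 2" "apply_ucb v \<in> UCb_n 2" using that by (auto simp: solves_def)
    have eq: "apply_ucb (r *\<^sub>R u + s *\<^sub>R v) = (\<lambda>x. r * apply_ucb u x + s * apply_ucb v x)" for u v
      by (auto simp: plus_ucb.rep_eq scaleR_ucb.rep_eq)
    have "\<kappa> * (r * apply_ucb u x + s * apply_ucb v x) -
        (r * diff_expr a b c (apply_ucb u) x + s * diff_expr a b c (apply_ucb v) x) =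
      r * (\<kappa> * apply_ucb u x - diff_expr a b c (apply_ucb u) x) +
        s * (\<kappa> * apply_ucb v x - diff_expr a b c (apply_ucb v) x)" for x
      by (simp add: algebra_simps)
    then show ?thesis
      using that unfolding solves_def eq diff_expr_lincomb[OF uv] by (simp add: UCb_n_lincomb)
  qed
  have unique: "u = v" if k: "\<kappa> \<ge> \<kappa>\<^sub>0" and "solves \<kappa> f u" "solves \<kappa> f v" for \<kappa> f u v
  proof -
    have "norm (1 *\<^sub>R u + (-1) *\<^sub>R v) \<le> norm (1 *\<^sub>R f + (-1) *\<^sub>R f) / (\<kappa> - \<gamma>)"
      by (rule bound[OF k lincomb[OF that(2,3)]])
    then show ?thesis by simp
  qed
  have exist: "\<exists>u. solves \<kappa> f u" if k: "\<kappa> \<ge> \<kappa>\<^sub>0" for \<kappa> f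
  proof -
    obtain u where u: "u \<in> UCb_n 2" "\<And>x. \<kappa> * u x - diff_expr a b c u x = apply_ucb f x"
      using ex[of \<kappa> "apply_ucb f"] k apply_ucb[of f] by (auto simp: \<kappa>\<^sub>0_def)
    then have "apply_ucb (Ucb u) = u" using UCb_n_UCb Ucb_inverse by blast
    then show ?thesis using u by (auto simp: solves_def intro!: exI[of _ "Ucb u"])
  qed
  define R where "R = (\<lambda>\<kappa>. Blinfun (\<lambda>f. SOME u. solves \<kappa> f u))"
  have R: "solves \<kappa> f (R \<kappa> f)" if k: "\<kappa> \<ge> \<kappa>\<^sub>0" for \<kappa> f
  proof -
    define r where "r = (\<lambda>f. SOME u. solves \<kappa> f u)"
    have r: "solves \<kappa> f (r f)" for f unfolding r_def using exist[OF k] by (rule someI_ex)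
    have "bounded_linear r"
    proof (rule bounded_linear_intro[of _ "1 / (\<kappa> - \<gamma>)"])
      fix f g :: ucb and s :: real
      show "r (f + g) = r f + r g"
        using unique[OF k r[of "f + g"]] lincomb[OF r[of f] r[of g], of 1 1] by simp
      show "r (s *\<^sub>R f) = s *\<^sub>R r f"
        using unique[OF k r[of "s *\<^sub>R f"]] lincomb[OF r[of f] r[of f], of s 0] by simp
      show "norm (r f) \<le> norm f * (1 / (\<kappa> - \<gamma>))" using bound[OF k r[of f]] by simp
    qed
    then show ?thesis using r by (simp add: R_def r_def bounded_linear_Blinfun_apply)
  qed
  have graph_iff: "(x, y) \<in> graph \<longleftrightarrow> solves \<kappa> (\<kappa> *\<^sub>R x - y) x" for x y \<kappa>
    by (auto simp: graph_def solves_def minus_ucb.rep_eq scaleR_ucb.rep_eq)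
  have "hille_yosida graph R \<gamma> \<kappa>\<^sub>0"
  proof
    show "\<gamma> < \<kappa>\<^sub>0" by (simp add: \<kappa>\<^sub>0_def)
    fix \<kappa> assume k: "\<kappa>\<^sub>0 \<le> \<kappa>"
    then have k': "\<gamma> < \<kappa>" by (simp add: \<kappa>\<^sub>0_def)
    show "norm (R \<kappa>) \<le> 1 / (\<kappa> - \<gamma>)"
      by (rule norm_blinfun_bound) (use bound[OF k R[OF k]] k' in auto)
    show "(x, y) \<in> graph \<longleftrightarrow> R \<kappa> (\<kappa> *\<^sub>R x - y) = x" for x y
      unfolding graph_iff[of x y \<kappa>] using R[OF k] unique[OF k] by metis
  next
    fix f :: ucb and e :: real assume e: "e > 0"
    obtain g where g: "g \<in> UCb_n 2" "\<And>x. \<bar>g x - apply_ucb f x\<bar> \<le> e / 2"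
      using UCb_n_dense[OF apply_ucb[of f], of "e / 2" 2] e by auto
    have gU: "apply_ucb (Ucb g) = g" using g(1) UCb_n_UCb Ucb_inverse by blast
    have "diff_expr a b c g \<in> UCb"
      unfolding diff_expr_def by (intro UCb_add UCb_mult UCb_2D[OF g(1)] UCb_n_UCb[OF a] UCb_n_UCb[OF b] UCb_n_UCb[OF c])
    then have mem: "(Ucb g, Ucb (diff_expr a b c g)) \<in> graph" by (simp add: graph_def gU g(1) Ucb_inverse)
    have "norm (f - Ucb g) \<le> e / 2"
    proof (rule norm_ucb_le)
      show "\<bar>apply_ucb (f - Ucb g) x\<bar> \<le> e / 2" for x
        using g(2)[of x] by (simp add: minus_ucb.rep_eq gU abs_minus_commute)
    qed
    then have "norm (f - Ucb g) < e" using e by linarith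
    with mem show "\<exists>(y, z)\<in>graph. norm (f - y) < e" by (intro bexI[OF _ mem]) simp
  qed
  then show ?thesis by blast
qed

text \<open>The graph is closed because it is where R(\<kappa>u - v) = u, an equation between
  continuous maps. For density, \<kappa>x - y is approximated rather than x: boundedness of the
  resolvent then carries convergence over to both components of the graph.\<close>

lemma closure_op_A:
  assumes hc: "a \<in> HCb" "b \<in> HCb" "c \<in> HCb"
  shows "closure (op_A a b c) = graph"
proof
  have "\<And>x. c x \<le> sup_norm c"
    using UCb_abs_le[OF UCb_n_UCb[OF c]] by (simp add: abs_le_iff)
  then obtain R \<kappa> where "hille_yosida graph R (sup_norm c) \<kappa>"
    using hille_yosida_graph by blast
  then interpret hy: hille_yosida graph R "sup_norm c" \<kappa> .
  have sub: "op_A a b c \<subseteq> graph"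
    using HCb_n_subset_UCb_n by (auto simp: op_A_def graph_def)
  have "graph = {p. R \<kappa> (\<kappa> *\<^sub>R fst p - snd p) = fst p}"
    using hy.resolvent[of \<kappa>] by auto
  moreover have "closed {p. R \<kappa> (\<kappa> *\<^sub>R fst p - snd p) = fst p}"
    by (intro closed_Collect_eq continuous_intros)
  ultimately show "closure (op_A a b c) \<subseteq> graph" using sub by (metis closure_minimal)
  show "graph \<subseteq> closure (op_A a b c)"
  proof (rule subsetI, clarify)
    fix x y assume xy: "(x, y) \<in> graph"
    define f where "f = \<kappa> *\<^sub>R x - y"
    have "\<exists>g. apply_ucb g \<in> UCb_n 1 \<and> norm (g - f) \<le> 1 / real (Suc n)" for n
    proof -
      obtain h where h: "h \<in> UCb_n 1" "\<And>x. \<bar>h x - apply_ucb f x\<bar> \<le> 1 / real (Suc n)"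
        using UCb_n_dense[OF apply_ucb[of f], of "1 / real (Suc n)" 1] by auto
      have hU: "apply_ucb (Ucb h) = h" using h(1) UCb_n_UCb Ucb_inverse by blast
      have "norm (Ucb h - f) \<le> 1 / real (Suc n)"
        by (rule norm_ucb_le) (simp only: minus_ucb.rep_eq hU h(2))
      with h(1) hU show ?thesis by (intro exI[of _ "Ucb h"]) simp
    qed
    then obtain g where g: "\<And>n. apply_ucb (g n) \<in> UCb_n 1" "\<And>n. norm (g n - f) \<le> 1 / real (Suc n)"
      by metis
    have "(\<lambda>n. g n - f) \<longlonglongrightarrow> 0"
    proof (rule tendsto_norm_zero_cancel, rule tendsto_sandwich[OF _ _ tendsto_const])
      show "(\<lambda>n. 1 / real (Suc n)) \<longlonglongrightarrow> 0" by (rule LIMSEQ_Suc[OF lim_1_over_n])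
    qed (use g(2) in auto)
    then have gf: "g \<longlonglongrightarrow> f" by (simp add: LIM_zero_iff)
    have inA: "(R \<kappa> (g n), \<kappa> *\<^sub>R R \<kappa> (g n) - g n) \<in> op_A a b c" for n
    proof -
      define u where "u = apply_ucb (R \<kappa> (g n))"
      have "(R \<kappa> (g n), \<kappa> *\<^sub>R R \<kappa> (g n) - g n) \<in> graph" by (rule hy.R_in_A) simp
      then have u: "u \<in> UCb_n 2" and Au: "apply_ucb (\<kappa> *\<^sub>R R \<kappa> (g n) - g n) = diff_expr a b c u"
        by (auto simp: graph_def u_def)
      have u12: "u \<in> UCb_n (Suc 1)" using u by (simp add: numeral_2_eq_2)
      have Hu: "u \<in> HCb" "deriv u \<in> HCb"
        using UCb_n_1_subset_HCb[OF u12] UCb_n_1_subset_HCb[of "deriv u" 0] UCb_n_SucD(3)[OF u12] by auto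
      have Hg: "apply_ucb (g n) \<in> HCb" using UCb_n_1_subset_HCb[of _ 0] g(1)[of n] by simp
      \<comment> \<open>Every ingredient is Hoelder: the coefficients by assumption, u and u'
        because u lies in \<open>UCb_n 2\<close>, and \<open>g n\<close> because it is
        Lipschitz.\<close>
      have "deriv (deriv u) = (\<lambda>x. (1 / a x) * ((\<kappa> * u x + (-1) * apply_ucb (g n) x) + (-1) * (b x * deriv u x + c x * u x)))"
        unfolding second_deriv_eq[abs_def] Au[symmetric]
        by (rule ext) (simp add: minus_ucb.rep_eq scaleR_ucb.rep_eq u_def)
      also have "\<dots> \<in> HCb"
        by (intro HCb_mult HCb_add HCb_inverse[OF hc(1) a0] HCb_const hc Hu Hg)
      finally have H2: "deriv (deriv u) \<in> HCb" .
      have "u \<in> HCb_n 2"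
        unfolding HCb_n_def numeral_2_eq_2 with_derivs_in_Suc with_derivs_in_0
        using Hu H2 UCb_2D(4,5)[OF u] by (auto simp: real_differentiable_def)
      then show ?thesis using Au by (simp add: op_A_def u_def)
    qed
    have "(\<lambda>n. (R \<kappa> (g n), \<kappa> *\<^sub>R R \<kappa> (g n) - g n)) \<longlonglongrightarrow> (R \<kappa> f, \<kappa> *\<^sub>R R \<kappa> f - f)"
      by (intro tendsto_intros gf)
    moreover have "R \<kappa> f = x" using xy hy.resolvent[of \<kappa> x y] by (simp add: f_def)
    then have "(R \<kappa> f, \<kappa> *\<^sub>R R \<kappa> f - f) = (x, y)" by (simp add: f_def)
    ultimately show "(x, y) \<in> closure (op_A a b c)"
      unfolding closure_sequential using inA by (intro exI[of _ "\<lambda>n. (R \<kappa> (g n), \<kappa> *\<^sub>R R \<kappa> (g n) - g n)"]) auto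
  qed
qed

end

section \<open>Regularity of the semigroup and the convergence rate\<close>

context elliptic
begin

text \<open>Elliptic regularity propagates from the end of the chain to its start: each step back
  along A gains two derivatives. This supplies the regularity of orbits, for which only membership
  in the graph is known at the outset.\<close>

lemma graph_chain:
  assumes "2 * N \<le> p + 2" "\<forall>i<N. (x i, x (Suc i)) \<in> graph"
  shows "apply_ucb (x 0) \<in> UCb_n (2 * N) \<and> (\<forall>i\<le>N. apply_ucb (x i) = (diff_expr a b c ^^ i) (apply_ucb (x 0)))"
  using assms
proof (induction N arbitrary: x)
  case 0
  show ?case using apply_ucb[of "x 0"] by (simp add: UCb_n_0)
next
  case (Suc N)
  have N2: "2 * N \<le> p + 2" and N: "2 * N \<le> p" using Suc.prems(1) by simp_all
  have "\<forall>i<N. (x (Suc i), x (Suc (Suc i))) \<in> graph" using Suc.prems(2) by blast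
  note IH = Suc.IH[of "\<lambda>i. x (Suc i)", OF N2 this]
  have "(x 0, x (Suc 0)) \<in> graph" using Suc.prems(2) by blast
  then have 0: "apply_ucb (x 0) \<in> UCb_n 2" "apply_ucb (x (Suc 0)) = diff_expr a b c (apply_ucb (x 0))"
    unfolding graph_def by blast+
  have "diff_expr a b c (apply_ucb (x 0)) \<in> UCb_n (2 * N)"
    using conjunct1[OF IH] unfolding 0(2) .
  then have "apply_ucb (x 0) \<in> UCb_n (2 * N + 2)"
    using elliptic_estimate[OF N] 0(1) by blast
  then have "apply_ucb (x 0) \<in> UCb_n (2 * Suc N)" by simp
  moreover have "apply_ucb (x i) = (diff_expr a b c ^^ i) (apply_ucb (x 0))" if "i \<le> Suc N" for i
  proof (cases i)
    case (Suc j)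
    then have "apply_ucb (x i) = (diff_expr a b c ^^ j) (apply_ucb (x (Suc 0)))"
      using conjunct2[OF IH] that by blast
    then show ?thesis unfolding Suc 0(2) by (simp add: funpow_swap1)
  qed simp
  ultimately show ?case by blast
qed

text \<open>A^i f as an element of \<open>ucb\<close>, so that the semigroup can act on it; the lift
  is faithful for i \<le> N if f has order 2N.\<close>

definition iterate :: "ucb \<Rightarrow> nat \<Rightarrow> ucb" where
  "iterate f i = Ucb ((diff_expr a b c ^^ i) (apply_ucb f))"

lemma iterate:
  assumes "2 * N \<le> p + 2" "apply_ucb f \<in> UCb_n (2 * N)"
  shows "i \<le> N \<Longrightarrow> apply_ucb (iterate f i) = (diff_expr a b c ^^ i) (apply_ucb f)"
    and "i < N \<Longrightarrow> (iterate f i, iterate f (Suc i)) \<in> graph"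
    and "iterate f 0 = f"
proof -
  have reg: "(diff_expr a b c ^^ i) (apply_ucb f) \<in> UCb_n (2 * (N - i))" if "i \<le> N" for i
  proof -
    have "2 * (N - i) + 2 * i = 2 * N" using that by simp
    then show ?thesis using diff_expr_pow_UCb_n[of "2 * (N - i)" i] assms by auto
  qed
  show *: "apply_ucb (iterate f i) = (diff_expr a b c ^^ i) (apply_ucb f)" if "i \<le> N" for i
    unfolding iterate_def by (rule Ucb_inverse[OF UCb_n_UCb[OF reg[OF that]]])
  show "(iterate f i, iterate f (Suc i)) \<in> graph" if "i < N"
  proof -
    have "(diff_expr a b c ^^ i) (apply_ucb f) \<in> UCb_n 2"
      using reg[of i] UCb_n_mono[of 2 "2 * (N - i)"] that by auto
    then show ?thesis using that by (simp add: graph_def *)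
  qed
  show "iterate f 0 = f" by (simp add: iterate_def apply_ucb_inverse)
qed

lemma norm_iterate_le:
  assumes "2 * N \<le> p + 2" "i \<le> N"
  shows "\<exists>K\<ge>0. \<forall>f. apply_ucb f \<in> UCb_n (2 * N) \<longrightarrow> norm (iterate f i) \<le> K * cnorm (2 * N) (apply_ucb f)"
proof -
  obtain K where K: "K \<ge> 0" "\<And>u. u \<in> UCb_n (2 * i) \<Longrightarrow> cnorm 0 ((diff_expr a b c ^^ i) u) \<le> K * cnorm (2 * i) u"
    using diff_expr_pow_UCb_n[of 0 i] assms by auto
  have "norm (iterate f i) \<le> K * cnorm (2 * N) (apply_ucb f)" if f: "apply_ucb f \<in> UCb_n (2 * N)" for f
  proof -
    have "norm (iterate f i) = cnorm 0 ((diff_expr a b c ^^ i) (apply_ucb f))"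
      by (simp add: norm_ucb.rep_eq iterate(1)[OF assms(1) f assms(2)] cnorm_0)
    also have "\<dots> \<le> K * cnorm (2 * i) (apply_ucb f)"
      using UCb_n_mono[of "2 * i" "2 * N"] assms f by (intro K(2)) auto
    also have "\<dots> \<le> K * cnorm (2 * N) (apply_ucb f)"
      using assms f by (intro mult_left_mono K(1) cnorm_mono) auto
    finally show ?thesis .
  qed
  with K(1) show ?thesis by blast
qed

text \<open>Since \<open>U\<close> commutes with \<open>A\<close>, the norms of the iterates \<open>A\<^sup>i (U t f)\<close> are controlled by those of
  \<open>A\<^sup>i f\<close>, and they are equivalent to the norm of \<open>C\<^sup>2\<^sup>N\<close>.\<close>

lemma semigroup_regularity:
  assumes "semigroup_growth U w" and gen: "generator U = graph" and N: "2 * N \<le> p + 2"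
  shows "\<exists>K\<ge>0. \<forall>f t. apply_ucb f \<in> UCb_n (2 * N) \<longrightarrow> t \<ge> 0 \<longrightarrow> apply_ucb (U t f) \<in> UCb_n (2 * N) \<and>
    cnorm (2 * N) (apply_ucb (U t f)) \<le> K * exp (w * t) * cnorm (2 * N) (apply_ucb f)"
proof -
  interpret semigroup_growth U w by (rule assms(1))
  obtain K1 where K1: "K1 \<ge> 0" "\<And>u. u \<in> UCb_n (2 * N) \<Longrightarrow>
     cnorm (2 * N) u \<le> K1 * (\<Sum>i\<le>N. sup_norm ((diff_expr a b c ^^ i) u))"
    using cnorm_le_diff_expr_pow[OF N] by auto
  have "\<forall>i\<in>{..N}. \<exists>K\<ge>0. \<forall>f. apply_ucb f \<in> UCb_n (2 * N) \<longrightarrow> norm (iterate f i) \<le> K * cnorm (2 * N) (apply_ucb f)"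
    using norm_iterate_le[OF N] by auto
  then obtain K2 where K2: "\<And>i. i \<le> N \<Longrightarrow> K2 i \<ge> 0"
    "\<And>i f. i \<le> N \<Longrightarrow> apply_ucb f \<in> UCb_n (2 * N) \<Longrightarrow> norm (iterate f i) \<le> K2 i * cnorm (2 * N) (apply_ucb f)"
    by (metis atMost_iff)
  define K where "K = K1 * (\<Sum>i\<le>N. K2 i)"
  show ?thesis
  proof (intro exI[of _ K] conjI allI impI)
    show "K \<ge> 0" unfolding K_def using K1 K2 by (auto intro!: mult_nonneg_nonneg sum_nonneg)
    fix f and t :: real assume f: "apply_ucb f \<in> UCb_n (2 * N)" and t: "t \<ge> 0"
    \<comment> \<open>The semigroup maps the chain of iterates of \<open>f\<close> to a chain that
      starts at U t f and hence consists of the iterates of U t f.\<close>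
    have "\<forall>i<N. (U t (iterate f i), U t (iterate f (Suc i))) \<in> graph"
      using generator_invariant[OF _ t] iterate(2)[OF N f] gen by simp
    from graph_chain[OF N, of "\<lambda>i. U t (iterate f i)", OF this]
    have reg: "apply_ucb (U t f) \<in> UCb_n (2 * N)"
      and it: "\<And>i. i \<le> N \<Longrightarrow> apply_ucb (U t (iterate f i)) = (diff_expr a b c ^^ i) (apply_ucb (U t f))"
      by (auto simp: iterate(3)[OF N f])
    show "apply_ucb (U t f) \<in> UCb_n (2 * N)" by (rule reg)
    have "cnorm (2 * N) (apply_ucb (U t f)) \<le> K1 * (\<Sum>i\<le>N. sup_norm ((diff_expr a b c ^^ i) (apply_ucb (U t f))))"
      by (rule K1(2)[OF reg])
    also have "\<dots> \<le> K1 * (\<Sum>i\<le>N. exp (w * t) * (K2 i * cnorm (2 * N) (apply_ucb f)))"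
    proof (intro mult_left_mono sum_mono K1(1))
      fix i assume i: "i \<in> {..N}"
      have "sup_norm ((diff_expr a b c ^^ i) (apply_ucb (U t f))) = norm (U t (iterate f i))"
        using i it by (simp add: norm_ucb.rep_eq)
      also have "\<dots> \<le> exp (w * t) * norm (iterate f i)" by (rule norm_U_apply[OF t])
      also have "\<dots> \<le> exp (w * t) * (K2 i * cnorm (2 * N) (apply_ucb f))"
        using i by (intro mult_left_mono K2(2) f) auto
      finally show "sup_norm ((diff_expr a b c ^^ i) (apply_ucb (U t f))) \<le> exp (w * t) * (K2 i * cnorm (2 * N) (apply_ucb f))" .
    qed
    also have "\<dots> = K * exp (w * t) * cnorm (2 * N) (apply_ucb f)"
      by (simp add: K_def sum_distrib_left sum_distrib_right mult_ac)
    finally show "cnorm (2 * N) (apply_ucb (U t f)) \<le> K * exp (w * t) * cnorm (2 * N) (apply_ucb f)" .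
  qed
qed

lemma apply_ucb_sum: "apply_ucb (sum f I) x = (\<Sum>i\<in>I. apply_ucb (f i) x)"
  by (induction I rule: infinite_finite_induct) (auto simp: zero_ucb.rep_eq plus_ucb.rep_eq)

text \<open>The bound for a single step combines the hypothesis on \<open>S\<close> with the Taylor expansion of \<open>U\<close>;
  \<open>\<tau> \<le> 1\<close> is only needed to absorb \<open>\<tau>\<^sup>m\<^sup>+\<^sup>1\<close> into \<open>\<tau> powr (m + \<alpha>)\<close>.\<close>

lemma one_step_error:
  assumes "semigroup_growth U w" and gen: "generator U = graph" and N: "2 * N \<le> p + 2" and m: "Suc m \<le> N"
    and j: "j \<le> 2 * N" and B: "\<forall>i\<le>j. B i \<ge> 0" and alpha: "\<alpha> \<le> 1"
  shows "\<exists>E\<ge>0. \<forall>(S :: ucb) \<tau> f. apply_ucb f \<in> UCb_n (2 * N) \<longrightarrow> \<tau> > 0 \<longrightarrow> \<alpha> = 1 \<or> \<tau> \<le> 1 \<longrightarrow>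
     sup_norm (\<lambda>x. apply_ucb S x - (\<Sum>k = 0..m. \<tau> ^ k * (diff_expr a b c ^^ k) (apply_ucb f) x / fact k))
       \<le> \<tau> powr (real m + \<alpha>) * (\<Sum>i = 0..j. B i * sup_norm ((deriv ^^ i) (apply_ucb f))) \<longrightarrow>
     norm (S - U \<tau> f) \<le> E * \<tau> powr (real m + \<alpha>) * exp (w * \<tau>) * cnorm (2 * N) (apply_ucb f)"
proof -
  interpret semigroup_growth U w by (rule assms(1))
  obtain K where K: "K \<ge> 0" "\<And>f. apply_ucb f \<in> UCb_n (2 * N) \<Longrightarrow> norm (iterate f (Suc m)) \<le> K * cnorm (2 * N) (apply_ucb f)"
    using norm_iterate_le[OF N m] by auto
  define b0 where "b0 = (\<Sum>i = 0..j. B i)"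
  have b0: "b0 \<ge> 0" unfolding b0_def using B by (intro sum_nonneg) auto
  show ?thesis
  proof (intro exI[of _ "b0 + K"] conjI allI impI)
    show "b0 + K \<ge> 0" using b0 K by simp
    \<comment> \<open>A vector stands for S(\<tau>) f, so that \<open>E\<close> cannot depend on the
      family of operators.\<close>
    fix S :: ucb and \<tau> :: real and f
    assume f: "apply_ucb f \<in> UCb_n (2 * N)" and tau: "\<tau> > 0" "\<alpha> = 1 \<or> \<tau> \<le> 1"
      and S: "sup_norm (\<lambda>x. apply_ucb S x - (\<Sum>k = 0..m. \<tau> ^ k * (diff_expr a b c ^^ k) (apply_ucb f) x / fact k))
       \<le> \<tau> powr (real m + \<alpha>) * (\<Sum>i = 0..j. B i * sup_norm ((deriv ^^ i) (apply_ucb f)))"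
    define X where "X = cnorm (2 * N) (apply_ucb f)"
    have X: "X \<ge> 0" unfolding X_def by (rule cnorm_nonneg[OF f])
    \<comment> \<open>The Taylor polynomial common to both comparisons, as an element of
      \<open>ucb\<close>.\<close>
    define P where "P = (\<Sum>k<Suc m. (\<tau> ^ k / fact k) *\<^sub>R iterate f k)"
    have "apply_ucb (S - P) = (\<lambda>x. apply_ucb S x - (\<Sum>k = 0..m. \<tau> ^ k * (diff_expr a b c ^^ k) (apply_ucb f) x / fact k))"
    proof
      fix x
      have "apply_ucb P x = (\<Sum>k = 0..m. \<tau> ^ k * (diff_expr a b c ^^ k) (apply_ucb f) x / fact k)"
        unfolding P_def apply_ucb_sum atLeast0AtMost lessThan_Suc_atMost
        using m by (intro sum.cong) (auto simp: scaleR_ucb.rep_eq iterate(1)[OF N f])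
      then show "apply_ucb (S - P) x = apply_ucb S x - (\<Sum>k = 0..m. \<tau> ^ k * (diff_expr a b c ^^ k) (apply_ucb f) x / fact k)"
        by (simp add: minus_ucb.rep_eq)
    qed
    then have "norm (S - P) \<le> \<tau> powr (real m + \<alpha>) * (\<Sum>i = 0..j. B i * sup_norm ((deriv ^^ i) (apply_ucb f)))"
      using S by (simp add: norm_ucb.rep_eq)
    also have "\<dots> \<le> \<tau> powr (real m + \<alpha>) * (\<Sum>i = 0..j. B i * X)"
      unfolding X_def using j by (intro mult_left_mono sum_mono sup_norm_deriv_pow_le[OF f] B[rule_format]) auto
    also have "\<dots> = b0 * \<tau> powr (real m + \<alpha>) * 1 * X" by (simp add: b0_def sum_distrib_right sum_distrib_left mult_ac)
    also have "\<dots> \<le> b0 * \<tau> powr (real m + \<alpha>) * exp (w * \<tau>) * X"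
      using b0 X w tau by (intro mult_right_mono mult_left_mono mult_nonneg_nonneg) auto
    finally have 1: "norm (S - P) \<le> b0 * \<tau> powr (real m + \<alpha>) * exp (w * \<tau>) * X" .
    have "norm (U \<tau> f - P) \<le> \<tau> ^ Suc m / fact (Suc m) * exp (w * \<tau>) * norm (iterate f (Suc m))"
    proof -
      have "(iterate f k, iterate f (Suc k)) \<in> generator U" if "k < Suc m" for k
        unfolding gen using that m by (intro iterate(2)[OF N f]) simp
      from taylor_bound[of "Suc m" "iterate f" \<tau>, OF this] show ?thesis
        using tau by (simp add: P_def iterate(3)[OF N f])
    qed
    also have "\<dots> \<le> \<tau> powr (real m + \<alpha>) * exp (w * \<tau>) * (K * X)"
    proof (intro mult_mono K(2)[OF f, folded X_def] order_refl)
      have "\<tau> ^ Suc m / fact (Suc m) \<le> \<tau> ^ Suc m / 1"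
        using tau by (intro divide_left_mono fact_ge_1) auto
      also have "\<dots> = \<tau> powr (real m + 1)" using powr_realpow[OF tau(1), of "Suc m"] by (simp add: add.commute)
      also have "\<dots> \<le> \<tau> powr (real m + \<alpha>)"
        using tau alpha by (cases "\<alpha> = 1") (auto intro!: powr_mono')
      finally show "\<tau> ^ Suc m / fact (Suc m) \<le> \<tau> powr (real m + \<alpha>)" .
    qed (use tau in auto)
    finally have 2: "norm (U \<tau> f - P) \<le> K * \<tau> powr (real m + \<alpha>) * exp (w * \<tau>) * X" by (simp add: mult_ac)
    have "S - U \<tau> f = (S - P) - (U \<tau> f - P)" by simp
    then have "norm (S - U \<tau> f) \<le> norm (S - P) + norm (U \<tau> f - P)" by (metis norm_triangle_ineq4)
    with 1 2 show "norm (S - U \<tau> f) \<le> (b0 + K) * \<tau> powr (real m + \<alpha>) * exp (w * \<tau>) * cnorm (2 * N) (apply_ucb f)"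
      by (simp add: X_def algebra_simps)
  qed
qed

end

section \<open>Telescoping of the error\<close>

lemma blinfun_power_simps:
  "blinfun_power S 0 x = x" "blinfun_power S (Suc n) x = S (blinfun_power S n x)"
  by (simp_all add: blinfun_power_def)

lemma (in semigroup_growth) telescope:
  assumes "\<tau> \<ge> 0"
  shows "blinfun_power S n x - U (real n * \<tau>) x =
    (\<Sum>k<n. blinfun_power S (n - 1 - k) (S (U (real k * \<tau>) x) - U \<tau> (U (real k * \<tau>) x)))"
proof (induction n)
  case 0
  show ?case by (simp add: blinfun_power_simps U_0)
next
  case (Suc n)
  define d where "d = (\<lambda>k. S (U (real k * \<tau>) x) - U \<tau> (U (real k * \<tau>) x))"
  have "U (real (Suc n) * \<tau>) x = U \<tau> (U (real n * \<tau>) x)"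
    using U_add[of \<tau> "real n * \<tau>" x] assms by (simp add: algebra_simps)
  then have "blinfun_power S (Suc n) x - U (real (Suc n) * \<tau>) x = S (blinfun_power S n x - U (real n * \<tau>) x) + d n"
    by (simp add: d_def blinfun_power_simps blinfun.bilinear_simps)
  also have "\<dots> = (\<Sum>k<n. S (blinfun_power S (n - 1 - k) (d k))) + d n"
    unfolding Suc d_def blinfun.sum_right ..
  also have "\<dots> = (\<Sum>k<n. blinfun_power S (Suc n - 1 - k) (d k)) + blinfun_power S (Suc n - 1 - n) (d n)"
  proof -
    have "S (blinfun_power S (n - 1 - k) (d k)) = blinfun_power S (Suc n - 1 - k) (d k)" if "k < n" for k
    proof -
      have "Suc n - 1 - k = Suc (n - 1 - k)" using that by simp
      then show ?thesis by (simp only: blinfun_power_simps)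
    qed
    then show ?thesis by (simp add: blinfun_power_simps)
  qed
  finally show ?case by (simp add: d_def)
qed

text \<open>The n - 1 - k factors S, the local error and the k steps of U contribute exponents that
  add up to n w \<tau> for every k, so all n terms obey the same bound.\<close>

lemma (in semigroup_growth) telescope_bound:
  assumes tau: "\<tau> \<ge> 0" and M: "M \<ge> 0" and D: "D \<ge> 0"
    and S: "\<And>k. norm (blinfun_power S k) \<le> M * exp (real k * (w * \<tau>))"
    and step: "\<And>k. norm (S (U (real k * \<tau>) x) - U \<tau> (U (real k * \<tau>) x)) \<le> D * exp (w * \<tau>) * exp (real k * (w * \<tau>))"
  shows "norm (blinfun_power S n x - U (real n * \<tau>) x) \<le> real n * (M * D * exp (real n * (w * \<tau>)))"
proof -
  have "norm (blinfun_power S n x - U (real n * \<tau>) x) \<le> (\<Sum>k<n. M * D * exp (real n * (w * \<tau>)))"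
    unfolding telescope[OF tau]
  proof (rule sum_norm_le)
    fix k assume k: "k \<in> {..<n}"
    have "norm (blinfun_power S (n - 1 - k) (S (U (real k * \<tau>) x) - U \<tau> (U (real k * \<tau>) x))) \<le>
      (M * exp (real (n - 1 - k) * (w * \<tau>))) * (D * exp (w * \<tau>) * exp (real k * (w * \<tau>)))"
      using M D by (intro order_trans[OF norm_blinfun] mult_mono S step) auto
    also have "\<dots> = M * D * exp (real (n - 1 - k) * (w * \<tau>) + w * \<tau> + real k * (w * \<tau>))"
      by (simp add: exp_add)
    also have "real (n - 1 - k) * (w * \<tau>) + w * \<tau> + real k * (w * \<tau>) = real n * (w * \<tau>)"
    proof -
      have "real (n - 1 - k) + 1 + real k = real n" using k by auto
      from arg_cong[OF this, of "\<lambda>r. r * (w * \<tau>)"] show ?thesis by (simp only: distrib_right mult_1)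
    qed
    finally show "norm (blinfun_power S (n - 1 - k) (S (U (real k * \<tau>) x) - U \<tau> (U (real k * \<tau>) x))) \<le> M * D * exp (real n * (w * \<tau>))" .
  qed
  then show ?thesis by simp
qed

theorem theorem4p2:
  fixes m q qh :: nat
    and a b c :: "real \<Rightarrow> real"
    and M \<sigma> \<alpha> \<gamma> w :: real
    and B :: "nat \<Rightarrow> real"
  assumes "m \<ge> 1" and "q \<ge> 1" and "qh = 2 * ((q + 1) div 2)"
    and "a \<in> HCb_n (2 * m + qh - 2)"
    and "b \<in> HCb_n (2 * m + qh - 2)"
    and "c \<in> HCb_n (2 * m + qh - 2)"
    and "(INF x. a x) > 0"
    and "M \<ge> 1" and "\<sigma> \<ge> 0" and "\<alpha> \<le> 1" and "\<forall>i \<le> 2 * m + q. B i \<ge> 0"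
    and "\<gamma> = (SUP x. c x)" and "w = max (max \<sigma> \<gamma>) 0"
  shows "\<exists>C :: nat \<Rightarrow> real. (\<forall>i \<le> 2 * m + qh. C i \<ge> 0) \<and>
    (\<forall>(T :: real) (S :: real \<Rightarrow> ucb \<Rightarrow>\<^sub>L ucb).
      T > 0 \<longrightarrow>
      (\<forall>t \<in> {0<..T}. \<forall>k \<ge> 1. norm (blinfun_power (S t) k) \<le> M * exp (real k * \<sigma> * t)) \<longrightarrow>
      (\<forall>t \<in> {0<..T}. \<forall>f. apply_ucb f \<in> UCb_n (2 * m + q) \<longrightarrow>
         sup_norm (\<lambda>x. apply_ucb (S t f) x
                       - (\<Sum>k = 0..m. t ^ k * (diff_expr a b c ^^ k) (apply_ucb f) x / fact k))
           \<le> t powr (real m + \<alpha>)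
               * (\<Sum>i = 0..2 * m + q. B i * sup_norm ((deriv ^^ i) (apply_ucb f)))) \<longrightarrow>
      (\<exists>U :: real \<Rightarrow> ucb \<Rightarrow>\<^sub>L ucb.
         C0_semigroup U \<and> generator U = closure (op_A a b c) \<and>
         (\<forall>t \<ge> 0. norm (U t) \<le> exp (\<gamma> * t)) \<and>
         (\<forall>t > 0. \<forall>n :: nat. \<forall>f.
            n \<ge> 1 \<longrightarrow> real n \<ge> (if \<alpha> = 1 then t / T else max (t / T) t) \<longrightarrow>
            apply_ucb f \<in> UCb_n (2 * m + qh) \<longrightarrow>
            norm (blinfun_power (S (t / real n)) n f - U t f)
              \<le> M * t powr (real m + \<alpha>) * exp (w * t) / real n powr (real m - 1 + \<alpha>)
                  * (\<Sum>i = 0..2 * m + qh. C i * sup_norm ((deriv ^^ i) (apply_ucb f)))) \<and>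
         (\<alpha> > 1 - real m \<longrightarrow>
            (\<forall>T' > 0. \<forall>g.
               ((\<lambda>n. SUP t \<in> {0<..T'}. norm (blinfun_power (S (t / real n)) n g - U t g))
                  \<longlongrightarrow> 0) (inf sequentially (principal {n. real n \<ge> T' / T}))))))"
proof -
  define N where "N = m + (q + 1) div 2"
  define p where "p = 2 * m + qh - 2"
  have N2: "2 * m + qh = 2 * N" using assms(3) by (simp add: N_def)
  have qpos: "(q + 1) div 2 \<ge> 1" using assms(2) by simp
  have pN: "2 * N \<le> p + 2" and mN: "Suc m \<le> N" using assms(1) qpos N2 by (auto simp: p_def N_def)
  have jN: "2 * m + q \<le> 2 * N" by (simp add: N_def)
  have H: "a \<in> HCb" "b \<in> HCb" "c \<in> HCb"
    using assms(4-6) by (auto simp: HCb_n_def with_derivs_in_def)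
  have Up: "a \<in> UCb_n p" "b \<in> UCb_n p" "c \<in> UCb_n p"
    using assms(4-6) HCb_n_subset_UCb_n unfolding p_def by blast+
  have a_ge: "(INF x. a x) \<le> a x" for x
    using UCb_abs_le[OF UCb_n_UCb[OF Up(1)]]
    by (intro cINF_lower) (auto simp: bdd_below_def abs_le_iff intro!: exI[of _ "- sup_norm a"] dest: minus_le_iff[THEN iffD1])
  have c_le: "c x \<le> \<gamma>" for x
    unfolding assms(12) using UCb_abs_le[OF UCb_n_UCb[OF Up(3)]]
    by (intro cSUP_upper) (auto simp: bdd_above_def abs_le_iff)
  interpret elliptic a b c "INF x. a x" p
    using Up assms(7) a_ge by unfold_locales
  obtain R \<kappa> where "hille_yosida graph R \<gamma> \<kappa>" using hille_yosida_graph[OF c_le] by blast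
  then interpret hy: hille_yosida graph R \<gamma> \<kappa> .
  define U where "U = hy.U"
  have gen: "generator U = graph" unfolding U_def by (rule hy.generator_U)
  have w_ge: "w \<ge> 0" "\<gamma> \<le> w" "\<sigma> \<le> w" using assms(13) by auto
  have Ugr: "semigroup_growth U w"
  proof
    show "C0_semigroup U" unfolding U_def by (rule hy.C0_semigroup_U)
    show "norm (U t) \<le> exp (w * t)" if "t \<ge> 0" for t
      unfolding U_def using w_ge that by (intro order_trans[OF hy.norm_U]) (auto intro: mult_right_mono)
  qed (rule w_ge)
  interpret semigroup_growth U w by (rule Ugr)
  from one_step_error[OF Ugr gen pN mN jN assms(11,10)] obtain E where E: "E \<ge> 0"
    "\<forall>(S :: ucb) \<tau> f. apply_ucb f \<in> UCb_n (2 * N) \<longrightarrow> \<tau> > 0 \<longrightarrow> \<alpha> = 1 \<or> \<tau> \<le> 1 \<longrightarrow>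
     sup_norm (\<lambda>x. apply_ucb S x - (\<Sum>k = 0..m. \<tau> ^ k * (diff_expr a b c ^^ k) (apply_ucb f) x / fact k))
       \<le> \<tau> powr (real m + \<alpha>) * (\<Sum>i = 0..2 * m + q. B i * sup_norm ((deriv ^^ i) (apply_ucb f))) \<longrightarrow>
     norm (S - U \<tau> f) \<le> E * \<tau> powr (real m + \<alpha>) * exp (w * \<tau>) * cnorm (2 * N) (apply_ucb f)"
    by (elim exE conjE)
  from semigroup_regularity[OF Ugr gen pN] obtain K where K: "K \<ge> 0"
    "\<forall>f t. apply_ucb f \<in> UCb_n (2 * N) \<longrightarrow> t \<ge> 0 \<longrightarrow> apply_ucb (U t f) \<in> UCb_n (2 * N) \<and>
      cnorm (2 * N) (apply_ucb (U t f)) \<le> K * exp (w * t) * cnorm (2 * N) (apply_ucb f)"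
    by (elim exE conjE)
  show ?thesis
  \<comment> \<open>All C i are equal because the data are measured in \<open>cnorm\<close>;
    \<open>E\<close> and \<open>K\<close> are fixed before \<open>T\<close> and \<open>S\<close>
    appear.\<close>
  proof (intro exI[of _ "\<lambda>_. E * K"] conjI allI impI)
    show "0 \<le> E * K" using E K by simp
    fix T :: real and S :: "real \<Rightarrow> ucb \<Rightarrow>\<^sub>L ucb"
    assume T: "T > 0"
      and S1: "\<forall>t \<in> {0<..T}. \<forall>k \<ge> 1. norm (blinfun_power (S t) k) \<le> M * exp (real k * \<sigma> * t)"
      and S2: "\<forall>t \<in> {0<..T}. \<forall>f. apply_ucb f \<in> UCb_n (2 * m + q) \<longrightarrow>
         sup_norm (\<lambda>x. apply_ucb (S t f) x
                       - (\<Sum>k = 0..m. t ^ k * (diff_expr a b c ^^ k) (apply_ucb f) x / fact k))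
           \<le> t powr (real m + \<alpha>)
               * (\<Sum>i = 0..2 * m + q. B i * sup_norm ((deriv ^^ i) (apply_ucb f)))"
    have S1': "norm (blinfun_power (S t) k) \<le> M * exp (real k * (w * t))" if t: "t \<in> {0<..T}" for t k
    proof (cases "k \<ge> 1")
      case True
      then have "norm (blinfun_power (S t) k) \<le> M * exp (real k * \<sigma> * t)" using S1 t by blast
      also have "real k * \<sigma> * t \<le> real k * (w * t)"
        unfolding mult.assoc using w_ge t by (intro mult_left_mono mult_right_mono) auto
      then have "M * exp (real k * \<sigma> * t) \<le> M * exp (real k * (w * t))"
        using assms(8) by simp
      finally show ?thesis .
    next
      \<comment> \<open>The power 0 occurs in the last term of the telescoping sum; there M \<ge> 1
        supplies the bound.\<close>
      case False
      then have "k = 0" by simp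
      then show ?thesis using assms(8) norm_blinfun_id_le[where 'a = ucb] by (simp add: blinfun_power_def)
    qed
    have rate: "norm (blinfun_power (S (t / real n)) n f - U t f)
              \<le> M * t powr (real m + \<alpha>) * exp (w * t) / real n powr (real m - 1 + \<alpha>) * (E * K * cnorm (2 * N) (apply_ucb f))"
      if t: "t > 0" and n: "n \<ge> 1" "real n \<ge> (if \<alpha> = 1 then t / T else max (t / T) t)"
        and f: "apply_ucb f \<in> UCb_n (2 * N)" for t n f
    proof -
      define \<tau> where "\<tau> = t / real n"
      define X where "X = cnorm (2 * N) (apply_ucb f)"
      have X: "X \<ge> 0" unfolding X_def by (rule cnorm_nonneg[OF f])
      have npos: "real n > 0" using n(1) by simp
      have tau0: "\<tau> > 0" using t npos by (simp add: \<tau>_def)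
      have "t / T \<le> real n" using n(2) by (auto split: if_splits)
      then have tauT: "\<tau> \<in> {0<..T}" using tau0 T npos by (simp add: \<tau>_def field_simps)
      \<comment> \<open>For \<alpha> < 1 the threshold includes t precisely to ensure \<tau> \<le>
        1, as the one-step estimate demands.\<close>
      have tau1: "\<alpha> = 1 \<or> \<tau> \<le> 1" using n(2) npos by (auto simp: \<tau>_def split: if_splits)
      have nt: "real n * \<tau> = t" using npos by (simp add: \<tau>_def)
      define D where "D = E * \<tau> powr (real m + \<alpha>) * K * X"
      have "norm (blinfun_power (S \<tau>) n f - U (real n * \<tau>) f) \<le> real n * (M * D * exp (real n * (w * \<tau>)))"
      proof (rule telescope_bound)
        show "D \<ge> 0" using E(1) K(1) X by (simp add: D_def)
        show "norm (blinfun_power (S \<tau>) k) \<le> M * exp (real k * (w * \<tau>))" for k by (rule S1'[OF tauT])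
        fix k
        define g where "g = U (real k * \<tau>) f"
        have "0 \<le> real k * \<tau>" using tau0 by simp
        note g = K(2)[rule_format, OF f this, folded g_def X_def]
        have gq: "apply_ucb g \<in> UCb_n (2 * m + q)" using g UCb_n_mono[OF jN] by blast
        have "norm (S \<tau> g - U \<tau> g) \<le> E * \<tau> powr (real m + \<alpha>) * exp (w * \<tau>) * cnorm (2 * N) (apply_ucb g)"
          by (rule E(2)[rule_format, OF conjunct1[OF g] tau0 tau1 S2[rule_format, OF tauT gq]])
        also have "\<dots> \<le> E * \<tau> powr (real m + \<alpha>) * exp (w * \<tau>) * (K * exp (w * (real k * \<tau>)) * X)"
          using g E(1) by (intro mult_left_mono) auto
        also have "\<dots> = D * exp (w * \<tau>) * exp (real k * (w * \<tau>))" by (simp add: D_def mult_ac)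
        finally show "norm (S \<tau> (U (real k * \<tau>) f) - U \<tau> (U (real k * \<tau>) f)) \<le> D * exp (w * \<tau>) * exp (real k * (w * \<tau>))"
          by (simp add: g_def)
      qed (use tau0 assms(8) in auto)
      also have "real n * (w * \<tau>) = w * t" using nt by (simp add: mult_ac)
      also have "real n * (M * D * exp (w * t)) = M * (real n * \<tau> powr (real m + \<alpha>)) * exp (w * t) * (E * K * X)"
        by (simp add: D_def mult_ac)
      \<comment> \<open>Summing n local errors costs one power of n, which lowers the exponent from
        m + \<alpha> to m - 1 + \<alpha>.\<close>
      also have "real n * \<tau> powr (real m + \<alpha>) = t powr (real m + \<alpha>) / real n powr (real m - 1 + \<alpha>)"
      proof -
        have "real n powr (real m + \<alpha>) = real n * real n powr (real m - 1 + \<alpha>)"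
          using npos powr_add[of "real n" 1 "real m - 1 + \<alpha>"] by simp
        then show ?thesis using t npos by (simp add: \<tau>_def powr_divide)
      qed
      finally show ?thesis unfolding nt unfolding \<tau>_def X_def by simp
    qed
    have lim: "((\<lambda>n. SUP t \<in> {0<..T'}. norm (blinfun_power (S (t / real n)) n g - U t g)) \<longlongrightarrow> 0)
        (inf sequentially (principal {n. real n \<ge> T' / T}))"
      if alpha: "\<alpha> > 1 - real m" and T': "T' > 0" for T' g
    proof (rule tendstoI)
      fix e :: real assume e: "e > 0"
      \<comment> \<open>\<open>L\<close> bounds the joint effect of both evolutions on g - f. With
        the distance at most e/(4L), the replacement of g by f costs e/4, and e/4 is left for the
        smooth data.\<close>
      define L where "L = (M + 1) * exp (w * T')"
      have L: "L > 0" using assms(8) by (simp add: L_def)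
      define d where "d = e / (4 * L)"
      have d: "d > 0" using e L by (simp add: d_def)
      obtain h where h: "h \<in> UCb_n (2 * N)" "\<And>x. \<bar>h x - apply_ucb g x\<bar> \<le> d"
        using UCb_n_dense[OF apply_ucb[of g] d] by blast
      define f where "f = Ucb h"
      have fh: "apply_ucb f = h" unfolding f_def using h(1) UCb_n_UCb Ucb_inverse by blast
      have gf: "norm (g - f) \<le> d"
        by (rule norm_ucb_le) (simp add: minus_ucb.rep_eq fh abs_minus_commute h(2))
      define Y where "Y = M * T' powr (real m + \<alpha>) * exp (w * T') * (E * K * cnorm (2 * N) (apply_ucb f))"
      have ma: "real m - 1 + \<alpha> > 0" "real m + \<alpha> > 0" using alpha by auto
      have "(\<lambda>n. Y / real n powr (real m - 1 + \<alpha>)) \<longlonglongrightarrow> 0"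
      proof -
        have "(\<lambda>n. real n powr (- (real m - 1 + \<alpha>))) \<longlonglongrightarrow> 0"
          using ma(1) by (intro tendsto_neg_powr filterlim_real_sequentially) simp
        from tendsto_mult_right_zero[OF this, of Y] show ?thesis
          unfolding powr_minus_divide by simp
      qed
      then have "\<forall>\<^sub>F n in sequentially. Y / real n powr (real m - 1 + \<alpha>) < e / 4"
        using e by (intro order_tendstoD(2)) auto
      \<comment> \<open>n \<ge> T' yields t \<le> n for all t up to T', so the rate applies for
        every \<alpha>; n \<ge> 1 excludes the division by 0.\<close>
      moreover have "\<forall>\<^sub>F n in sequentially. real n \<ge> max T' 1"
        using filterlim_real_sequentially unfolding filterlim_at_top by blast
      ultimately have "\<forall>\<^sub>F n in sequentially. n \<in> {n. real n \<ge> T' / T} \<longrightarrow>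
          dist (SUP t \<in> {0<..T'}. norm (blinfun_power (S (t / real n)) n g - U t g)) 0 < e"
      proof eventually_elim
        case (elim n)
        have n: "n \<ge> 1" "real n \<ge> T'" using elim(2) by auto
        show ?case
        proof
          assume "n \<in> {n. real n \<ge> T' / T}"
          then have nT: "T' / T \<le> real n" by simp
          have bound: "norm (blinfun_power (S (t / real n)) n g - U t g) \<le> e / 2" if t: "t \<in> {0<..T'}" for t
          proof -
            have t': "t > 0" "t \<le> T'" using t by auto
            have "t / T \<le> T' / T" using t' T by (simp add: divide_right_mono)
            then have nt: "t / T \<le> real n" "t \<le> real n" using nT n t' by auto
            then have tn: "t / real n \<in> {0<..T}" using n(1) t' T by (simp add: field_simps)
            have ew: "exp (w * t) \<le> exp (w * T')" using t' w by (auto intro: mult_left_mono)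
            have "norm (blinfun_power (S (t / real n)) n f - U t f)
              \<le> M * t powr (real m + \<alpha>) * exp (w * t) / real n powr (real m - 1 + \<alpha>) * (E * K * cnorm (2 * N) (apply_ucb f))"
              using nt n t' h(1) fh by (intro rate) auto
            also have "\<dots> \<le> M * T' powr (real m + \<alpha>) * exp (w * T') / real n powr (real m - 1 + \<alpha>) * (E * K * cnorm (2 * N) (apply_ucb f))"
              using t' ma ew assms(8) E(1) K(1) cnorm_nonneg[of "apply_ucb f" "2 * N"] h(1) fh
              by (intro mult_right_mono divide_right_mono mult_mono powr_mono2 mult_nonneg_nonneg) auto
            also have "\<dots> = Y / real n powr (real m - 1 + \<alpha>)" by (simp add: Y_def)
            finally have 1: "norm (blinfun_power (S (t / real n)) n f - U t f) \<le> e / 4" using elim(1) by linarith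
            have "norm (blinfun_power (S (t / real n)) n) \<le> M * exp (w * t)"
              using S1'[OF tn, of n] n(1) by simp
            then have 2: "norm (blinfun_power (S (t / real n)) n (g - f)) \<le> M * exp (w * T') * d"
              using ew assms(8) gf by (intro order_trans[OF norm_blinfun] mult_mono order_trans[OF _ mult_left_mono[OF ew]]) auto
            have "norm (U t (g - f)) \<le> exp (w * t) * norm (g - f)" using t' by (intro norm_U_apply) simp
            then have 3: "norm (U t (g - f)) \<le> exp (w * T') * d"
              using ew gf by (elim order_trans) (intro mult_mono, auto)
            have "blinfun_power (S (t / real n)) n g - U t g =
                blinfun_power (S (t / real n)) n (g - f) + (blinfun_power (S (t / real n)) n f - U t f) - U t (g - f)"
              by (simp add: blinfun.bilinear_simps)
            also have "norm \<dots> \<le> norm (blinfun_power (S (t / real n)) n (g - f))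
                + norm (blinfun_power (S (t / real n)) n f - U t f) + norm (U t (g - f))"
              by (rule order_trans[OF norm_triangle_ineq4 add_right_mono[OF norm_triangle_ineq]])
            also have "\<dots> \<le> M * exp (w * T') * d + e / 4 + exp (w * T') * d" using 1 2 3 by linarith
            also have "\<dots> = L * d + e / 4" by (simp add: L_def algebra_simps)
            also have "L * d = e / 4" using L by (simp add: d_def)
            finally show ?thesis by simp
          qed
          have ne: "{0<..T'} \<noteq> {}" using T' by auto
          have "(SUP t \<in> {0<..T'}. norm (blinfun_power (S (t / real n)) n g - U t g)) \<le> e / 2"
            by (rule cSUP_least[OF ne bound])
          \<comment> \<open>A real supremum is informative only for sets bounded above;
            \<open>bound\<close> provides this.\<close>
          moreover have "0 \<le> (SUP t \<in> {0<..T'}. norm (blinfun_power (S (t / real n)) n g - U t g))"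
          proof (rule cSUP_upper2[where x = T'])
            show "bdd_above ((\<lambda>t. norm (blinfun_power (S (t / real n)) n g - U t g)) ` {0<..T'})"
              unfolding bdd_above_def using bound by blast
          qed (use T' in auto)
          ultimately show "dist (SUP t \<in> {0<..T'}. norm (blinfun_power (S (t / real n)) n g - U t g)) 0 < e"
            using e by (simp add: dist_real_def)
        qed
      qed
      then show "\<forall>\<^sub>F n in inf sequentially (principal {n. real n \<ge> T' / T}).
          dist (SUP t \<in> {0<..T'}. norm (blinfun_power (S (t / real n)) n g - U t g)) 0 < e"
        by (simp add: eventually_inf_principal)
    qed
    show "\<exists>U :: real \<Rightarrow> ucb \<Rightarrow>\<^sub>L ucb.
         C0_semigroup U \<and> generator U = closure (op_A a b c) \<and>
         (\<forall>t \<ge> 0. norm (U t) \<le> exp (\<gamma> * t)) \<and>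
         (\<forall>t > 0. \<forall>n :: nat. \<forall>f.
            n \<ge> 1 \<longrightarrow> real n \<ge> (if \<alpha> = 1 then t / T else max (t / T) t) \<longrightarrow>
            apply_ucb f \<in> UCb_n (2 * m + qh) \<longrightarrow>
            norm (blinfun_power (S (t / real n)) n f - U t f)
              \<le> M * t powr (real m + \<alpha>) * exp (w * t) / real n powr (real m - 1 + \<alpha>)
                  * (\<Sum>i = 0..2 * m + qh. E * K * sup_norm ((deriv ^^ i) (apply_ucb f)))) \<and>
         (\<alpha> > 1 - real m \<longrightarrow>
            (\<forall>T' > 0. \<forall>g.
               ((\<lambda>n. SUP t \<in> {0<..T'}. norm (blinfun_power (S (t / real n)) n g - U t g))
                  \<longlongrightarrow> 0) (inf sequentially (principal {n. real n \<ge> T' / T}))))"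
    proof (intro exI[of _ U] conjI allI impI)
      show "C0_semigroup U" by (rule C0)
      show "generator U = closure (op_A a b c)" unfolding gen by (rule closure_op_A[OF H, symmetric])
      show "norm (U t) \<le> exp (\<gamma> * t)" if "0 \<le> t" for t unfolding U_def by (rule hy.norm_U[OF that])
      show "norm (blinfun_power (S (t / real n)) n f - U t f)
              \<le> M * t powr (real m + \<alpha>) * exp (w * t) / real n powr (real m - 1 + \<alpha>)
                  * (\<Sum>i = 0..2 * m + qh. E * K * sup_norm ((deriv ^^ i) (apply_ucb f)))"
        if "0 < t" "1 \<le> n" "(if \<alpha> = 1 then t / T else max (t / T) t) \<le> real n"
          "apply_ucb f \<in> UCb_n (2 * m + qh)" for t n f
        using rate[OF that(1-3) that(4)[unfolded N2]]
        unfolding N2 cnorm_def sum_distrib_left[symmetric] .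
    qed (rule lim)
  qed
qed

end
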